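(* Let $\alpha\in(0,1)$ and $\lambda_1>0$, and let $(\mathcal N_t)_{t\ge 0}$ be an inhomogeneous Poisson process with rate function $\lambda_t=\lambda_1 t^{\alpha-1}$, $t>0$. Let $L_t$ be the longest gap before time $t$ and $\sigma_t$ its right-end position. Then $$\Big(\lambda_t L_t-b_t,\ \frac{t-\sigma_t}{t}\log t\Big)\ \longrightarrow\ (G,E_{\alpha(1-\alpha)})\quad\text{in distribution as } t\to\infty,$$ where $$b_t=\alpha\log t-\log\log t-\log\big(\alpha(1-\alpha)/\lambda_1\big),$$ and $G$ and $E_{\alpha(1-\alpha)}$ are independent random variables, $G$ having the Gumbel distribution and $E_{\alpha(1-\alpha)}$ the exponential distribution with rate $\alpha(1-\alpha)$.
   Context: The epochs (points) of $\mathcal N$ in increasing order are $0<T_1<T_2<\cdots$, with $T_0=0$, and the gaps are $R_i=T_i-T_{i-1}$, $i\ge1$. The longest gap before time $t$ and its right-end position are $$L_t=\max_{i\ge1}\{R_i: T_i\le t\},\qquad \sigma_t=\min_{i\ge1}\{T_i: R_i=L_t\}.$$ (They are defined on the event $\{T_1\le t\}$, whose probability tends to $1$; values assigned on the complement are irrelevant for the limit.) The Gumbel distribution has distribution function $\mathbb P(G\le x)=\exp(-e^{-x})$, $x\in\mathbb R$. *)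

theory Defs
  imports "HOL-Probability.Probability"
begin

text \<open>
  Paths are regular for every outcome. Unit jumps and divergence of the path are not required:
  for the rates considered here they hold almost surely, as a consequence of the law of the
  increments.
\<close>

definition counting_path :: "(real \<Rightarrow> nat) \<Rightarrow> bool" where
  "counting_path f \<longleftrightarrow>
     f 0 = 0 \<and> mono_on {0..} f \<and> (\<forall>t\<ge>0. continuous (at_right t) f)"

text \<open>
  The Poisson law is written out because \<^const>\<open>poisson_pmf\<close> is only specified for a strictly
  positive parameter. Only times \<open>t \<ge> 0\<close> matter. Subtraction of natural numbers is harmless
  below, since the paths are nondecreasing.
\<close>

definition inhomogeneous_poisson_process ::
  "'a measure \<Rightarrow> (real \<Rightarrow> 'a \<Rightarrow> nat) \<Rightarrow> (real \<Rightarrow> real) \<Rightarrow> bool" where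
  "inhomogeneous_poisson_process M N rate \<longleftrightarrow>
     prob_space M \<and>
     (\<forall>t>0. 0 \<le> rate t) \<and>
     (\<forall>t>0. set_integrable lborel {0<..t} rate) \<and>
     (\<forall>t\<ge>0. N t \<in> measurable M (count_space UNIV)) \<and>
     (\<forall>\<omega>\<in>space M. counting_path (\<lambda>t. N t \<omega>)) \<and>
     (\<forall>(n::nat) (\<tau>::nat \<Rightarrow> real). 0 \<le> \<tau> 0 \<longrightarrow> (\<forall>i<n. \<tau> i \<le> \<tau> (Suc i)) \<longrightarrow>
        prob_space.indep_vars M (\<lambda>_. count_space UNIV)
          (\<lambda>i \<omega>. N (\<tau> (Suc i)) \<omega> - N (\<tau> i) \<omega>) {..<n}) \<and>
     (\<forall>s t k. 0 \<le> s \<longrightarrow> s < t \<longrightarrow>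
        measure M {\<omega>\<in>space M. N t \<omega> - N s \<omega> = k} =
          (LINT u:{s<..t}|lborel. rate u) ^ k / fact k * exp (- (LINT u:{s<..t}|lborel. rate u)))"

text \<open>
  Since the path starts at 0, \<open>epoch N 0 \<omega> = 0\<close>. For \<open>i \<ge> 1\<close> this is the \<open>i\<close>-th point in
  increasing order, provided the path reaches level \<open>i\<close> (otherwise the value is unspecified).
\<close>

definition epoch :: "(real \<Rightarrow> 'a \<Rightarrow> nat) \<Rightarrow> nat \<Rightarrow> 'a \<Rightarrow> real" where
  "epoch N i \<omega> = Inf {t. 0 \<le> t \<and> i \<le> N t \<omega>}"

definition gap :: "(real \<Rightarrow> 'a \<Rightarrow> nat) \<Rightarrow> nat \<Rightarrow> 'a \<Rightarrow> real" where
  "gap N i \<omega> = epoch N i \<omega> - epoch N (i - 1) \<omega>"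

definition longest_gap :: "(real \<Rightarrow> 'a \<Rightarrow> nat) \<Rightarrow> real \<Rightarrow> 'a \<Rightarrow> real" where
  "longest_gap N t \<omega> = Max {gap N i \<omega> | i. 1 \<le> i \<and> epoch N i \<omega> \<le> t}"

text \<open>
  The set below ranges over all epochs and may be infinite, so \<^const>\<open>Min\<close> cannot be used. When
  the first epoch is at most \<open>t\<close> and the epochs tend to infinity, the infimum is attained.
\<close>

definition longest_gap_end :: "(real \<Rightarrow> 'a \<Rightarrow> nat) \<Rightarrow> real \<Rightarrow> 'a \<Rightarrow> real" where
  "longest_gap_end N t \<omega> = Inf {epoch N i \<omega> | i. 1 \<le> i \<and> gap N i \<omega> = longest_gap N t \<omega>}"

text \<open>
  The library's \<^const>\<open>weak_conv_m\<close> covers only sequences of laws on the real line. This is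
  the definition by bounded continuous test functions; measurability is demanded explicitly
  because the integral of a nonmeasurable function is 0 by convention.
\<close>

definition converges_in_distribution ::
  "'a measure \<Rightarrow> ('i \<Rightarrow> 'a \<Rightarrow> 'c::topological_space) \<Rightarrow> 'i filter \<Rightarrow>
   'b measure \<Rightarrow> ('b \<Rightarrow> 'c) \<Rightarrow> bool" where
  "converges_in_distribution M X F M' Y \<longleftrightarrow>
     (\<forall>\<^sub>F t in F. X t \<in> borel_measurable M) \<and> Y \<in> borel_measurable M' \<and>
     (\<forall>f :: 'c \<Rightarrow> real. continuous_on UNIV f \<longrightarrow> bounded (range f) \<longrightarrow>
        ((\<lambda>t. \<integral>\<omega>. f (X t \<omega>) \<partial>M) \<longlongrightarrow> (\<integral>\<omega>. f (Y \<omega>) \<partial>M')) F)"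

end

theory Submission
  imports Defs "HOL-Real_Asymp.Real_Asymp"
begin

text \<open>
Write \<open>\<Lambda>(s, t)\<close> for the mean number of points in \<open>(s, t]\<close>, put \<open>c = \<alpha> (1 - \<alpha>)\<close>, and let
\<open>\<ell>\<^sub>t(x) = (b\<^sub>t + x) / \<lambda>\<^sub>t\<close> be the gap length that is normalised to \<open>x\<close>. Around time
\<open>s = t (1 - y / log t)\<close>, gaps longer than \<open>\<ell>\<^sub>t(x)\<close> end at a rate of about
\<open>\<lambda>\<^sub>s exp (- \<ell>\<^sub>t(x) \<lambda>\<^sub>s)\<close>. There \<open>\<lambda>\<^sub>s\<close> exceeds \<open>\<lambda>\<^sub>t\<close> by the relative amount
\<open>(1 - \<alpha>) y / log t\<close>, while \<open>\<ell>\<^sub>t(x) \<lambda>\<^sub>t\<close> is about \<open>\<alpha> log t\<close>; so the exponent grows by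
\<open>c y\<close>, and the centering is exactly what turns the rate, measured in the coordinate \<open>y\<close>, into
\<open>c exp (- x - c y)\<close>. The long gaps, recorded as points (normalised length, \<open>y\<close>), therefore behave
like a Poisson process of intensity \<open>exp (- x) c exp (- c y)\<close>. Because this is a product, the
highest point has a Gumbel height and, independently, an exponential position.

The proof works with probabilities of finitely many increments instead of point processes. Cut a
time interval into small cells: a long gap is, up to two cells, a run of \<open>m\<close> empty cells, and the
cells are independent. If \<open>p n\<close> is the probability that the first \<open>n\<close> cells contain no such run,
then \<open>p (n + 1) = p n - p (n - m) w (n - m)\<close> exactly, where \<open>w j\<close> is the probability that cell
\<open>j\<close> is occupied and the next \<open>m\<close> cells are empty. This pins \<open>p\<close> down to \<open>exp (- \<Sum> w)\<close> up to
explicit errors (\<open>prob_no_run_le\<close>, \<open>prob_no_run_ge\<close>). The sum is computed by telescoping: with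
\<open>\<psi>(u) = exp (- \<Lambda>(u, u + l))\<close>, each \<open>w j\<close> is comparable to an increment of \<open>\<psi>\<close> divided by
\<open>1 - (u / (u + l)) powr (1 - \<alpha>)\<close>, since a power rate loses just this fraction over a lag \<open>l\<close>
(\<open>run_weight_le\<close>, \<open>run_weight_ge\<close>).

Gaps ending before and after \<open>t (1 - y / log t)\<close> are governed by disjoint cells, hence the
probability that all the former are at most \<open>\<ell>\<^sub>t(x\<^sub>1)\<close> and all the latter at most
\<open>\<ell>\<^sub>t(x\<^sub>2)\<close> converges to a product (\<open>gaps_below_limit\<close>). Comparing the two groups of gaps on a
fine grid of levels gives lower bounds for the probability that the longest gap has normalised
length at most \<open>x\<close> and ends late, and likewise early. The two bounds add up to the whole limiting
probability, so both are sharp (\<open>rectangle_limit\<close>). Finally, convergence of the probabilities of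
quadrants yields convergence in distribution by approximating test functions by step functions.
\<close>

section \<open>Runs of zeros in independent sequences\<close>

definition no_run :: "nat \<Rightarrow> nat \<Rightarrow> (nat \<Rightarrow> nat) \<Rightarrow> bool" where
  "no_run m n x \<longleftrightarrow> (\<forall>j. j + m \<le> n \<longrightarrow> (\<exists>i\<in>{j..<j+m}. x i \<noteq> 0))"

lemma no_run_cong: "(\<And>i. i < n \<Longrightarrow> x i = y i) \<Longrightarrow> no_run m n x = no_run m n y"
  unfolding no_run_def by (intro all_cong bex_cong) auto

lemma no_run_anti: "no_run m n x \<Longrightarrow> k \<le> n \<Longrightarrow> no_run m k x"
  unfolding no_run_def by auto

text \<open>
The run that is completed last occupies the final \<open>m\<close> places, and the place before it must be
nonzero because otherwise a run would have been completed earlier. The three conditions on the right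
concern disjoint sets of places; this is the source of the exact recursion below.
\<close>

lemma no_run_completes_iff:
  assumes "0 < m" "m \<le> n"
  shows "no_run m n x \<and> \<not> no_run m (Suc n) x \<longleftrightarrow>
    no_run m (n - m) x \<and> x (n - m) \<noteq> 0 \<and> (\<forall>i\<in>{n-m<..n}. x i = 0)"
proof (intro iffI; elim conjE)
  assume a: "no_run m n x" "\<not> no_run m (Suc n) x"
  from a(2) obtain j where j: "j + m \<le> Suc n" "\<forall>i\<in>{j..<j+m}. x i = 0"
    unfolding no_run_def by auto
  with a(1) have "j + m = Suc n" unfolding no_run_def by (metis le_Suc_eq)
  hence je: "j = Suc (n - m)" using assms by auto
  have z: "\<forall>i\<in>{n-m<..n}. x i = 0" using j(2) assms unfolding je by auto
  have "\<exists>i\<in>{n-m..<n-m+m}. x i \<noteq> 0"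
    using a(1)[unfolded no_run_def, rule_format, of "n - m"] assms by simp
  then obtain i where i: "i \<in> {n-m..<n}" "x i \<noteq> 0" using assms by auto
  hence "i = n - m" using z by (cases "i = n - m") auto
  thus "no_run m (n - m) x \<and> x (n - m) \<noteq> 0 \<and> (\<forall>i\<in>{n-m<..n}. x i = 0)"
    using i z no_run_anti[OF a(1)] by auto
next
  assume a: "no_run m (n - m) x" "x (n - m) \<noteq> 0" "\<forall>i\<in>{n-m<..n}. x i = 0"
  have "\<not> no_run m (Suc n) x"
    unfolding no_run_def not_all using a(3) assms by (intro exI[of _ "Suc (n - m)"]) auto
  moreover have "no_run m n x" unfolding no_run_def
  proof (intro allI impI)
    fix j assume j: "j + m \<le> n"
    show "\<exists>i\<in>{j..<j+m}. x i \<noteq> 0"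
    proof (cases "j + m \<le> n - m")
      case True thus ?thesis using a(1) unfolding no_run_def by blast
    next
      case False
      hence "n - m \<in> {j..<j+m}" using j by auto
      thus ?thesis using a(2) by blast
    qed
  qed
  ultimately show "no_run m n x \<and> \<not> no_run m (Suc n) x" by simp
qed

text \<open>
On finitely many coordinates of a sequence of naturals every predicate is measurable, so
independence of the coordinates gives independence of arbitrary predicates of disjoint blocks.
\<close>

lemma (in prob_space) prob_indep_coordinates:
  fixes X :: "'i \<Rightarrow> 'a \<Rightarrow> nat"
  assumes X: "indep_vars (\<lambda>_. count_space UNIV) X I"
    and AB: "finite A" "finite B" "A \<inter> B = {}" "A \<subseteq> I" "B \<subseteq> I"
    and P: "\<And>x y. (\<And>i. i \<in> A \<Longrightarrow> x i = y i) \<Longrightarrow> P x = P y"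
    and Q: "\<And>x y. (\<And>i. i \<in> B \<Longrightarrow> x i = y i) \<Longrightarrow> Q x = Q y"
  shows "\<P>(\<omega> in M. P (\<lambda>i. X i \<omega>) \<and> Q (\<lambda>i. X i \<omega>)) =
         \<P>(\<omega> in M. P (\<lambda>i. X i \<omega>)) * \<P>(\<omega> in M. Q (\<lambda>i. X i \<omega>))"
    and "{\<omega>\<in>space M. P (\<lambda>i. X i \<omega>)} \<in> events"
proof -
  let ?A = "{f \<in> PiE A (\<lambda>_. UNIV::nat set). P f}" and ?B = "{f \<in> PiE B (\<lambda>_. UNIV::nat set). Q f}"
  let ?S = "\<lambda>A. PiM A (\<lambda>_. count_space (UNIV::nat set))"
  let ?X = "\<lambda>A \<omega>. restrict (\<lambda>i. X i \<omega>) A"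
  have S: "?A \<in> sets (?S A)" "?B \<in> sets (?S B)"
    using AB by (auto simp: count_space_PiM_finite)
  have ind: "indep_var (?S A) (?X A) (?S B) (?X B)"
    by (rule indep_var_restrict[OF X AB(3,4,5)])
  have eA: "?X A -` ?A \<inter> space M = {\<omega>\<in>space M. P (\<lambda>i. X i \<omega>)}"
    using P[of "?X A _" "\<lambda>i. X i _"] by auto
  have eB: "?X B -` ?B \<inter> space M = {\<omega>\<in>space M. Q (\<lambda>i. X i \<omega>)}"
    using Q[of "?X B _" "\<lambda>i. X i _"] by auto
  have "(\<lambda>\<omega>. (?X A \<omega>, ?X B \<omega>)) -` (?A \<times> ?B) \<inter> space M
      = (?X A -` ?A \<inter> space M) \<inter> (?X B -` ?B \<inter> space M)" by auto
  also have "\<dots> = {\<omega>\<in>space M. P (\<lambda>i. X i \<omega>) \<and> Q (\<lambda>i. X i \<omega>)}" unfolding eA eB by auto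
  finally show "\<P>(\<omega> in M. P (\<lambda>i. X i \<omega>) \<and> Q (\<lambda>i. X i \<omega>)) =
         \<P>(\<omega> in M. P (\<lambda>i. X i \<omega>)) * \<P>(\<omega> in M. Q (\<lambda>i. X i \<omega>))"
    using indep_varD[OF ind S] eA eB by simp
  show "{\<omega>\<in>space M. P (\<lambda>i. X i \<omega>)} \<in> events"
    using measurable_sets[OF indep_var_rv1[OF ind] S(1)] eA by simp
qed

lemma exp_le_one_minus:
  assumes "0 \<le> w" "w \<le> \<eta>" "\<eta> < (1::real)"
  shows "exp (- (w / (1 - \<eta>))) \<le> 1 - w"
proof -
  have "w / (1 - w) \<le> w / (1 - \<eta>)" using assms by (intro divide_left_mono) auto
  hence "exp (- (w / (1 - \<eta>))) \<le> exp (- (w / (1 - w)))" by simp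
  also have "\<dots> = 1 / exp (w / (1 - w))" by (simp add: exp_minus inverse_eq_divide)
  also have "\<dots> \<le> 1 / (1 + w / (1 - w))"
    using assms exp_ge_add_one_self[of "w / (1 - w)"] 
    by (intro divide_left_mono mult_pos_pos) (auto intro: add_pos_nonneg)
  also have "\<dots> = 1 - w" using assms by (simp add: field_simps)
  finally show ?thesis .
qed

context prob_space
begin

text \<open>
Let \<open>p k\<close> be the probability of no run among the first \<open>k\<close> places. The recursion
\<open>p (k + 1) = p k - p (k - m) w (k - m)\<close> together with \<open>p k \<le> p (k - m)\<close> gives
\<open>p (k + 1) \<le> p k (1 - w (k - m))\<close>, whence the upper bound. For the lower bound, \<open>\<delta>\<close> dominates the
loss of \<open>p\<close> over a stretch of \<open>m\<close> places, that is \<open>p (k - m) \<le> p k + \<delta>\<close>; then \<open>p + \<delta>\<close>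
satisfies the reverse inequality \<open>p (k + 1) + \<delta> \<ge> (p k + \<delta>) (1 - w (k - m))\<close>.
\<close>

lemma
  fixes X :: "nat \<Rightarrow> 'a \<Rightarrow> nat"
  assumes X: "indep_vars (\<lambda>_. count_space UNIV) X {..<n}"
    and m: "0 < m" "m \<le> n"
    and w: "\<And>j. j < n - m \<Longrightarrow>
      w j = \<P>(\<omega> in M. X j \<omega> \<noteq> 0) * \<P>(\<omega> in M. \<forall>i\<in>{j<..j+m}. X i \<omega> = 0)"
  shows prob_no_run_le: "\<P>(\<omega> in M. no_run m n (\<lambda>i. X i \<omega>)) \<le> exp (- (\<Sum>j<n-m. w j))"
    and prob_no_run_ge:
      "\<lbrakk>\<And>j. j < n - m \<Longrightarrow> w j \<le> \<eta>; \<eta> < 1;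
        \<And>k. \<P>(\<omega> in M. \<forall>i<m. X i \<omega> = 0) + (\<Sum>j\<in>{k..<k+m}\<inter>{..<n-m}. w j) \<le> \<delta>\<rbrakk> \<Longrightarrow>
       exp (- ((\<Sum>j<n-m. w j) / (1 - \<eta>))) - \<delta> \<le> \<P>(\<omega> in M. no_run m n (\<lambda>i. X i \<omega>))"
proof -
  define p where "p k = \<P>(\<omega> in M. no_run m k (\<lambda>i. X i \<omega>))" for k
  have ev: "{\<omega>\<in>space M. no_run m k (\<lambda>i. X i \<omega>)} \<in> events" if "k \<le> n" for k
  proof (rule prob_indep_coordinates(2)[OF X, where B="{}" and A="{..<k}" and Q="\<lambda>_. True"
        and P="no_run m k"])
    show "no_run m k x = no_run m k y" if "\<And>i. i \<in> {..<k} \<Longrightarrow> x i = y i" for x y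
      using that by (intro no_run_cong) auto
  qed (use that in auto)
  have w0: "0 \<le> w j" if "j < n - m" for j using w[OF that] by simp
  have step: "p (Suc k) = p k - p (k - m) * w (k - m)" if k: "m \<le> k" "k < n" for k
  proof -
    let ?R = "\<lambda>x::nat\<Rightarrow>nat. x (k - m) \<noteq> 0 \<and> (\<forall>i\<in>{k-m<..k}. x i = 0)"
    have 1: "p k - p (Suc k) = prob ({\<omega>\<in>space M. no_run m k (\<lambda>i. X i \<omega>)} - {\<omega>\<in>space M. no_run m (Suc k) (\<lambda>i. X i \<omega>)})"
      unfolding p_def using k ev[of k] ev[of "Suc k"]
      by (subst finite_measure_Diff) (auto intro: no_run_anti)
    have "(no_run m k (\<lambda>i. X i \<omega>) \<and> \<not> no_run m (Suc k) (\<lambda>i. X i \<omega>)) =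
      (no_run m (k - m) (\<lambda>i. X i \<omega>) \<and> ?R (\<lambda>i. X i \<omega>))" for \<omega>
      by (rule no_run_completes_iff[OF m(1) k(1)])
    note c = this
    have "{\<omega>\<in>space M. no_run m k (\<lambda>i. X i \<omega>)} - {\<omega>\<in>space M. no_run m (Suc k) (\<lambda>i. X i \<omega>)}
      = {\<omega>\<in>space M. no_run m k (\<lambda>i. X i \<omega>) \<and> \<not> no_run m (Suc k) (\<lambda>i. X i \<omega>)}"
      by auto
    hence "p k - p (Suc k) = \<P>(\<omega> in M. no_run m (k - m) (\<lambda>i. X i \<omega>) \<and> ?R (\<lambda>i. X i \<omega>))"
      by (simp only: 1 c)
    also have "\<dots> = p (k - m) * \<P>(\<omega> in M. ?R (\<lambda>i. X i \<omega>))"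
      unfolding p_def
    proof (rule prob_indep_coordinates(1)[OF X, where A="{..<k-m}" and B="{k-m..k}"
          and P="no_run m (k-m)" and Q="?R"])
      show "no_run m (k-m) x = no_run m (k-m) y" if "\<And>i. i \<in> {..<k-m} \<Longrightarrow> x i = y i" for x y
        using that by (intro no_run_cong) auto
      show "?R x = ?R y" if "\<And>i. i \<in> {k-m..k} \<Longrightarrow> x i = y i" for x y
        using that by (intro conj_cong ball_cong arg_cong2[where f="(=)"] arg_cong[where f=Not]) auto
    qed (use k in auto)
    also have "\<P>(\<omega> in M. ?R (\<lambda>i. X i \<omega>)) = \<P>(\<omega> in M. X (k-m) \<omega> \<noteq> 0) * \<P>(\<omega> in M. \<forall>i\<in>{k-m<..k}. X i \<omega> = 0)"
    proof (rule prob_indep_coordinates(1)[OF X, where A="{k-m}" and B="{k-m<..k}"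
          and P="\<lambda>x. x (k-m) \<noteq> 0" and Q="\<lambda>x. \<forall>i\<in>{k-m<..k}. x i = 0"])
      show "(x (k-m) \<noteq> 0) = (y (k-m) \<noteq> 0)" if "\<And>i. i \<in> {k-m} \<Longrightarrow> x i = y i" for x y :: "nat \<Rightarrow> nat"
        using that by simp
      show "(\<forall>i\<in>{k-m<..k}. x i = 0) = (\<forall>i\<in>{k-m<..k}. y i = 0)"
        if "\<And>i. i \<in> {k-m<..k} \<Longrightarrow> x i = y i" for x y :: "nat \<Rightarrow> nat"
        using that by simp
    qed (use k in auto)
    also have "\<dots> = w (k - m)" using k by (subst w) auto
    finally show ?thesis by simp
  qed
  have mono: "p k \<le> p j" if "j \<le> k" "k \<le> n" for j k
    unfolding p_def using that ev by (intro finite_measure_mono) (auto intro: no_run_anti)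
  have p01: "0 \<le> p k" "p k \<le> 1" for k by (auto simp: p_def)
  have up: "p (m + i) \<le> exp (- (\<Sum>j<i. w j))" if "m + i \<le> n" for i
    using that
  proof (induction i)
    case (Suc i)
    have "p (m + Suc i) = p (m + i) - p i * w i" using step[of "m+i"] Suc.prems by simp
    also have "\<dots> \<le> p (m + i) - p (m + i) * w i"
      using w0[of i] mono[of i "m+i"] Suc.prems by (auto intro: mult_right_mono)
    also have "\<dots> = p (m + i) * (1 - w i)" by (simp add: algebra_simps)
    also have "\<dots> \<le> p (m + i) * exp (- w i)" using p01 exp_ge_add_one_self[of "- w i"]
      by (intro mult_left_mono) auto
    also have "\<dots> \<le> exp (- (\<Sum>j<i. w j)) * exp (- w i)"
      using Suc by (intro mult_right_mono) auto
    also have "\<dots> = exp (- (\<Sum>j<Suc i. w j))" by (simp add: exp_add[symmetric])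
    finally show ?case .
  qed (use p01 in auto)
  show "\<P>(\<omega> in M. no_run m n (\<lambda>i. X i \<omega>)) \<le> exp (- (\<Sum>j<n-m. w j))"
    using up[of "n - m"] m by (simp add: p_def)
  assume eta: "\<And>j. j < n - m \<Longrightarrow> w j \<le> \<eta>" "\<eta> < 1"
    and delta: "\<And>k. \<P>(\<omega> in M. \<forall>i<m. X i \<omega> = 0) + (\<Sum>j\<in>{k..<k+m}\<inter>{..<n-m}. w j) \<le> \<delta>"
  define z where "z = \<P>(\<omega> in M. \<forall>i<m. X i \<omega> = 0)"
  have z0: "0 \<le> z" by (simp add: z_def)
  have pm: "p m = 1 - z"
  proof -
    have e: "{\<omega>\<in>space M. \<forall>i<m. X i \<omega> = 0} \<in> events"
      by (rule prob_indep_coordinates(2)[OF X, where B="{}" and A="{..<m}" and Q="\<lambda>_. True"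
            and P="\<lambda>x. \<forall>i<m. x i = 0"]) (use m in auto)
    have "{\<omega>\<in>space M. no_run m m (\<lambda>i. X i \<omega>)} = space M - {\<omega>\<in>space M. \<forall>i<m. X i \<omega> = 0}"
      by (auto simp: no_run_def)
    thus ?thesis unfolding p_def z_def using prob_compl[OF e] by simp
  qed
  have drop: "p k \<le> p (k + i) + (\<Sum>j\<in>{k-m..<k+i-m}. w j)" if "m \<le> k" "k + i \<le> n" for k i
    using that(2)
  proof (induction i)
    case (Suc i)
    have "p (k + Suc i) = p (k + i) - p (k + i - m) * w (k + i - m)"
      using step[of "k+i"] Suc.prems that(1) by simp
    also have "\<dots> \<ge> p (k + i) - w (k + i - m)"
      using p01[of "k+i-m"] w0[of "k+i-m"] Suc.prems that(1) mult_right_mono[of "p (k+i-m)" 1 "w (k+i-m)"] by auto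
    finally have "p (k + i) - w (k + i - m) \<le> p (k + Suc i)" .
    moreover have "(\<Sum>j\<in>{k-m..<k+Suc i-m}. w j) = (\<Sum>j\<in>{k-m..<k+i-m}. w j) + w (k+i-m)"
      using that(1) by (simp add: Suc_diff_le)
    ultimately show ?case using Suc by simp
  qed simp
  \<comment> \<open>Below \<open>m\<close> the value of \<open>p\<close> is 1, and at \<open>m\<close> it drops by \<open>z\<close>.\<close>
  have lag: "p k \<le> p (k + m) + \<delta>" if "k + m \<le> n" for k
  proof (cases "m \<le> k")
    case True
    have "p k \<le> p (k + m) + (\<Sum>j\<in>{k-m..<k}. w j)" using drop[OF True that] by simp
    moreover have "{k-m..<k-m+m}\<inter>{..<n-m} = {k-m..<k}" using that True by auto
    ultimately show ?thesis using delta[of "k-m", folded z_def] z0 by simp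
  next
    case False
    have "p m \<le> p (m + k) + (\<Sum>j\<in>{0..<k}. w j)" using drop[of m k] that by (simp add: add.commute)
    also have "(\<Sum>j\<in>{0..<k}. w j) \<le> (\<Sum>j\<in>{0..<0+m}\<inter>{..<n-m}. w j)"
      using False that w0 by (intro sum_mono2) auto
    finally show ?thesis using delta[of 0] pm p01(2)[of k] by (simp add: z_def add.commute)
  qed
  have d0: "z \<le> \<delta>"
  proof -
    have "0 \<le> (\<Sum>j\<in>{0..<0+m}\<inter>{..<n-m}. w j)" by (intro sum_nonneg w0) auto
    thus ?thesis using delta[of 0] by (simp add: z_def)
  qed
  have "exp (- ((\<Sum>j<i. w j) / (1 - \<eta>))) \<le> p (m + i) + \<delta>" if "m + i \<le> n" for i
    using that
  proof (induction i)
    case 0 thus ?case using pm d0 by simp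
  next
    case (Suc i)
    have i: "i < n - m" using Suc.prems by simp
    have "exp (- ((\<Sum>j<Suc i. w j) / (1 - \<eta>))) = exp (- ((\<Sum>j<i. w j) / (1 - \<eta>))) * exp (- (w i / (1 - \<eta>)))"
      by (simp add: exp_add[symmetric] add_divide_distrib)
    also have "\<dots> \<le> (p (m + i) + \<delta>) * (1 - w i)"
      using Suc exp_le_one_minus[OF w0[OF i] eta(1)[OF i] eta(2)] by (intro mult_mono) (auto intro: order_trans[OF exp_ge_zero])
    also have "\<dots> = p (m + i) + \<delta> - (p (m + i) + \<delta>) * w i" by (simp add: algebra_simps)
    also have "\<dots> \<le> p (m + i) + \<delta> - p i * w i"
      using lag[of i] w0[OF i] Suc.prems by (auto intro!: mult_right_mono simp: add.commute)
    also have "\<dots> = p (m + Suc i) + \<delta>" using step[of "m+i"] Suc.prems by simp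
    finally show ?case .
  qed
  from this[of "n - m"] m show
    "exp (- ((\<Sum>j<n-m. w j) / (1 - \<eta>))) - \<delta> \<le> \<P>(\<omega> in M. no_run m n (\<lambda>i. X i \<omega>))"
    by (simp add: p_def)
qed

end

section \<open>Mean measure of a power rate\<close>

locale power_rate =
  fixes \<alpha> \<kappa> :: real
  assumes alpha_pos: "0 < \<alpha>" and alpha_less_1: "\<alpha> < 1" and kappa_pos: "0 < \<kappa>"
begin

definition rate :: "real \<Rightarrow> real" where
  "rate s = \<kappa> * s powr (\<alpha> - 1)"

definition mean :: "real \<Rightarrow> real \<Rightarrow> real" where
  "mean s t = \<kappa> / \<alpha> * (t powr \<alpha> - s powr \<alpha>)"

text \<open>
The probability that the Poisson process has no point in \<open>(u, u + l]\<close>.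
\<close>

definition vacancy :: "real \<Rightarrow> real \<Rightarrow> real" where
  "vacancy l u = exp (- mean u (u + l))"

text \<open>
The fraction of the rate that is lost between \<open>u\<close> and \<open>u + l\<close>.
\<close>

definition rate_drop :: "real \<Rightarrow> real \<Rightarrow> real" where
  "rate_drop l u = 1 - (u / (u + l)) powr (1 - \<alpha>)"

lemma rate_pos: "0 < s \<Longrightarrow> 0 < rate s"
  using kappa_pos by (simp add: rate_def)

lemma rate_antimono: "0 < s \<Longrightarrow> s \<le> t \<Longrightarrow> rate t \<le> rate s"
  using kappa_pos alpha_less_1 by (auto simp: rate_def intro!: powr_mono2')

lemma mean_add: "mean s t + mean t u = mean s u"
  by (simp add: mean_def algebra_simps)

lemma mean_mono: "0 \<le> s \<Longrightarrow> s \<le> t \<Longrightarrow> 0 \<le> mean s t"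
  using alpha_pos kappa_pos unfolding mean_def
  by (intro mult_nonneg_nonneg) (auto intro!: powr_mono2)

lemma mean_self [simp]: "mean s s = 0"
  by (simp add: mean_def)

lemma mean_mvt:
  assumes "0 < s" "s < t"
  obtains z where "s < z" "z < t" "mean s t = (t - s) * rate z"
proof -
  have "\<exists>z. s < z \<and> z < t \<and> t powr \<alpha> - s powr \<alpha> = (t - s) * (\<alpha> * z powr (\<alpha> - 1))"
    using assms by (intro MVT2) (auto intro!: derivative_eq_intros)
  then obtain z where z: "s < z" "z < t" "t powr \<alpha> - s powr \<alpha> = (t - s) * (\<alpha> * z powr (\<alpha> - 1))"
    by blast
  show ?thesis by (rule that[OF z(1,2)]) (use z(3) alpha_pos in \<open>simp add: mean_def rate_def\<close>)
qed

lemma mean_le_rate: "0 < s \<Longrightarrow> s \<le> t \<Longrightarrow> mean s t \<le> rate s * (t - s)"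
proof (cases "s = t")
  case False
  assume *: "0 < s" "s \<le> t"
  with False obtain z where "s < z" "z < t" "mean s t = (t - s) * rate z"
    by (auto elim: mean_mvt[of s t])
  thus ?thesis using rate_antimono[of s z] * by (simp add: mult_left_mono mult.commute)
qed auto

lemma rate_le_mean: "0 \<le> s \<Longrightarrow> s \<le> t \<Longrightarrow> rate t * (t - s) \<le> mean s t"
proof (cases "s = t \<or> s = 0")
  case False
  assume *: "0 \<le> s" "s \<le> t"
  from False * obtain z where "s < z" "z < t" "mean s t = (t - s) * rate z"
    by (metis mean_mvt order_le_less)
  thus ?thesis using rate_antimono[of z t] * by (simp add: mult_left_mono mult.commute)
next
  case True
  assume *: "0 \<le> s" "s \<le> t"
  have "rate t * t \<le> mean 0 t"
  proof (cases "t = 0")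
    case False
    hence "rate t * t = \<kappa> * t powr \<alpha>" using * powr_mult_base[of t "\<alpha> - 1"]
      by (simp add: rate_def mult.commute mult.left_commute)
    also have "\<dots> \<le> \<kappa> / \<alpha> * t powr \<alpha>"
      using alpha_pos alpha_less_1 kappa_pos by (intro mult_right_mono) (auto simp: field_simps)
    finally show ?thesis using alpha_pos by (simp add: mean_def)
  qed simp
  thus ?thesis using True by auto
qed

lemma rate_shift: "0 < s \<Longrightarrow> 0 \<le> l \<Longrightarrow> rate (s + l) = (s / (s + l)) powr (1 - \<alpha>) * rate s"
  by (simp add: rate_def powr_divide powr_minus_divide powr_diff)

lemma lag_ratio_mono: "0 \<le> s \<Longrightarrow> s \<le> b \<Longrightarrow> 0 < l \<Longrightarrow>
    (s / (s + l)) powr (1 - \<alpha>) \<le> (b / (b + l)) powr (1 - \<alpha>)"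
  using alpha_less_1 by (intro powr_mono2) (auto simp: field_simps)

lemma mean_deriv:
  assumes "0 < s" shows "((\<lambda>s. mean 0 s) has_real_derivative rate s) (at s)"
  using assms alpha_pos unfolding mean_def rate_def
  by (auto intro!: derivative_eq_intros)

lemma continuous_on_mean: "continuous_on {0..} (\<lambda>s. mean 0 s)"
  using alpha_pos unfolding mean_def
  by (intro continuous_intros continuous_on_powr') (auto)

lemma mean_diff: "mean s t = mean 0 t - mean 0 s"
  using mean_add[of 0 s t] by simp

text \<open>
The rate at lag \<open>l\<close> is a fixed multiple of the rate at \<open>s\<close>, the factor
\<open>(s / (s + l)) powr (1 - \<alpha>)\<close> being increasing in \<open>s\<close>; integrate over \<open>[u, v]\<close>.
\<close>

lemma mean_lag_le:
  assumes "0 \<le> u" "u \<le> v" "v \<le> b" "0 < l"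
  shows "mean (u + l) (v + l) \<le> (b / (b + l)) powr (1 - \<alpha>) * mean u v"
proof -
  let ?r = "(b / (b + l)) powr (1 - \<alpha>)"
  let ?g = "\<lambda>s. ?r * mean 0 s - mean 0 (s + l)"
  have "?g u \<le> ?g v"
  proof (rule DERIV_nonneg_imp_increasing_open[OF assms(2)])
    fix s assume s: "u < s" "s < v"
    have "((\<lambda>s. mean 0 (s + l)) has_real_derivative rate (s + l) * 1) (at s)"
      using s assms by (intro DERIV_chain2[OF mean_deriv]) (auto intro!: derivative_eq_intros)
    hence "(?g has_real_derivative (?r * rate s - rate (s + l))) (at s)"
      using s assms by (auto intro!: derivative_eq_intros mean_deriv)
    moreover have "rate (s + l) \<le> ?r * rate s"
      using s assms rate_pos[of s] lag_ratio_mono[of s b l] by (subst rate_shift) (auto intro!: mult_right_mono)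
    ultimately show "\<exists>y. (?g has_real_derivative y) (at s) \<and> 0 \<le> y" by auto
  next
    show "continuous_on {u..v} ?g"
      using assms by (intro continuous_intros continuous_on_compose2[OF continuous_on_mean]) auto
  qed
  thus ?thesis unfolding mean_diff[of "u+l" "v+l"] mean_diff[of u v] by (simp add: algebra_simps)
qed

lemma mean_lag_ge:
  assumes "0 < a" "a \<le> u" "u \<le> v" "0 < l"
  shows "(a / (a + l)) powr (1 - \<alpha>) * mean u v \<le> mean (u + l) (v + l)"
proof -
  let ?r = "(a / (a + l)) powr (1 - \<alpha>)"
  let ?g = "\<lambda>s. mean 0 (s + l) - ?r * mean 0 s"
  have "?g u \<le> ?g v"
  proof (rule DERIV_nonneg_imp_increasing_open[OF assms(3)])
    fix s assume s: "u < s" "s < v"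
    have "((\<lambda>s. mean 0 (s + l)) has_real_derivative rate (s + l) * 1) (at s)"
      using s assms by (intro DERIV_chain2[OF mean_deriv]) (auto intro!: derivative_eq_intros)
    hence "(?g has_real_derivative (rate (s + l) - ?r * rate s)) (at s)"
      using s assms by (auto intro!: derivative_eq_intros mean_deriv)
    moreover have "rate (s + l) \<ge> ?r * rate s"
      using s assms rate_pos[of s] lag_ratio_mono[of a s l] by (subst rate_shift) (auto intro!: mult_right_mono)
    ultimately show "\<exists>y. (?g has_real_derivative y) (at s) \<and> 0 \<le> y" by auto
  next
    show "continuous_on {u..v} ?g"
      using assms by (intro continuous_intros continuous_on_compose2[OF continuous_on_mean]) auto
  qed
  thus ?thesis unfolding mean_diff[of "u+l" "v+l"] mean_diff[of u v] by (simp add: algebra_simps)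
qed

lemma rate_drop_bounds: "0 \<le> u \<Longrightarrow> 0 < l \<Longrightarrow> 0 \<le> rate_drop l u \<and> rate_drop l u \<le> 1"
  using alpha_less_1 powr_mono2[of "1-\<alpha>" "u/(u+l)" 1] by (auto simp: rate_drop_def)

lemma rate_drop_pos: "0 \<le> u \<Longrightarrow> 0 < l \<Longrightarrow> 0 < rate_drop l u"
  using alpha_less_1 powr_less_mono2[of "1-\<alpha>" "u/(u+l)" 1] by (auto simp: rate_drop_def)

lemma vacancy_pos: "0 < vacancy l u" by (simp add: vacancy_def)

lemma vacancy_shift: "vacancy l u = vacancy l v * exp (- (mean u v - mean (u + l) (v + l)))"
proof -
  have "mean u (u+l) = mean v (v+l) + (mean u v - mean (u+l) (v+l))"
    using mean_add[of u v "v+l"] mean_add[of u "u+l" "v+l"] by simp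
  thus ?thesis by (simp add: vacancy_def exp_add[symmetric])
qed

lemma vacancy_mono:
  assumes "0 \<le> u" "u \<le> v" "0 < l" shows "vacancy l u \<le> vacancy l v"
proof -
  have "0 \<le> mean u v" by (rule mean_mono[OF assms(1,2)])
  moreover have "(v / (v + l)) powr (1 - \<alpha>) \<le> 1" 
    using rate_drop_bounds[of v l] assms by (simp add: rate_drop_def)
  ultimately have "mean (u+l) (v+l) \<le> mean u v"
    using mean_lag_le[OF assms(1,2) order_refl assms(3)] mult_right_mono[of "(v / (v + l)) powr (1 - \<alpha>)" 1 "mean u v"]
    by simp
  thus ?thesis using vacancy_pos[of l v] unfolding vacancy_shift[of l u v] by (simp add: mult_le_cancel_left1)
qed

text \<open>
\<open>(1 - exp (- mean u v)) * vacancy l v\<close> is the weight of a run of empty cells of total length \<open>l\<close> that starts at \<open>v\<close>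
after the occupied cell \<open>(u, v]\<close>. Passing from \<open>u\<close> to \<open>v\<close> decreases the exponent of the vacancy
probability by at least the fraction \<open>rate_drop l b\<close> of \<open>mean u v\<close>, and \<open>1 - exp (- r x)\<close> is at
least \<open>r (1 - exp (- x))\<close> by convexity. The bound holds for cells of any size and telescopes over
consecutive cells.
\<close>

lemma run_weight_le:
  assumes "0 \<le> u" "u \<le> v" "v \<le> b" "0 < l"
  shows "(1 - exp (- mean u v)) * vacancy l v * rate_drop l b \<le> vacancy l v - vacancy l u"
proof -
  let ?x = "mean u v" and ?r = "rate_drop l b"
  have r: "0 \<le> ?r" "?r \<le> 1" using rate_drop_bounds[of b l] assms by auto
  have "?r * ?x \<le> ?x - mean (u + l) (v + l)"
    using mean_lag_le[OF assms] by (simp add: rate_drop_def algebra_simps)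
  hence "vacancy l u \<le> vacancy l v * exp (- (?r * ?x))"
    unfolding vacancy_shift[of l u v] using vacancy_pos by (intro mult_left_mono) (auto simp: less_imp_le)
  also have "exp (- (?r * ?x)) \<le> (1 - ?r) * exp 0 + ?r * exp (- ?x)"
    using convex_onD[OF exp_convex, of ?r 0 "- ?x"] r by simp
  finally have "vacancy l u \<le> vacancy l v * ((1 - ?r) * exp 0 + ?r * exp (- ?x))"
    using vacancy_pos[of l v] by simp
  thus ?thesis by (simp add: algebra_simps)
qed

text \<open>
The counterpart of the previous bound. Linearising both exponentials costs the factor
\<open>exp (- mean u v)\<close>, which tends to 1 as the cell shrinks.
\<close>

lemma run_weight_ge:
  assumes "0 < a" "a \<le> u" "u \<le> v" "0 < l"
  shows "exp (- mean u v) * (vacancy l v - vacancy l u) \<le> (1 - exp (- mean u v)) * vacancy l v * rate_drop l a"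
proof -
  let ?x = "mean u v" and ?r = "rate_drop l a"
  have r: "0 \<le> ?r" "?r \<le> 1" using rate_drop_bounds[of a l] assms by auto
  have x: "0 \<le> ?x" using assms by (intro mean_mono) auto
  have "?x - mean (u + l) (v + l) \<le> ?r * ?x"
    using mean_lag_ge[OF assms] by (simp add: rate_drop_def algebra_simps)
  moreover have "1 - exp (- (?x - mean (u + l) (v + l))) \<le> ?x - mean (u + l) (v + l)"
    using exp_ge_add_one_self[of "- (?x - mean (u + l) (v + l))"] by linarith
  ultimately have "1 - exp (- (?x - mean (u + l) (v + l))) \<le> ?r * ?x" by linarith
  hence "vacancy l v * (1 - exp (- (?x - mean (u + l) (v + l)))) \<le> vacancy l v * (?r * ?x)"
    using vacancy_pos[of l v] by (intro mult_left_mono) auto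
  hence "vacancy l v - vacancy l u \<le> vacancy l v * (?r * ?x)"
    unfolding vacancy_shift[of l u v] by (simp add: algebra_simps)
  hence "exp (- ?x) * (vacancy l v - vacancy l u) \<le> exp (- ?x) * (vacancy l v * (?r * ?x))" by simp
  also have "\<dots> = vacancy l v * ?r * (?x * exp (- ?x))" by simp
  also have "\<dots> \<le> vacancy l v * ?r * (1 - exp (- ?x))"
  proof -
    have "(1 + ?x) * exp (- ?x) \<le> exp ?x * exp (- ?x)" by (intro mult_right_mono exp_ge_add_one_self) auto
    hence "?x * exp (- ?x) \<le> 1 - exp (- ?x)" by (simp add: exp_add[symmetric] algebra_simps)
    thus ?thesis using vacancy_pos[of l v] r by (intro mult_left_mono) auto
  qed
  finally show ?thesis by (simp add: ac_simps)
qed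

text \<open>
The rate is unbounded at 0, so the fundamental theorem of calculus is not applied on \<open>(0, t]\<close>
directly; the Henstock-Kurzweil integral from 0 is known, and it agrees with the Lebesgue integral
once the rate is known to be integrable.
\<close>

lemma set_integral_rate:
  assumes "0 \<le> s" "s < t" and int: "\<And>t. 0 < t \<Longrightarrow> set_integrable lborel {0<..t} rate"
  shows "(LINT u:{s<..t}|lborel. rate u) = mean s t"
proof -
  have from0: "(LINT u:{0<..t}|lborel. rate u) = mean 0 t" if "0 < t" for t
  proof -
    have "((\<lambda>x. \<kappa> * x powr (\<alpha> - 1)) has_integral (\<kappa> * (t powr (\<alpha> - 1 + 1) / (\<alpha> - 1 + 1)))) {0..t}"
      using that alpha_pos by (intro has_integral_mult_right has_integral_powr_from_0) auto
    hence 1: "(rate has_integral mean 0 t) {0..t}"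
      using alpha_pos by (simp add: rate_def[abs_def] mean_def field_simps)
    have "(rate has_integral mean 0 t) {0<..t}"
      using 1 by (subst has_integral_spike_set_eq[of _ "{0..t}"]) (auto intro: negligible_subset[of "{0}"])
    thus ?thesis using set_borel_integral_eq_integral(2)[OF int[OF that]] by (simp add: integral_unique)
  qed
  show ?thesis
  proof (cases "s = 0")
    case False
    have "(LINT u:{0<..t}|lborel. rate u) = (LINT u:{0<..s} \<union> {s<..t}|lborel. rate u)"
      using assms by (intro arg_cong2[where f="set_lebesgue_integral lborel"]) auto
    also have "\<dots> = (LINT u:{0<..s}|lborel. rate u) + (LINT u:{s<..t}|lborel. rate u)"
      using assms False by (intro set_integral_Un set_integrable_subset[OF int[of t]] int) auto
    finally show ?thesis using from0[of s] from0[of t] assms False mean_add[of 0 s t] by simp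
  qed (use from0 assms in auto)
qed

end

section \<open>Runs of empty cells in the Poisson process\<close>

locale power_rate_poisson = power_rate \<alpha> \<kappa> + prob_space M
  for \<alpha> \<kappa> :: real and M :: "'a measure" +
  fixes N :: "real \<Rightarrow> 'a \<Rightarrow> nat"
  assumes poisson: "inhomogeneous_poisson_process M N rate"
begin

definition incr :: "(nat \<Rightarrow> real) \<Rightarrow> 'a \<Rightarrow> nat \<Rightarrow> nat" where
  "incr \<tau> \<omega> i = N (\<tau> (Suc i)) \<omega> - N (\<tau> i) \<omega>"

definition grid :: "real \<Rightarrow> real \<Rightarrow> nat \<Rightarrow> nat \<Rightarrow> real" where
  "grid a b n i = a + real i * ((b - a) / real n)"

lemma N_measurable: "0 \<le> t \<Longrightarrow> N t \<in> measurable M (count_space UNIV)"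
  using poisson by (auto simp: inhomogeneous_poisson_process_def)

lemma counting_path_N: "\<omega> \<in> space M \<Longrightarrow> counting_path (\<lambda>t. N t \<omega>)"
  using poisson by (auto simp: inhomogeneous_poisson_process_def)

lemma N_mono: "\<omega> \<in> space M \<Longrightarrow> 0 \<le> s \<Longrightarrow> s \<le> t \<Longrightarrow> N s \<omega> \<le> N t \<omega>"
  using counting_path_N[of \<omega>] by (auto simp: counting_path_def mono_on_def)

lemma N_zero: "\<omega> \<in> space M \<Longrightarrow> N 0 \<omega> = 0"
  using counting_path_N[of \<omega>] by (auto simp: counting_path_def)

lemma prob_increment:
  assumes "0 \<le> s" "s < t"
  shows "\<P>(\<omega> in M. N t \<omega> - N s \<omega> = k) = mean s t ^ k / fact k * exp (- mean s t)"
  using poisson assms set_integral_rate[OF assms]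
  unfolding inhomogeneous_poisson_process_def by simp

lemma event_N [measurable]:
  assumes "0 \<le> s" "0 \<le> t" shows "{\<omega>\<in>space M. P (N s \<omega>) (N t \<omega>)} \<in> events"
proof -
  note [measurable] = N_measurable[OF assms(1)] N_measurable[OF assms(2)]
  show ?thesis by measurable
qed

lemma prob_empty:
  assumes "0 \<le> s" "s \<le> t"
  shows "\<P>(\<omega> in M. N t \<omega> = N s \<omega>) = exp (- mean s t)"
proof (cases "s = t")
  case False
  have "{\<omega>\<in>space M. N t \<omega> = N s \<omega>} = {\<omega>\<in>space M. N t \<omega> - N s \<omega> = 0}"
    using N_mono assms by (auto intro: antisym)
  thus ?thesis using prob_increment[of s t 0] False assms by simp
qed (simp add: prob_space)

lemma incr_indep:
  assumes "0 \<le> \<tau> 0" "\<And>i. i < n \<Longrightarrow> \<tau> i \<le> \<tau> (Suc i)"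
  shows "indep_vars (\<lambda>_. count_space UNIV) (\<lambda>i \<omega>. incr \<tau> \<omega> i) {..<n}"
  using poisson assms unfolding inhomogeneous_poisson_process_def incr_def by blast

lemma time_mono:
  fixes \<tau> :: "nat \<Rightarrow> real"
  assumes "\<And>i. i < n \<Longrightarrow> \<tau> i \<le> \<tau> (Suc i)" "j \<le> k" "k \<le> n"
  shows "\<tau> j \<le> \<tau> k"
  using assms(2,3)
proof (induction k rule: dec_induct)
  case (step i) thus ?case using assms(1)[of i] by simp
qed simp

lemma incr_zero_iff:
  assumes \<omega>: "\<omega> \<in> space M" and \<tau>: "0 \<le> \<tau> 0" "\<And>i. i < n \<Longrightarrow> \<tau> i \<le> \<tau> (Suc i)"
    and jk: "j \<le> k" "k \<le> n"
  shows "(\<forall>i\<in>{j..<k}. incr \<tau> \<omega> i = 0) \<longleftrightarrow> N (\<tau> k) \<omega> = N (\<tau> j) \<omega>"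
  using jk
proof (induction k rule: dec_induct)
  case (step i)
  have "0 \<le> \<tau> j" using time_mono[of n \<tau> 0 j] \<tau> step by force
  moreover have ji: "\<tau> j \<le> \<tau> i" "\<tau> i \<le> \<tau> (Suc i)"
    using time_mono[of n \<tau> j i] \<tau>(2) step by auto
  ultimately have "N (\<tau> j) \<omega> \<le> N (\<tau> i) \<omega>" "N (\<tau> i) \<omega> \<le> N (\<tau> (Suc i)) \<omega>"
    using \<omega> by (auto intro!: N_mono)
  moreover have "{j..<Suc i} = insert i {j..<i}" using step by auto
  ultimately show ?case using step by (auto simp: incr_def)
qed simp

lemma no_run_incr_iff:
  assumes \<omega>: "\<omega> \<in> space M" and \<tau>: "0 \<le> \<tau> 0" "\<And>i. i < n \<Longrightarrow> \<tau> i \<le> \<tau> (Suc i)"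
  shows "no_run m n (incr \<tau> \<omega>) \<longleftrightarrow> (\<forall>j. j + m \<le> n \<longrightarrow> N (\<tau> (j + m)) \<omega> \<noteq> N (\<tau> j) \<omega>)"
  unfolding no_run_def using incr_zero_iff[OF assms, where j=j and k="j+m" for j] by fastforce

text \<open>
If one grid ends where the other begins, their concatenation is a single increasing sequence of times,
whose increments are independent.
\<close>

lemma prob_two_grids:
  assumes \<tau>: "0 \<le> \<tau> 0" "\<And>i. i < n \<Longrightarrow> \<tau> i \<le> \<tau> (Suc i)"
    and \<tau>': "\<tau>' 0 = \<tau> n" "\<And>i. i < n' \<Longrightarrow> \<tau>' i \<le> \<tau>' (Suc i)"
  shows "\<P>(\<omega> in M. no_run m n (incr \<tau> \<omega>) \<and> no_run m' n' (incr \<tau>' \<omega>)) =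
    \<P>(\<omega> in M. no_run m n (incr \<tau> \<omega>)) * \<P>(\<omega> in M. no_run m' n' (incr \<tau>' \<omega>))"
proof -
  define \<rho> where "\<rho> i = (if i \<le> n then \<tau> i else \<tau>' (i - n))" for i
  have "\<rho> i \<le> \<rho> (Suc i)" if "i < n + n'" for i
  proof (cases "i = n")
    case True thus ?thesis using \<tau>'(1) \<tau>'(2)[of 0] that by (simp add: \<rho>_def)
  next
    case False thus ?thesis using that \<tau>(2)[of i] \<tau>'(2)[of "i - n"] by (auto simp: \<rho>_def Suc_diff_le)
  qed
  hence ind: "indep_vars (\<lambda>_. count_space UNIV) (\<lambda>i \<omega>. incr \<rho> \<omega> i) {..<n+n'}"
    using \<tau>(1) by (intro incr_indep) (auto simp: \<rho>_def)
  have 1: "no_run m n (incr \<tau> \<omega>) = no_run m n (\<lambda>i. incr \<rho> \<omega> i)" for \<omega>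
    by (rule no_run_cong) (auto simp: incr_def \<rho>_def)
  have 2: "no_run m' n' (incr \<tau>' \<omega>) = no_run m' n' (\<lambda>i. incr \<rho> \<omega> (n + i))" for \<omega>
    by (rule no_run_cong) (use \<tau>'(1) in \<open>auto simp: incr_def \<rho>_def\<close>)
  show ?thesis unfolding 1 2
  proof (rule prob_indep_coordinates(1)[OF ind, where A="{..<n}" and B="{n..<n+n'}"
        and P="no_run m n" and Q="\<lambda>x. no_run m' n' (\<lambda>i. x (n + i))"])
    show "no_run m n x = no_run m n y" if "\<And>i. i \<in> {..<n} \<Longrightarrow> x i = y i" for x y
      using that by (intro no_run_cong) auto
    show "no_run m' n' (\<lambda>i. x (n + i)) = no_run m' n' (\<lambda>i. y (n + i))"
      if "\<And>i. i \<in> {n..<n+n'} \<Longrightarrow> x i = y i" for x y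
      using that by (intro no_run_cong) auto
  qed auto
qed

lemma no_run_event:
  assumes \<tau>: "0 \<le> \<tau> 0" "\<And>i. i < n \<Longrightarrow> \<tau> i \<le> \<tau> (Suc i)"
  shows "{\<omega>\<in>space M. no_run m n (incr \<tau> \<omega>)} \<in> events"
proof (rule prob_indep_coordinates(2)[OF incr_indep[OF \<tau>], where A="{..<n}" and B="{}"
        and P="no_run m n" and Q="\<lambda>_. True"])
  show "no_run m n x = no_run m n y" if "\<And>i. i \<in> {..<n} \<Longrightarrow> x i = y i" for x y
    using that by (intro no_run_cong) auto
qed auto

lemma grid_Suc: "a \<le> b \<Longrightarrow> grid a b n i \<le> grid a b n (Suc i)"
  by (simp add: grid_def algebra_simps divide_right_mono add_divide_distrib[symmetric])

lemma grid_0 [simp]: "grid a b n 0 = a" by (simp add: grid_def)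

lemma grid_n [simp]: "0 < n \<Longrightarrow> grid a b n n = b" by (simp add: grid_def)

text \<open>
As the rate is decreasing, intervals of given length carry the largest mean at the origin.
\<close>

lemma mean_shift_le: "0 \<le> u \<Longrightarrow> 0 \<le> l \<Longrightarrow> mean u (u + l) \<le> mean 0 l"
proof (cases "u = 0")
  case False
  assume *: "0 \<le> u" "0 \<le> l"
  have "mean (0 + u) (l + u) \<le> (l / (l + u)) powr (1 - \<alpha>) * mean 0 l"
    using * False by (intro mean_lag_le) auto
  also have "\<dots> \<le> 1 * mean 0 l"
    using * False alpha_less_1 powr_mono2[of "1 - \<alpha>" "l / (l + u)" 1]
    by (intro mult_right_mono mean_mono) auto
  finally show ?thesis by (simp add: add.commute)
qed simp

text \<open>
Here \<open>h\<close> is the width of a cell, \<open>l\<close> the length of a run and \<open>v\<close> the latest time at which a run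
can start. The run weights telescope to \<open>vacancy l v - vacancy l a\<close>. A stretch of \<open>m\<close> cells has mean
at most \<open>mean 0 l\<close>, and each run starting there is vacant with probability at most
\<open>vacancy l v\<close>; this accounts for the term \<open>vacancy l v * mean 0 l\<close> in the lower bound, and the run at the very
beginning for the remaining \<open>vacancy l v\<close>.
\<close>

lemma
  fixes a b :: real and m n :: nat
  defines "h \<equiv> (b - a) / real n"
  defines "l \<equiv> real m * h" 
  defines "v \<equiv> b - l"
  assumes ab: "0 \<le> a" "a < b" and m: "0 < m" "m < n"
  shows prob_grid_no_run_le: "0 < a \<Longrightarrow>
      \<P>(\<omega> in M. no_run m n (incr (grid a b n) \<omega>))
        \<le> exp (- (exp (- (rate a * h)) * ((vacancy l v - vacancy l a) / rate_drop l a)))"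
    and prob_grid_no_run_ge:
      "exp (- ((vacancy l v - vacancy l a) / (rate_drop l v * (1 - vacancy l v)))) - vacancy l v * (1 + mean 0 l)
        \<le> \<P>(\<omega> in M. no_run m n (incr (grid a b n) \<omega>))"
proof -
  define u where "u i = a + real i * h" for i
  have h: "0 < h" using ab m by (simp add: h_def)
  have l: "0 < l" using m h by (simp add: l_def)
  have u_eq: "grid a b n = u" by (auto simp: grid_def u_def h_def fun_eq_iff)
  have u0: "u 0 = a" by (simp add: u_def)
  have uSuc: "u (Suc i) = u i + h" for i by (simp add: u_def algebra_simps)
  have u_m: "u (i + m) = u i + l" for i by (simp add: u_def l_def algebra_simps)
  have ua: "a \<le> u i" for i using h by (simp add: u_def)
  have upos: "0 \<le> u i" for i using ua[of i] ab by linarith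
  have u_mono: "u i \<le> u j" if "i \<le> j" for i j
    using that h by (simp add: u_def mult_right_mono)
  have un: "u n = b" using m by (simp add: u_def h_def)
  have uv: "u (n - m) = v" using u_m[of "n - m"] m un by (simp add: v_def)
  have v0: "0 \<le> v" using upos[of "n-m"] uv by simp
  have inc: "0 \<le> u 0" "\<And>i. i < n \<Longrightarrow> u i \<le> u (Suc i)" using upos uSuc h by auto
  define w where "w j = (1 - exp (- mean (u j) (u (Suc j)))) * vacancy l (u (Suc j))" for j
  have X: "indep_vars (\<lambda>_. count_space UNIV) (\<lambda>i \<omega>. incr u \<omega> i) {..<n}"
    by (rule incr_indep[OF inc])
  have zero: "\<P>(\<omega> in M. \<forall>i\<in>{j..<k}. incr u \<omega> i = 0) = exp (- mean (u j) (u k))"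
    if "j \<le> k" "k \<le> n" for j k
  proof -
    have "{\<omega>\<in>space M. \<forall>i\<in>{j..<k}. incr u \<omega> i = 0} = {\<omega>\<in>space M. N (u k) \<omega> = N (u j) \<omega>}"
      using incr_zero_iff[OF _ inc that] by blast
    thus ?thesis using prob_empty[OF upos[of j] u_mono[OF that(1)]] by simp
  qed
  have w: "w j = \<P>(\<omega> in M. incr u \<omega> j \<noteq> 0) * \<P>(\<omega> in M. \<forall>i\<in>{j<..j+m}. incr u \<omega> i = 0)"
    if "j < n - m" for j
  proof -
    have "\<P>(\<omega> in M. \<forall>i\<in>{j<..j+m}. incr u \<omega> i = 0) = exp (- mean (u (Suc j)) (u (Suc j + m)))"
      using zero[of "Suc j" "Suc j + m"] that by (simp add: atLeastSucLessThan_greaterThanLessThan atLeastSucAtMost_greaterThanAtMost[symmetric] atLeastLessThanSuc_atLeastAtMost)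
    also have "\<dots> = vacancy l (u (Suc j))" unfolding u_m by (simp add: vacancy_def)
    finally have 1: "\<P>(\<omega> in M. \<forall>i\<in>{j<..j+m}. incr u \<omega> i = 0) = vacancy l (u (Suc j))" .
    have z: "\<P>(\<omega> in M. incr u \<omega> j = 0) = exp (- mean (u j) (u (Suc j)))"
      using zero[of j "Suc j"] that by simp
    have ev: "{\<omega>\<in>space M. incr u \<omega> j = 0} \<in> events"
      unfolding incr_def by (rule event_N[OF upos[of j] upos[of "Suc j"], where P="\<lambda>x y. y - x = 0"])
    have "{\<omega>\<in>space M. incr u \<omega> j \<noteq> 0} = space M - {\<omega>\<in>space M. incr u \<omega> j = 0}" by auto
    hence "\<P>(\<omega> in M. incr u \<omega> j \<noteq> 0) = 1 - exp (- mean (u j) (u (Suc j)))"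
      using prob_compl[OF ev] z by simp
    thus ?thesis unfolding w_def 1 by simp
  qed
  have tele: "(\<Sum>j<n-m. vacancy l (u (Suc j)) - vacancy l (u j)) = vacancy l v - vacancy l a"
    by (subst sum_lessThan_telescope) (simp add: uv u0)
  have jv: "u (Suc j) \<le> v" if "j < n - m" for j
    using u_mono[of "Suc j" "n-m"] that uv by simp
  show "\<P>(\<omega> in M. no_run m n (incr (grid a b n) \<omega>))
        \<le> exp (- (exp (- (rate a * h)) * ((vacancy l v - vacancy l a) / rate_drop l a)))" if a: "0 < a"
  proof -
    have "exp (- (rate a * h)) * ((vacancy l (u (Suc j)) - vacancy l (u j)) / rate_drop l a) \<le> w j" for j
    proof -
      have "mean (u j) (u (Suc j)) \<le> rate (u j) * h"
        using mean_le_rate[of "u j" "u (Suc j)"] uSuc[of j] h a ua[of j] by simp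
      also have "\<dots> \<le> rate a * h" using h a ua[of j] by (intro mult_right_mono rate_antimono) auto
      finally have "exp (- (rate a * h)) * (vacancy l (u (Suc j)) - vacancy l (u j))
          \<le> exp (- mean (u j) (u (Suc j))) * (vacancy l (u (Suc j)) - vacancy l (u j))"
        using vacancy_mono[of "u j" "u (Suc j)" l] upos l uSuc[of j] h by (intro mult_right_mono) auto
      also have "\<dots> \<le> w j * rate_drop l a"
        unfolding w_def using a ua uSuc[of j] h l by (intro run_weight_ge) auto
      finally show ?thesis using rate_drop_pos[of a l] ab l by (simp add: field_simps)
    qed
    hence "(\<Sum>j<n-m. exp (- (rate a * h)) * ((vacancy l (u (Suc j)) - vacancy l (u j)) / rate_drop l a)) \<le> (\<Sum>j<n-m. w j)"
      by (intro sum_mono)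
    hence "exp (- (rate a * h)) * ((vacancy l v - vacancy l a) / rate_drop l a) \<le> (\<Sum>j<n-m. w j)"
      unfolding tele[symmetric] by (simp add: sum_distrib_left sum_divide_distrib)
    moreover have "\<P>(\<omega> in M. no_run m n (incr u \<omega>)) \<le> exp (- (\<Sum>j<n-m. w j))"
      using prob_no_run_le[OF X, of m w] m w by simp
    ultimately show ?thesis unfolding u_eq by (auto elim: order_trans)
  qed
  have psi1: "vacancy l v < 1"
    using rate_le_mean[of v "v+l"] v0 l mult_pos_pos[OF rate_pos[of "v+l"] l]
    unfolding vacancy_def exp_less_one_iff by simp
  have wle: "w j \<le> (vacancy l (u (Suc j)) - vacancy l (u j)) / rate_drop l v" if "j < n - m" for j
    using run_weight_le[OF upos[of j] u_mono[of j "Suc j"] jv[OF that] l] rate_drop_pos[OF v0 l]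
    by (simp add: w_def field_simps)
  have psij: "vacancy l (u (Suc j)) \<le> vacancy l v" if "j < n - m" for j
    by (rule vacancy_mono[OF upos jv[OF that] l])
  have mj: "0 \<le> mean (u j) (u (Suc j))" for j by (rule mean_mono[OF upos u_mono]) simp
  have w1: "w j \<le> mean (u j) (u (Suc j)) * vacancy l v" if "j < n - m" for j
  proof -
    have "1 - exp (- mean (u j) (u (Suc j))) \<le> mean (u j) (u (Suc j))"
      using exp_ge_add_one_self[of "- mean (u j) (u (Suc j))"] by linarith
    thus ?thesis unfolding w_def using psij[OF that] vacancy_pos[of l "u (Suc j)"] mj[of j]
      by (intro mult_mono) auto
  qed
  have w2: "w j \<le> vacancy l v" if "j < n - m" for j
    using psij[OF that] vacancy_pos[of l "u (Suc j)"] mj[of j] unfolding w_def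
    by (intro order_trans[OF mult_left_le_one_le]) auto
  have delta: "\<P>(\<omega> in M. \<forall>i<m. incr u \<omega> i = 0) + (\<Sum>j\<in>{k..<k+m}\<inter>{..<n-m}. w j)
      \<le> vacancy l v * (1 + mean 0 l)" for k
  proof -
    have "\<P>(\<omega> in M. \<forall>i<m. incr u \<omega> i = 0) = exp (- mean (u 0) (u (0 + m)))"
      using zero[of 0 m] m by (simp add: Ball_def)
    also have "\<dots> = vacancy l a" unfolding u_m by (simp add: vacancy_def u0)
    also have "\<dots> \<le> vacancy l v" using ua[of "n-m"] uv by (intro vacancy_mono ab l) auto
    finally have 1: "\<P>(\<omega> in M. \<forall>i<m. incr u \<omega> i = 0) \<le> vacancy l v" .
    have "(\<Sum>j\<in>{k..<k+m}\<inter>{..<n-m}. w j) \<le> (\<Sum>j\<in>{k..<k+m}\<inter>{..<n-m}. mean (u j) (u (Suc j)) * vacancy l v)"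
      by (intro sum_mono w1) auto
    also have "\<dots> \<le> (\<Sum>j\<in>{k..<k+m}. mean (u j) (u (Suc j)) * vacancy l v)"
      using mj vacancy_pos[of l v] by (intro sum_mono2) auto
    also have "\<dots> = (\<Sum>j\<in>{k..<k+m}. mean 0 (u (Suc j)) - mean 0 (u j)) * vacancy l v"
      unfolding sum_distrib_right[symmetric] by (subst mean_diff) simp
    also have "\<dots> = mean (u k) (u (k + m)) * vacancy l v"
      by (subst sum_Suc_diff') (auto simp: mean_diff[of "u k"])
    also have "\<dots> \<le> mean 0 l * vacancy l v"
      unfolding u_m using upos l vacancy_pos[of l v] by (intro mult_right_mono mean_shift_le) auto
    finally show ?thesis using 1 by (simp add: algebra_simps)
  qed
  have "(\<Sum>j<n-m. w j) \<le> (\<Sum>j<n-m. (vacancy l (u (Suc j)) - vacancy l (u j)) / rate_drop l v)"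
    by (intro sum_mono wle) auto
  also have "\<dots> = (vacancy l v - vacancy l a) / rate_drop l v"
    unfolding tele[symmetric] by (simp add: sum_divide_distrib)
  finally have "(\<Sum>j<n-m. w j) / (1 - vacancy l v) \<le> (vacancy l v - vacancy l a) / rate_drop l v / (1 - vacancy l v)"
    using psi1 by (intro divide_right_mono) auto
  hence "exp (- ((vacancy l v - vacancy l a) / (rate_drop l v * (1 - vacancy l v)))) - vacancy l v * (1 + mean 0 l)
    \<le> exp (- ((\<Sum>j<n-m. w j) / (1 - vacancy l v))) - vacancy l v * (1 + mean 0 l)" by simp
  also have "\<dots> \<le> \<P>(\<omega> in M. no_run m n (incr u \<omega>))"
    using prob_no_run_ge[OF X, of m w "vacancy l v" "vacancy l v * (1 + mean 0 l)"] m w w2 psi1 delta by simp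
  finally show "exp (- ((vacancy l v - vacancy l a) / (rate_drop l v * (1 - vacancy l v)))) - vacancy l v * (1 + mean 0 l)
        \<le> \<P>(\<omega> in M. no_run m n (incr (grid a b n) \<omega>))" unfolding u_eq .
qed

end

section \<open>Asymptotics of vacancy probabilities\<close>

text \<open>
The derivative of \<open>(1 + z) powr p\<close> at 0 is \<open>p\<close>. Caratheodory's form of the derivative is used, as
\<open>z\<close> may vanish.
\<close>

lemma powr_linearization:
  fixes z g :: "real \<Rightarrow> real" and p c L :: real
  assumes z: "(z \<longlongrightarrow> 0) F" and g: "((\<lambda>t. g t * z t) \<longlongrightarrow> L) F"
  shows "((\<lambda>t. g t * ((1 + z t) powr p - 1)) \<longlongrightarrow> p * L) F"
proof -
  have "((\<lambda>z. (1 + z) powr p) has_real_derivative p) (at 0)"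
    by (auto intro!: derivative_eq_intros)
  then obtain k where k: "\<And>z. (1 + z) powr p - 1 = k z * z" "isCont k 0" "k 0 = p"
    using CARAT_DERIV[of "\<lambda>z. (1 + z) powr p" p 0] by auto
  have "((\<lambda>t. k (z t)) \<longlongrightarrow> p) F"
    using isCont_tendsto_compose[OF k(2) z] k(3) by simp
  hence "((\<lambda>t. k (z t) * (g t * z t)) \<longlongrightarrow> p * L) F" by (intro tendsto_mult g)
  thus ?thesis by (simp add: k(1) ac_simps)
qed

context power_rate
begin

definition centering :: "real \<Rightarrow> real" where
  "centering t = \<alpha> * ln t - ln (ln t) - ln (\<alpha> * (1 - \<alpha>) / \<kappa>)"

definition level :: "real \<Rightarrow> real \<Rightarrow> real" where
  "level x t = (centering t + x) / rate t"

text \<open>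
The time whose distance from \<open>t\<close> is normalised to \<open>y\<close>; it decreases in \<open>y\<close>.
\<close>

definition ago :: "real \<Rightarrow> real \<Rightarrow> real" where
  "ago y t = t * (1 - y / ln t)"

lemma centering_over_ln: "((\<lambda>t. centering t / ln t) \<longlongrightarrow> \<alpha>) at_top"
  unfolding centering_def using alpha_pos by real_asymp

lemma centering_at_top: "filterlim centering at_top at_top"
  unfolding centering_def using alpha_pos by real_asymp

lemma exp_minus_centering:
  "1 < t \<Longrightarrow> exp (- centering t) = \<alpha> * (1 - \<alpha>) / \<kappa> * ln t * t powr (- \<alpha>)"
proof -
  assume t: "1 < t"
  have "exp (- centering t) = exp (ln (\<alpha> * (1 - \<alpha>) / \<kappa>)) * exp (ln (ln t)) * exp (- \<alpha> * ln t)"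
    by (simp add: centering_def exp_add[symmetric])
  thus ?thesis using t alpha_pos alpha_less_1 kappa_pos by (simp add: powr_def del: exp_diff)
qed

lemma y_over_ln:
  assumes "((y :: real \<Rightarrow> real) \<longlongrightarrow> y0) at_top"
  shows "((\<lambda>t. y t / ln t) \<longlongrightarrow> 0) at_top"
proof -
  have "((\<lambda>t. 1 / ln t) \<longlongrightarrow> (0::real)) at_top" by real_asymp
  hence "((\<lambda>t. y t * (1 / ln t)) \<longlongrightarrow> y0 * 0) at_top" by (intro tendsto_intros assms)
  thus ?thesis by simp
qed

lemma ago_eventually_pos:
  assumes "((y :: real \<Rightarrow> real) \<longlongrightarrow> y0) at_top"
  shows "eventually (\<lambda>t. 1 < t \<and> 0 < 1 - y t / ln t \<and> 0 < ago (y t) t) at_top"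
proof -
  have "eventually (\<lambda>t. y t / ln t < 1) at_top"
    by (rule order_tendstoD(2)[OF y_over_ln[OF assms]]) simp
  thus ?thesis using eventually_gt_at_top[of 1]
    by eventually_elim (simp add: ago_def)
qed

text \<open>
From here on \<open>l\<close> is a gap length whose normalised value tends to \<open>x\<close>; lengths of runs of cells are
of this kind, although they hit the level only up to the width of a few cells.
\<close>

context
  fixes l :: "real \<Rightarrow> real" and x :: real
  assumes l: "((\<lambda>t. rate t * l t - centering t) \<longlongrightarrow> x) at_top"
begin

lemma rate_length_over_ln: "((\<lambda>t. rate t * l t / ln t) \<longlongrightarrow> \<alpha>) at_top"
proof -
  have "((\<lambda>t. 1 / ln t) \<longlongrightarrow> (0::real)) at_top" by real_asymp
  hence "((\<lambda>t. (rate t * l t - centering t) * (1 / ln t) + centering t / ln t) \<longlongrightarrow> x * 0 + \<alpha>) at_top"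
    by (intro tendsto_intros l centering_over_ln)
  thus ?thesis by (simp add: field_simps add_divide_distrib[symmetric])
qed

lemma length_eventually_pos: "eventually (\<lambda>t. 0 < l t) at_top"
proof -
  have "eventually (\<lambda>t. 0 < rate t * l t / ln t) at_top"
    using order_tendstoD(1)[OF rate_length_over_ln alpha_pos] .
  thus ?thesis using eventually_gt_at_top[of 1]
  proof eventually_elim
    case (elim t)
    thus ?case using rate_pos[of t] by (simp add: zero_less_mult_iff zero_less_divide_iff)
  qed
qed

text \<open>
A critical gap is short compared with \<open>t / ln t\<close>, the scale of the position of the longest gap. So
shifting a time by such a gap does not change its normalised position in the limit.
\<close>

lemma length_negligible: "((\<lambda>t. l t * ln t / t) \<longlongrightarrow> 0) at_top"
proof -
  have "((\<lambda>t. ln t ^ 2 / (\<kappa> * t powr \<alpha>)) \<longlongrightarrow> 0) at_top"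
    using alpha_pos kappa_pos by real_asymp
  hence "((\<lambda>t. rate t * l t / ln t * (ln t ^ 2 / (\<kappa> * t powr \<alpha>))) \<longlongrightarrow> \<alpha> * 0) at_top"
    by (intro tendsto_mult rate_length_over_ln)
  moreover have "eventually (\<lambda>t. rate t * l t / ln t * (ln t ^ 2 / (\<kappa> * t powr \<alpha>)) = l t * ln t / t) at_top"
    using eventually_gt_at_top[of 1]
  proof eventually_elim
    case (elim t)
    hence "t powr \<alpha> = t * t powr (\<alpha> - 1)" by (simp add: powr_mult_base)
    thus ?case using elim kappa_pos by (simp add: rate_def field_simps power2_eq_square)
  qed
  ultimately show ?thesis by (force intro: Lim_transform_eventually)
qed

lemma end_limit: "((\<lambda>t. y + l t * ln t / t) \<longlongrightarrow> y) at_top"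
  using tendsto_add[OF tendsto_const[of y] length_negligible] by simp

text \<open>
The relative excess of the rate over \<open>rate t\<close> is about \<open>(1 - \<alpha>) y0 / ln t\<close>, and
\<open>rate t * l t\<close> is about \<open>\<alpha> ln t\<close>. Their product is the extra term \<open>\<alpha> (1 - \<alpha>) y0\<close>, which
eventually becomes the rate of the exponential limit.
\<close>

lemma rate_at_ago:
  assumes y: "(y \<longlongrightarrow> y0) at_top"
  shows "((\<lambda>t. rate (ago (y t) t) * l t - centering t) \<longlongrightarrow> x + \<alpha> * (1 - \<alpha>) * y0) at_top"
proof -
  have z: "((\<lambda>t. - y t / ln t) \<longlongrightarrow> 0) at_top"
    using tendsto_minus[OF y_over_ln[OF y]] by simp
  have "eventually (\<lambda>t. - y t = ln t * (- y t / ln t)) at_top"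
    using eventually_gt_at_top[of 1] by eventually_elim simp
  with tendsto_minus[OF y] have "((\<lambda>t. ln t * (- y t / ln t)) \<longlongrightarrow> - y0) at_top"
    by (rule Lim_transform_eventually)
  hence "((\<lambda>t. ln t * ((1 + (- y t / ln t)) powr (\<alpha> - 1) - 1)) \<longlongrightarrow> (\<alpha> - 1) * (- y0)) at_top"
    by (rule powr_linearization[OF z])
  hence "((\<lambda>t. (rate t * l t - centering t) + rate t * l t / ln t * (ln t * ((1 + (- y t / ln t)) powr (\<alpha> - 1) - 1)))
      \<longlongrightarrow> x + \<alpha> * ((\<alpha> - 1) * (- y0))) at_top"
    by (rule tendsto_add[OF l tendsto_mult[OF rate_length_over_ln]])
  moreover have "eventually (\<lambda>t. (rate t * l t - centering t) + rate t * l t / ln t * (ln t * ((1 + (- y t / ln t)) powr (\<alpha> - 1) - 1))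
      = rate (ago (y t) t) * l t - centering t) at_top"
    using ago_eventually_pos[OF y]
  proof eventually_elim
    case (elim t)
    have "rate (ago (y t) t) = rate t * (1 + (- y t / ln t)) powr (\<alpha> - 1)"
      using elim by (simp add: rate_def ago_def powr_mult)
    thus ?case using elim by (simp add: algebra_simps)
  qed
  ultimately have "((\<lambda>t. rate (ago (y t) t) * l t - centering t) \<longlongrightarrow> x + \<alpha> * ((\<alpha> - 1) * (- y0))) at_top"
    by (rule Lim_transform_eventually)
  thus ?thesis by (simp add: algebra_simps)
qed

text \<open>
The mean of the interval lies between the rates at its two endpoints times its length, and both
endpoints have normalised position tending to \<open>y0\<close>.
\<close>

lemma vacancy_limit:
  assumes y: "(y \<longlongrightarrow> y0) at_top"
  shows "((\<lambda>t. vacancy (l t) (ago (y t) t) * exp (centering t)) \<longlongrightarrow> exp (- (x + \<alpha> * (1 - \<alpha>) * y0))) at_top"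
proof -
  have y': "((\<lambda>t. y t - l t * ln t / t) \<longlongrightarrow> y0) at_top"
    using tendsto_diff[OF y length_negligible] by simp
  have "((\<lambda>t. mean (ago (y t) t) (ago (y t) t + l t) - centering t) \<longlongrightarrow> x + \<alpha> * (1 - \<alpha>) * y0) at_top"
  proof (rule tendsto_sandwich[OF _ _ rate_at_ago[OF y'] rate_at_ago[OF y]])
    show "\<forall>\<^sub>F t in at_top. mean (ago (y t) t) (ago (y t) t + l t) - centering t
       \<le> rate (ago (y t) t) * l t - centering t"
      using ago_eventually_pos[OF y] length_eventually_pos
    proof eventually_elim
      case (elim t)
      thus ?case using mean_le_rate[of "ago (y t) t" "ago (y t) t + l t"] by simp
    qed
    show "\<forall>\<^sub>F t in at_top. rate (ago (y t - l t * ln t / t) t) * l t - centering t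
       \<le> mean (ago (y t) t) (ago (y t) t + l t) - centering t"
      using ago_eventually_pos[OF y] length_eventually_pos
    proof eventually_elim
      case (elim t)
      have "ago (y t - l t * ln t / t) t = ago (y t) t + l t"
        using elim by (simp add: ago_def field_simps)
      thus ?case using rate_le_mean[of "ago (y t) t" "ago (y t) t + l t"] elim by simp
    qed
  qed
  from tendsto_exp[OF tendsto_minus[OF this]]
  show ?thesis by (simp add: vacancy_def exp_diff exp_minus field_simps)
qed

lemma rate_drop_limit:
  assumes y: "(y \<longlongrightarrow> y0) at_top"
  shows "((\<lambda>t. rate_drop (l t) (ago (y t) t) * (t / l t)) \<longlongrightarrow> 1 - \<alpha>) at_top"
proof -
  let ?a = "\<lambda>t. ago (y t) t"
  have "((\<lambda>t. 1 / (1 - y t / ln t)) \<longlongrightarrow> 1 / (1 - 0)) at_top"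
    by (intro tendsto_intros y_over_ln[OF y]) auto
  moreover have "eventually (\<lambda>t. 1 / (1 - y t / ln t) = t / ?a t) at_top"
    using ago_eventually_pos[OF y] by eventually_elim (simp add: ago_def)
  ultimately have ta: "((\<lambda>t. t / ?a t) \<longlongrightarrow> 1) at_top" by (force intro: Lim_transform_eventually)
  have "((\<lambda>t. 1 / ln t) \<longlongrightarrow> (0::real)) at_top" by real_asymp
  hence "((\<lambda>t. l t * ln t / t * (1 / ln t) * (t / ?a t)) \<longlongrightarrow> 0 * 0 * 1) at_top"
    by (intro tendsto_mult length_negligible ta)
  moreover have "eventually (\<lambda>t. l t * ln t / t * (1 / ln t) * (t / ?a t) = l t / ?a t) at_top"
    using eventually_gt_at_top[of 1] by eventually_elim simp
  ultimately have z: "((\<lambda>t. l t / ?a t) \<longlongrightarrow> 0) at_top" by (force intro: Lim_transform_eventually)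
  have "eventually (\<lambda>t. t / ?a t = t / l t * (l t / ?a t)) at_top"
    using length_eventually_pos by eventually_elim simp
  with ta have "((\<lambda>t. t / l t * (l t / ?a t)) \<longlongrightarrow> 1) at_top" by (rule Lim_transform_eventually)
  from tendsto_minus[OF powr_linearization[OF z this, of "\<alpha> - 1"]]
  have "((\<lambda>t. - (t / l t * ((1 + l t / ?a t) powr (\<alpha> - 1) - 1))) \<longlongrightarrow> 1 - \<alpha>) at_top" by simp
  moreover have "eventually (\<lambda>t. - (t / l t * ((1 + l t / ?a t) powr (\<alpha> - 1) - 1)) = rate_drop (l t) (?a t) * (t / l t)) at_top"
    using ago_eventually_pos[OF y] length_eventually_pos
  proof eventually_elim
    case (elim t)
    have "(?a t / (?a t + l t)) powr (1 - \<alpha>) = (1 / (1 + l t / ?a t)) powr (1 - \<alpha>)"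
      using elim by (simp add: field_simps)
    also have "\<dots> = (1 + l t / ?a t) powr (\<alpha> - 1)"
      using elim powr_minus_divide[of "1 + l t / ?a t" "1 - \<alpha>"] by (simp add: powr_divide)
    finally show ?case by (simp add: rate_drop_def algebra_simps)
  qed
  ultimately show ?thesis by (force intro: Lim_transform_eventually)
qed

text \<open>
The centering makes \<open>exp (centering t)\<close> proportional to \<open>t / l t\<close>, the number of disjoint intervals
of critical length before time \<open>t\<close>.
\<close>

lemma scale_limit: "((\<lambda>t. exp (- centering t) * (t / l t)) \<longlongrightarrow> 1 - \<alpha>) at_top"
proof -
  have "((\<lambda>t. \<alpha> * (1 - \<alpha>) / (rate t * l t / ln t)) \<longlongrightarrow> \<alpha> * (1 - \<alpha>) / \<alpha>) at_top"
    using alpha_pos by (intro tendsto_intros rate_length_over_ln) auto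
  moreover have "eventually (\<lambda>t. \<alpha> * (1 - \<alpha>) / (rate t * l t / ln t) = exp (- centering t) * (t / l t)) at_top"
    using eventually_gt_at_top[of 1] length_eventually_pos
  proof eventually_elim
    case (elim t)
    have "t powr (- \<alpha>) * t = 1 / t powr (\<alpha> - 1)"
      using elim by (simp add: powr_diff powr_minus field_simps)
    hence "t powr (- \<alpha>) * t * t powr (\<alpha> - 1) = 1" using elim by simp
    moreover have "\<alpha> * (1 - \<alpha>) / (rate t * l t / ln t)
      = \<alpha> * (1 - \<alpha>) / \<kappa> * ln t / l t * (1 / t powr (\<alpha> - 1))"
      by (simp add: rate_def)
    ultimately have "\<alpha> * (1 - \<alpha>) / (rate t * l t / ln t)
      = \<alpha> * (1 - \<alpha>) / \<kappa> * ln t / l t * (t powr (- \<alpha>) * t)"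
      by (simp add: \<open>t powr (- \<alpha>) * t = 1 / t powr (\<alpha> - 1)\<close>)
    thus ?case using elim by (simp add: exp_minus_centering)
  qed
  ultimately show ?thesis using alpha_pos by (force intro: Lim_transform_eventually)
qed

lemma vacancy_over_rate_drop_limit:
  assumes y: "(y \<longlongrightarrow> y0) at_top" and y': "(y' \<longlongrightarrow> y0') at_top"
  shows "((\<lambda>t. vacancy (l t) (ago (y t) t) / rate_drop (l t) (ago (y' t) t)) \<longlongrightarrow> exp (- (x + \<alpha> * (1 - \<alpha>) * y0))) at_top"
proof -
  have "((\<lambda>t. vacancy (l t) (ago (y t) t) * exp (centering t) * (exp (- centering t) * (t / l t))
      / (rate_drop (l t) (ago (y' t) t) * (t / l t))) \<longlongrightarrow>
      exp (- (x + \<alpha> * (1 - \<alpha>) * y0)) * (1 - \<alpha>) / (1 - \<alpha>)) at_top"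
    using alpha_less_1 by (intro tendsto_intros vacancy_limit[OF y] rate_drop_limit[OF y'] scale_limit) auto
  moreover have "eventually (\<lambda>t. vacancy (l t) (ago (y t) t) * exp (centering t) * (exp (- centering t) * (t / l t))
      / (rate_drop (l t) (ago (y' t) t) * (t / l t)) = vacancy (l t) (ago (y t) t) / rate_drop (l t) (ago (y' t) t)) at_top"
    using eventually_gt_at_top[of 1] length_eventually_pos
    by eventually_elim (simp add: exp_minus)
  ultimately show ?thesis using alpha_less_1 by (force intro: Lim_transform_eventually)
qed

lemma vacancy_tendsto_0:
  assumes y: "(y \<longlongrightarrow> y0) at_top"
  shows "((\<lambda>t. vacancy (l t) (ago (y t) t)) \<longlongrightarrow> 0) at_top"
proof -
  have "((\<lambda>t. exp (- centering t)) \<longlongrightarrow> 0) at_top"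
    using centering_at_top by (intro filterlim_compose[OF exp_at_bot]) (simp add: filterlim_uminus_at_bot)
  from tendsto_mult[OF vacancy_limit[OF y] this] show ?thesis by (simp add: exp_minus mult.assoc)
qed

text \<open>
This is the error term of the lower bound for the no-run probability. The vacancy probability is of
order \<open>t powr (- \<alpha>)\<close> and the mean over the first \<open>l t\<close> time units of order
\<open>t powr (\<alpha> (1 - \<alpha>))\<close>, up to powers of \<open>ln t\<close>; the product vanishes because \<open>1 - \<alpha> < 1\<close>.
\<close>

lemma vacancy_mean_tendsto_0:
  assumes y: "(y \<longlongrightarrow> y0) at_top"
  shows "((\<lambda>t. vacancy (l t) (ago (y t) t) * (1 + mean 0 (l t))) \<longlongrightarrow> 0) at_top"
proof -
  have "((\<lambda>t. \<alpha> * (1 - \<alpha>) / \<kappa> * ln t * t powr (- \<alpha>) * (\<kappa> / \<alpha> * (ln t * t powr (1 - \<alpha>) / \<kappa>) powr \<alpha>)) \<longlongrightarrow> 0) at_top"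
    using alpha_pos alpha_less_1 kappa_pos by real_asymp
  hence "((\<lambda>t. vacancy (l t) (ago (y t) t) * exp (centering t) * ((rate t * l t / ln t) powr \<alpha> *
    (\<alpha> * (1 - \<alpha>) / \<kappa> * ln t * t powr (- \<alpha>) * (\<kappa> / \<alpha> * (ln t * t powr (1 - \<alpha>) / \<kappa>) powr \<alpha>)))) \<longlongrightarrow>
     exp (- (x + \<alpha> * (1 - \<alpha>) * y0)) * (\<alpha> powr \<alpha> * 0)) at_top"
    using alpha_pos by (intro tendsto_mult vacancy_limit[OF y] tendsto_powr rate_length_over_ln tendsto_const) auto
  moreover have "eventually (\<lambda>t. vacancy (l t) (ago (y t) t) * exp (centering t) * ((rate t * l t / ln t) powr \<alpha> *
    (\<alpha> * (1 - \<alpha>) / \<kappa> * ln t * t powr (- \<alpha>) * (\<kappa> / \<alpha> * (ln t * t powr (1 - \<alpha>) / \<kappa>) powr \<alpha>)))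
      = vacancy (l t) (ago (y t) t) * mean 0 (l t)) at_top"
    using eventually_gt_at_top[of 1] length_eventually_pos
  proof eventually_elim
    case (elim t)
    have e: "exp (centering t) * (\<alpha> * (1 - \<alpha>) / \<kappa> * ln t * t powr (- \<alpha>)) = 1"
      using exp_minus_centering[of t] elim by (metis exp_minus_inverse)
    have "(rate t * l t / ln t) powr \<alpha> * (ln t * t powr (1 - \<alpha>) / \<kappa>) powr \<alpha>
        = (rate t * l t / ln t * (ln t * t powr (1 - \<alpha>) / \<kappa>)) powr \<alpha>"
      by (rule powr_mult[symmetric])
    also have "rate t * l t / ln t * (ln t * t powr (1 - \<alpha>) / \<kappa>) = l t"
      using elim kappa_pos by (simp add: rate_def powr_diff field_simps)
    finally have f: "(rate t * l t / ln t) powr \<alpha> * (ln t * t powr (1 - \<alpha>) / \<kappa>) powr \<alpha> = l t powr \<alpha>" .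
    have "vacancy (l t) (ago (y t) t) * exp (centering t) * ((rate t * l t / ln t) powr \<alpha> *
    (\<alpha> * (1 - \<alpha>) / \<kappa> * ln t * t powr (- \<alpha>) * (\<kappa> / \<alpha> * (ln t * t powr (1 - \<alpha>) / \<kappa>) powr \<alpha>)))
      = vacancy (l t) (ago (y t) t) * (exp (centering t) * (\<alpha> * (1 - \<alpha>) / \<kappa> * ln t * t powr (- \<alpha>))) *
        (\<kappa> / \<alpha> * ((rate t * l t / ln t) powr \<alpha> * (ln t * t powr (1 - \<alpha>) / \<kappa>) powr \<alpha>))" by (simp only: ac_simps)
    also have "\<dots> = vacancy (l t) (ago (y t) t) * mean 0 (l t)"
      unfolding e f using alpha_pos by (simp add: mean_def)
    finally show ?case .
  qed
  ultimately have "((\<lambda>t. vacancy (l t) (ago (y t) t) * mean 0 (l t)) \<longlongrightarrow> 0) at_top"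
    by (force intro: Lim_transform_eventually)
  from tendsto_add[OF vacancy_tendsto_0[OF y] this] show ?thesis by (simp add: algebra_simps)
qed

end

end

section \<open>Limits of the no-run probabilities\<close>

context power_rate_poisson
begin

text \<open>
With this many cells the width of a cell is at most \<open>1 / t\<close>, which is negligible with respect to the
mean spacing \<open>1 / rate t\<close> of the points near \<open>t\<close>.
\<close>

definition cells :: "real \<Rightarrow> nat" where
  "cells t = nat \<lceil>t\<^sup>2\<rceil>"

lemma cells_ge: "t\<^sup>2 \<le> real (cells t)"
  by (simp add: cells_def real_nat_ceiling_ge)

lemma cells_pos: "0 < t \<Longrightarrow> 0 < cells t"
  by (simp add: cells_def)

lemma cell_width_le:
  assumes "0 < t" "b - a \<le> t" shows "(b - a) / real (cells t) \<le> 1 / t"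
proof -
  have "(b - a) / real (cells t) \<le> t / real (cells t)" using assms by (intro divide_right_mono) auto
  also have "\<dots> \<le> t / t\<^sup>2" using assms cells_ge[of t] by (intro divide_left_mono) (auto simp: zero_less_mult_iff cells_pos)
  finally show ?thesis using assms by (simp add: power2_eq_square)
qed

lemma ago_diff: "ago y t - ago y' t = t * ((y' - y) / ln t)"
  by (simp add: ago_def right_diff_distrib diff_divide_distrib)

lemma ago_minus: "1 < t \<Longrightarrow> ago y t - l = ago (y + l * ln t / t) t"
  by (simp add: ago_def field_simps)

lemma ago_ge_half: "eventually (\<lambda>t. 1 < t \<and> t / 2 \<le> ago y t) at_top"
proof -
  have "eventually (\<lambda>t::real. y / ln t < 1 / 2) at_top"
  proof (rule order_tendstoD)
    show "((\<lambda>t. y / ln t) \<longlongrightarrow> 0) at_top" by real_asymp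
  qed simp
  thus ?thesis using eventually_gt_at_top[of 1]
    by eventually_elim (simp add: ago_def)
qed

lemma ago_le: "0 \<le> y \<Longrightarrow> 1 < t \<Longrightarrow> ago y t \<le> t"
  using mult_left_mono[of "1 - y / ln t" 1 t] divide_nonneg_pos[of y "ln t"] by (simp add: ago_def)

lemma cell_width:
  assumes "0 \<le> yb" "yb < ya"
  shows "\<forall>\<^sub>F t in at_top. 0 < (ago yb t - ago ya t) / real (cells t) \<and> (ago yb t - ago ya t) / real (cells t) \<le> 1 / t"
  using ago_ge_half[of ya]
proof eventually_elim
  case (elim t)
  have "0 < ago yb t - ago ya t" using assms elim by (simp add: ago_diff)
  moreover have "ago yb t - ago ya t \<le> t" using ago_le[of yb t] assms elim by simp
  ultimately show ?case using elim cells_pos[of t] cell_width_le[of t "ago yb t" "ago ya t"] by simp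
qed

text \<open>
Between the normalised positions \<open>ya > yb\<close>, runs of \<open>m t\<close> cells of width \<open>h t\<close> are considered whose
length \<open>l t\<close> is critical. The expected number of long gaps in the interval tends to the difference
of two exponentials, one for each endpoint.
\<close>

context
  fixes l h :: "real \<Rightarrow> real" and m :: "real \<Rightarrow> nat" and x yb :: real
  assumes yb: "0 \<le> yb" and l_def: "l = (\<lambda>t. real (m t) * h t)"
    and l: "((\<lambda>t. rate t * l t - centering t) \<longlongrightarrow> x) at_top"
begin

lemma window_valid:
  assumes ya: "yb < ya" and a: "\<forall>\<^sub>F t in at_top. a t \<le> ago ya t"
    and h: "h = (\<lambda>t. (ago yb t - a t) / real (cells t))"
  shows "eventually (\<lambda>t. 1 < t \<and> a t < ago yb t \<and> 0 < m t \<and> m t < cells t) at_top"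
proof -
  have "eventually (\<lambda>t. l t * ln t / t < ya - yb) at_top"
    using order_tendstoD(2)[OF length_negligible[OF l], of "ya - yb"] ya by simp
  thus ?thesis using length_eventually_pos[OF l] eventually_gt_at_top[of 1] a
  proof eventually_elim
    case (elim t)
    have "l t < t * ((ya - yb) / ln t)" using elim by (simp add: field_simps)
    also have "\<dots> = ago yb t - ago ya t" by (simp add: ago_diff)
    also have "\<dots> \<le> ago yb t - a t" using elim by simp
    finally have lt: "l t < ago yb t - a t" .
    hence ab: "a t < ago yb t" using elim by simp
    have c: "0 < real (cells t)" using cells_pos[of t] elim by simp
    have "real (m t) * (ago yb t - a t) < real (cells t) * (ago yb t - a t)"
      using lt c by (simp add: l_def h field_simps)
    hence "m t < cells t" using ab by simp
    moreover have "0 < m t" using elim(2) by (cases "m t = 0") (auto simp: l_def)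
    ultimately show ?case using elim ab by simp
  qed
qed

lemma no_run_upper_limit:
  assumes ya: "yb < ya" and h: "h = (\<lambda>t. (ago yb t - ago ya t) / real (cells t))"
  shows "\<exists>g. (g \<longlongrightarrow> exp (- (exp (- (x + \<alpha> * (1 - \<alpha>) * yb)) - exp (- (x + \<alpha> * (1 - \<alpha>) * ya))))) at_top \<and>
    (\<forall>\<^sub>F t in at_top. \<P>(\<omega> in M. no_run (m t) (cells t) (incr (grid (ago ya t) (ago yb t) (cells t)) \<omega>)) \<le> g t)"
proof (intro exI conjI)
  let ?v = "\<lambda>t. ago (yb + l t * ln t / t) t"
  define g where "g t = exp (- (exp (- (rate (ago ya t) * h t)) *
     (vacancy (l t) (?v t) / rate_drop (l t) (ago ya t) - vacancy (l t) (ago ya t) / rate_drop (l t) (ago ya t))))" for t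
  have rh: "((\<lambda>t. rate (ago ya t) * h t) \<longlongrightarrow> 0) at_top"
  proof (rule tendsto_sandwich[OF _ _ tendsto_const])
    show "((\<lambda>t. \<kappa> * (t / 2) powr (\<alpha> - 1) * (1 / t)) \<longlongrightarrow> 0) at_top"
      using alpha_less_1 kappa_pos by real_asymp
    have ev: "\<forall>\<^sub>F t in at_top. 1 < t \<and> 0 < h t \<and> h t \<le> 1 / t \<and> 0 < rate (ago ya t) \<and> rate (ago ya t) \<le> rate (t / 2)"
      using ago_ge_half[of ya] cell_width[OF yb ya]
    proof eventually_elim
      case (elim t)
      thus ?case using rate_pos[of "ago ya t"] rate_antimono[of "t/2" "ago ya t"] by (simp add: h)
    qed
    show "\<forall>\<^sub>F t in at_top. rate (ago ya t) * h t \<le> \<kappa> * (t / 2) powr (\<alpha> - 1) * (1 / t)"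
      using ev
    proof eventually_elim
      case (elim t)
      hence "rate (ago ya t) * h t \<le> rate (t / 2) * (1 / t)" by (intro mult_mono) auto
      thus ?case by (simp add: rate_def[of "t / 2"])
    qed
    show "\<forall>\<^sub>F t in at_top. 0 \<le> rate (ago ya t) * h t"
      using ev by eventually_elim simp
  qed
  have 1: "((\<lambda>t. exp (- (rate (ago ya t) * h t))) \<longlongrightarrow> 1) at_top"
    using tendsto_exp[OF tendsto_minus[OF rh]] by simp
  from tendsto_exp[OF tendsto_minus[OF tendsto_mult[OF 1
      tendsto_diff[OF vacancy_over_rate_drop_limit[OF l end_limit[OF l, of yb] tendsto_const[of ya]]
         vacancy_over_rate_drop_limit[OF l tendsto_const[of ya] tendsto_const[of ya]]]]]]
  show "(g \<longlongrightarrow> exp (- (exp (- (x + \<alpha> * (1 - \<alpha>) * yb)) - exp (- (x + \<alpha> * (1 - \<alpha>) * ya))))) at_top"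
    by (simp add: g_def[abs_def])
  show "\<forall>\<^sub>F t in at_top. \<P>(\<omega> in M. no_run (m t) (cells t) (incr (grid (ago ya t) (ago yb t) (cells t)) \<omega>)) \<le> g t"
    using window_valid[OF ya always_eventually[OF allI[OF order_refl]] h] ago_ge_half[of ya]
  proof eventually_elim
    case (elim t)
    have "\<P>(\<omega> in M. no_run (m t) (cells t) (incr (grid (ago ya t) (ago yb t) (cells t)) \<omega>))
      \<le> exp (- (exp (- (rate (ago ya t) * h t)) * ((vacancy (l t) (ago yb t - l t) - vacancy (l t) (ago ya t)) / rate_drop (l t) (ago ya t))))"
      using prob_grid_no_run_le[of "ago ya t" "ago yb t" "m t" "cells t"] elim
      by (simp add: l_def h)
    thus ?case using elim by (simp add: g_def ago_minus diff_divide_distrib)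
  qed
qed

text \<open>
The starting time \<open>a t\<close> is either a moving time or the origin. \<open>A t\<close> stands for what is kept of the
vacancy probability at \<open>a t\<close>: all of it in the first case, and 0 in the second.
\<close>

lemma no_run_lower_limit:
  assumes ya: "yb < ya" and h: "h = (\<lambda>t. (ago yb t - a t) / real (cells t))"
    and a: "\<forall>\<^sub>F t in at_top. a t \<le> ago ya t" "\<forall>\<^sub>F t in at_top. 0 \<le> a t"
    and A: "\<forall>\<^sub>F t in at_top. A t \<le> vacancy (l t) (a t)"
      "((\<lambda>t. A t / rate_drop (l t) (ago (yb + l t * ln t / t) t)) \<longlongrightarrow> A0) at_top"
  shows "\<exists>g. (g \<longlongrightarrow> exp (- (exp (- (x + \<alpha> * (1 - \<alpha>) * yb)) - A0))) at_top \<and>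
    (\<forall>\<^sub>F t in at_top. g t \<le> \<P>(\<omega> in M. no_run (m t) (cells t) (incr (grid (a t) (ago yb t) (cells t)) \<omega>)))"
proof (intro exI conjI)
  let ?v = "\<lambda>t. ago (yb + l t * ln t / t) t"
  define g where "g t = exp (- ((vacancy (l t) (?v t) / rate_drop (l t) (?v t) - A t / rate_drop (l t) (?v t)) / (1 - vacancy (l t) (?v t))))
     - vacancy (l t) (?v t) * (1 + mean 0 (l t))" for t
  have 1: "((\<lambda>t. 1 - vacancy (l t) (?v t)) \<longlongrightarrow> 1) at_top"
    using tendsto_diff[OF tendsto_const[of 1] vacancy_tendsto_0[OF l end_limit[OF l, of yb]]] by simp
  from tendsto_diff[OF tendsto_exp[OF tendsto_minus[OF tendsto_divide[OF 
      tendsto_diff[OF vacancy_over_rate_drop_limit[OF l end_limit[OF l, of yb] end_limit[OF l, of yb]] A(2)] 1]]] vacancy_mean_tendsto_0[OF l end_limit[OF l, of yb]]]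
  show "(g \<longlongrightarrow> exp (- (exp (- (x + \<alpha> * (1 - \<alpha>) * yb)) - A0))) at_top"
    by (simp add: g_def[abs_def])
  have psi1: "\<forall>\<^sub>F t in at_top. 0 < 1 - vacancy (l t) (?v t)"
    by (rule order_tendstoD(1)[OF 1]) simp
  show "\<forall>\<^sub>F t in at_top. g t \<le> \<P>(\<omega> in M. no_run (m t) (cells t) (incr (grid (a t) (ago yb t) (cells t)) \<omega>))"
    using window_valid[OF ya a(1) h] a(2) A(1) psi1 ago_eventually_pos[OF end_limit[OF l, of yb]] length_eventually_pos[OF l]
  proof eventually_elim
    case (elim t)
    have r: "0 < rate_drop (l t) (?v t)" using elim by (intro rate_drop_pos) auto
    have "exp (- ((vacancy (l t) (ago yb t - l t) - vacancy (l t) (a t)) / (rate_drop (l t) (ago yb t - l t) * (1 - vacancy (l t) (ago yb t - l t)))))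
       - vacancy (l t) (ago yb t - l t) * (1 + mean 0 (l t)) \<le>
       \<P>(\<omega> in M. no_run (m t) (cells t) (incr (grid (a t) (ago yb t) (cells t)) \<omega>))"
      using prob_grid_no_run_ge[of "a t" "ago yb t" "m t" "cells t"] elim
      by (simp add: l_def h)
    hence "exp (- ((vacancy (l t) (?v t) - vacancy (l t) (a t)) / (rate_drop (l t) (?v t) * (1 - vacancy (l t) (?v t)))))
       - vacancy (l t) (?v t) * (1 + mean 0 (l t)) \<le>
       \<P>(\<omega> in M. no_run (m t) (cells t) (incr (grid (a t) (ago yb t) (cells t)) \<omega>))"
      using elim by (simp add: ago_minus)
    moreover have "(vacancy (l t) (?v t) - vacancy (l t) (a t)) / (rate_drop (l t) (?v t) * (1 - vacancy (l t) (?v t)))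
        \<le> (vacancy (l t) (?v t) - A t) / (rate_drop (l t) (?v t) * (1 - vacancy (l t) (?v t)))"
      using elim r by (intro divide_right_mono) auto
    ultimately show ?case unfolding g_def
      by (simp add: diff_divide_distrib[symmetric] divide_divide_eq_left)
        (smt (verit) exp_le_cancel_iff)
  qed
qed

end

lemma rate_level: "0 < t \<Longrightarrow> rate t * level x t = centering t + x"
  using rate_pos[of t] by (simp add: level_def)

lemma ceiling_window:
  fixes h L :: real
  assumes "0 < h" "0 \<le> L"
  shows "L \<le> real (nat \<lceil>L / h\<rceil>) * h" "real (nat \<lceil>L / h\<rceil>) * h \<le> L + h"
proof -
  have "0 \<le> L / h" using assms by simp
  hence "L / h \<le> real (nat \<lceil>L / h\<rceil>)" "real (nat \<lceil>L / h\<rceil>) - 1 \<le> L / h" by linarith+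
  hence "L \<le> real (nat \<lceil>L / h\<rceil>) * h" "(real (nat \<lceil>L / h\<rceil>) - 1) * h \<le> L"
    unfolding pos_le_divide_eq[OF assms(1)] pos_divide_le_eq[OF assms(1)] .
  thus "L \<le> real (nat \<lceil>L / h\<rceil>) * h" "real (nat \<lceil>L / h\<rceil>) * h \<le> L + h"
    by (simp_all add: left_diff_distrib)
qed

lemma floor_window:
  fixes h L :: real
  assumes "0 < h" "2 * h \<le> L"
  shows "real (nat \<lfloor>L / h\<rfloor> - 1 + 1) * h \<le> L" "L - 2 * h \<le> real (nat \<lfloor>L / h\<rfloor> - 1) * h"
    "real (nat \<lfloor>L / h\<rfloor> - 1) * h \<le> L"
proof -
  have 2: "2 \<le> L / h" using assms by (simp add: le_divide_eq)
  define k where "k = nat \<lfloor>L / h\<rfloor> - 1"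
  have k: "nat \<lfloor>L / h\<rfloor> = k + 1" unfolding k_def using 2 by linarith
  have "real (k + 1) \<le> L / h" "L / h \<le> real k + 2"
    using k 2 by linarith+
  hence *: "real (k + 1) * h \<le> L" "L \<le> (real k + 2) * h"
    using assms by (simp_all add: pos_le_divide_eq pos_divide_le_eq)
  show "real (nat \<lfloor>L / h\<rfloor> - 1 + 1) * h \<le> L" "L - 2 * h \<le> real (nat \<lfloor>L / h\<rfloor> - 1) * h"
    "real (nat \<lfloor>L / h\<rfloor> - 1) * h \<le> L"
    unfolding k using * assms(1) by (simp_all add: distrib_right)
qed

text \<open>
Rounding the critical length up to a multiple of the cell width serves the upper bound for the
probability of having no long gap; rounding down, with one cell to spare, serves the lower bound,
because a gap need not start at a grid time.
\<close>

lemma window_limits: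
  assumes h: "\<forall>\<^sub>F t in at_top. 0 < h t \<and> h t \<le> 1 / t"
  shows window_up_limit: "((\<lambda>t. rate t * (real (nat \<lceil>level x t / h t\<rceil>) * h t) - centering t) \<longlongrightarrow> x) at_top" (is ?U)
    and window_down_limit: "((\<lambda>t. rate t * (real (nat \<lfloor>level x t / h t\<rfloor> - 1) * h t) - centering t) \<longlongrightarrow> x) at_top" (is ?L)
    and window_up: "\<forall>\<^sub>F t in at_top. level x t \<le> real (nat \<lceil>level x t / h t\<rceil>) * h t"
    and window_down: "\<forall>\<^sub>F t in at_top. real (nat \<lfloor>level x t / h t\<rfloor> - 1 + 1) * h t \<le> level x t"
proof -
  have rt: "((\<lambda>t. rate t * (2 / t)) \<longlongrightarrow> 0) at_top"
    using alpha_less_1 kappa_pos unfolding rate_def by real_asymp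
  have "filterlim (\<lambda>t. x + centering t) at_top at_top"
    by (rule filterlim_tendsto_add_at_top[OF tendsto_const centering_at_top])
  hence "\<forall>\<^sub>F t in at_top. 1 < x + centering t" by (simp add: filterlim_at_top_dense)
  moreover have "\<forall>\<^sub>F t in at_top. rate t * (2 / t) < 1" by (rule order_tendstoD(2)[OF rt]) simp
  ultimately have ev: "\<forall>\<^sub>F t in at_top. 0 < t \<and> 0 < h t \<and> h t \<le> 1 / t \<and> 2 \<le> level x t / h t"
    using h eventually_gt_at_top[of 0]
  proof eventually_elim
    case (elim t)
    have "rate t * (2 / t) < rate t * level x t" using elim rate_level[of t x] by linarith
    hence "2 / t < level x t" using rate_pos[of t] elim mult_less_cancel_left_pos by blast
    moreover have "2 * h t \<le> 2 / t" using elim by simp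
    ultimately have "2 * h t \<le> level x t" by linarith
    thus ?case using elim by (simp add: le_divide_eq)
  qed
  have U: "\<forall>\<^sub>F t in at_top. level x t \<le> real (nat \<lceil>level x t / h t\<rceil>) * h t \<and>
      real (nat \<lceil>level x t / h t\<rceil>) * h t \<le> level x t + 2 / t"
    using ev
  proof eventually_elim
    case (elim t)
    hence "2 * h t \<le> level x t" by (simp add: le_divide_eq)
    moreover have "1 / t \<le> 2 / t" using elim by (simp add: divide_right_mono)
    ultimately show ?case using ceiling_window[of "h t" "level x t"] elim by linarith
  qed
  have L: "\<forall>\<^sub>F t in at_top. real (nat \<lfloor>level x t / h t\<rfloor> - 1 + 1) * h t \<le> level x t \<and>
      level x t - 2 / t \<le> real (nat \<lfloor>level x t / h t\<rfloor> - 1) * h t \<and>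
      real (nat \<lfloor>level x t / h t\<rfloor> - 1) * h t \<le> level x t"
    using ev
  proof eventually_elim
    case (elim t)
    hence 1: "2 * h t \<le> level x t" by (simp add: le_divide_eq)
    have "2 * h t \<le> 2 / t" using elim by simp
    thus ?case using floor_window[of "h t" "level x t"] 1 elim by auto
  qed
  show "\<forall>\<^sub>F t in at_top. level x t \<le> real (nat \<lceil>level x t / h t\<rceil>) * h t"
    using U by eventually_elim simp
  show "\<forall>\<^sub>F t in at_top. real (nat \<lfloor>level x t / h t\<rfloor> - 1 + 1) * h t \<le> level x t"
    using L by eventually_elim simp
  \<comment> \<open>Lengths that miss the level by at most two cells have the same normalised limit.\<close>
  have close: "((\<lambda>t. rate t * k t - centering t) \<longlongrightarrow> x) at_top"
    if k: "\<forall>\<^sub>F t in at_top. level x t - 2 / t \<le> k t \<and> k t \<le> level x t + 2 / t" for k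
  proof (rule tendsto_sandwich)
    show "((\<lambda>t. x - rate t * (2 / t)) \<longlongrightarrow> x) at_top" "((\<lambda>t. x + rate t * (2 / t)) \<longlongrightarrow> x) at_top"
      using tendsto_diff[OF tendsto_const rt] tendsto_add[OF tendsto_const rt] by simp_all
    have *: "\<forall>\<^sub>F t in at_top. x - rate t * (2 / t) \<le> rate t * k t - centering t \<and> rate t * k t - centering t \<le> x + rate t * (2 / t)"
      using k eventually_gt_at_top[of 0]
    proof eventually_elim
      case (elim t)
      have "rate t * (level x t - 2 / t) \<le> rate t * k t" "rate t * k t \<le> rate t * (level x t + 2 / t)"
        using elim rate_pos[of t] by (intro mult_left_mono; simp)+
      thus ?case using elim rate_level[of t x] by (simp add: algebra_simps)
    qed
    show "\<forall>\<^sub>F t in at_top. x - rate t * (2 / t) \<le> rate t * k t - centering t"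
      using * by eventually_elim simp
    show "\<forall>\<^sub>F t in at_top. rate t * k t - centering t \<le> x + rate t * (2 / t)"
      using * by eventually_elim simp
  qed
  show ?U
  proof (rule close)
    show "\<forall>\<^sub>F t in at_top. level x t - 2 / t \<le> real (nat \<lceil>level x t / h t\<rceil>) * h t \<and>
       real (nat \<lceil>level x t / h t\<rceil>) * h t \<le> level x t + 2 / t"
      using U eventually_gt_at_top[of 0] by eventually_elim (auto intro: order_trans[rotated])
  qed
  show ?L
  proof (rule close)
    show "\<forall>\<^sub>F t in at_top. level x t - 2 / t \<le> real (nat \<lfloor>level x t / h t\<rfloor> - 1) * h t \<and>
       real (nat \<lfloor>level x t / h t\<rfloor> - 1) * h t \<le> level x t + 2 / t"
      using L eventually_gt_at_top[of 0] by eventually_elim (auto intro: order_trans)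
  qed
qed

end

section \<open>Epochs, gaps and measurability\<close>

context power_rate_poisson
begin

text \<open>
Right-continuity makes the infimum in the definition of an epoch a minimum as soon as the level is
reached at all.
\<close>

lemma epoch_attained:
  assumes \<omega>: "\<omega> \<in> space M" and i: "0 \<le> T" "i \<le> N T \<omega>"
  shows "0 \<le> epoch N i \<omega>" "i \<le> N (epoch N i \<omega>) \<omega>"
proof -
  let ?S = "{t. 0 \<le> t \<and> i \<le> N t \<omega>}"
  have S: "?S \<noteq> {}" "bdd_below ?S" using i by (auto intro: bdd_belowI[of _ 0])
  show e0: "0 \<le> epoch N i \<omega>" unfolding epoch_def by (rule cInf_greatest[OF S(1)]) auto
  show "i \<le> N (epoch N i \<omega>) \<omega>"
  proof (rule ccontr)
    assume n: "\<not> i \<le> N (epoch N i \<omega>) \<omega>"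
    have "((\<lambda>t. N t \<omega>) \<longlongrightarrow> N (epoch N i \<omega>) \<omega>) (at_right (epoch N i \<omega>))"
      using counting_path_N[OF \<omega>] e0 by (auto simp: counting_path_def continuous_within)
    hence "eventually (\<lambda>s. N s \<omega> < i) (at_right (epoch N i \<omega>))"
      using n by (intro order_tendstoD(2)) auto
    then obtain d where d: "epoch N i \<omega> < d" "\<And>s. epoch N i \<omega> < s \<Longrightarrow> s < d \<Longrightarrow> N s \<omega> < i"
      by (auto simp: eventually_at_right_field)
    obtain s where s: "s \<in> ?S" "s < d"
      using d(1) S by (auto simp: epoch_def cInf_less_iff)
    have "epoch N i \<omega> \<le> s" unfolding epoch_def by (rule cInf_lower[OF s(1) S(2)])
    thus False using s d(2)[of s] n by (cases "s = epoch N i \<omega>") auto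
  qed
qed

lemma epoch_le_iff:
  assumes \<omega>: "\<omega> \<in> space M" and i: "0 \<le> T" "i \<le> N T \<omega>" and u: "0 \<le> u"
  shows "epoch N i \<omega> \<le> u \<longleftrightarrow> i \<le> N u \<omega>"
proof
  assume "epoch N i \<omega> \<le> u"
  thus "i \<le> N u \<omega>" using epoch_attained[OF \<omega> i] N_mono[OF \<omega>] by (meson le_trans)
next
  assume "i \<le> N u \<omega>"
  thus "epoch N i \<omega> \<le> u" using u unfolding epoch_def
    by (intro cInf_lower bdd_belowI[of _ 0]) auto
qed

lemma epoch_mono:
  assumes \<omega>: "\<omega> \<in> space M" and j: "0 \<le> T" "j \<le> N T \<omega>" and ij: "i \<le> j"
  shows "epoch N i \<omega> \<le> epoch N j \<omega>"
  using epoch_le_iff[OF \<omega> j(1), of i "epoch N j \<omega>"] epoch_attained[OF \<omega> j] ij j(2) by auto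

text \<open>
The next point after an empty stretch ends a gap that is strictly longer than the stretch.
\<close>

lemma long_gap_of_empty:
  assumes \<omega>: "\<omega> \<in> space M" and uv: "0 \<le> u" "u \<le> v" "v \<le> T" "N v \<omega> = N u \<omega>" "N v \<omega> < N T \<omega>"
  obtains i where "1 \<le> i" "i \<le> N T \<omega>" "v < epoch N i \<omega>" "epoch N i \<omega> \<le> T" "v - u < gap N i \<omega>"
proof
  let ?i = "Suc (N v \<omega>)"
  have i: "?i \<le> N T \<omega>" "0 \<le> T" using uv by auto
  show "v < epoch N ?i \<omega>" using epoch_le_iff[OF \<omega> i(2,1), of v] uv by auto
  moreover have "epoch N (N v \<omega>) \<omega> \<le> u" using epoch_le_iff[OF \<omega> uv(1), of "N v \<omega>" u] uv by auto
  ultimately show "v - u < gap N ?i \<omega>" by (simp add: gap_def)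
  show "epoch N ?i \<omega> \<le> T" using epoch_le_iff[OF \<omega> i(2,1), of T] uv by auto
qed (use uv in auto)

lemma constant_on_gap:
  assumes \<omega>: "\<omega> \<in> space M" and i: "1 \<le> i" "0 \<le> T" "i \<le> N T \<omega>"
    and uv: "0 \<le> u" "epoch N (i - 1) \<omega> \<le> u" "u \<le> v" "v < epoch N i \<omega>"
  shows "N v \<omega> = N u \<omega>"
proof -
  have "i - 1 \<le> N u \<omega>" using epoch_le_iff[OF \<omega> i(2), of "i - 1" u] i uv by auto
  moreover have "\<not> i \<le> N v \<omega>" using epoch_le_iff[OF \<omega> i(2,3), of v] uv by auto
  ultimately show ?thesis using N_mono[OF \<omega> uv(1,3)] by linarith
qed

text \<open>
Rounding the start of the gap up to the next grid time loses less than one cell; the \<open>m\<close> cells that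
follow are contained in the gap and hence empty.
\<close>

lemma run_of_gap:
  assumes \<omega>: "\<omega> \<in> space M" and i: "1 \<le> i" "i \<le> N b \<omega>"
    and ab: "0 \<le> a" "a < b" "0 < n" and gap: "a \<le> epoch N (i - 1) \<omega>" "epoch N i \<omega> \<le> b"
    "real (m + 1) * ((b - a) / real n) \<le> gap N i \<omega>"
  shows "\<not> no_run m n (incr (grid a b n) \<omega>)"
proof -
  define h where "h = (b - a) / real n"
  have h: "0 < h" "real n * h = b - a" using ab by (auto simp: h_def)
  define j where "j = nat \<lceil>(epoch N (i - 1) \<omega> - a) / h\<rceil>"
  have p: "0 \<le> (epoch N (i - 1) \<omega> - a) / h" using gap h by simp
  have "(epoch N (i - 1) \<omega> - a) / h \<le> real j" "real j < (epoch N (i - 1) \<omega> - a) / h + 1"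
    unfolding j_def using p by linarith+
  hence j: "epoch N (i - 1) \<omega> \<le> a + real j * h" "a + real j * h < epoch N (i - 1) \<omega> + h"
    using h by (auto simp: field_simps)
  have g: "grid a b n k = a + real k * h" for k by (simp add: grid_def h_def)
  have jm: "a + real (j + m) * h < epoch N i \<omega>"
    using j gap(3) by (simp add: gap_def h_def[symmetric] algebra_simps)
  hence "real (j + m) * h < real n * h" using gap(2) h by linarith
  hence jn: "j + m \<le> n" using h(1) by simp
  have "N (grid a b n (j + m)) \<omega> = N (grid a b n j) \<omega>"
    by (rule constant_on_gap[OF \<omega> i(1) _ i(2)]) (use ab h j jm gap in \<open>auto simp: g algebra_simps\<close>)
  thus ?thesis using no_run_incr_iff[OF \<omega>, of "grid a b n" n m] jn ab grid_Suc[of a b n] by auto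
qed

lemma reaches_iff: "\<omega> \<in> space M \<Longrightarrow> (\<exists>t\<ge>0. i \<le> N t \<omega>) \<longleftrightarrow> (\<exists>n. i \<le> N (real n) \<omega>)"
  by (meson N_mono le_trans of_nat_0_le_iff real_arch_simple)

lemma epoch_unreached: "\<omega> \<in> space M \<Longrightarrow> \<not> (\<exists>n. i \<le> N (real n) \<omega>) \<Longrightarrow> epoch N i \<omega> = Inf {}"
proof -
  assume "\<omega> \<in> space M" "\<not> (\<exists>n. i \<le> N (real n) \<omega>)"
  hence "{t. 0 \<le> t \<and> i \<le> N t \<omega>} = {}" using reaches_iff[of \<omega> i] by auto
  thus ?thesis by (simp only: epoch_def)
qed

text \<open>
Measurability has to hold on all of the sample space. If the path stays below \<open>i\<close>, the epoch is the
fixed value \<open>Inf {}\<close>; whether this happens is decided by the countably many variables \<open>N n\<close>.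
\<close>

lemma epoch_measurable [measurable]: "epoch N i \<in> borel_measurable M"
  unfolding borel_measurable_iff_le
proof
  fix x :: real
  have [measurable]: "N (real n) \<in> measurable M (count_space UNIV)" for n :: nat by (rule N_measurable) simp
  have [measurable]: "N (max 0 x) \<in> measurable M (count_space UNIV)" by (rule N_measurable) simp
  have "epoch N i \<omega> \<le> x \<longleftrightarrow> (if \<exists>n. i \<le> N (real n) \<omega> then 0 \<le> x \<and> i \<le> N (max 0 x) \<omega> else Inf {} \<le> x)"
    if \<omega>: "\<omega> \<in> space M" for \<omega>
  proof (cases "\<exists>n. i \<le> N (real n) \<omega>")
    case True
    then obtain n where "i \<le> N (real n) \<omega>" by auto
    thus ?thesis using epoch_le_iff[OF \<omega>, of "real n" i x] epoch_attained(1)[OF \<omega>, of "real n" i] True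
      by (auto simp: max_def)
  qed (use epoch_unreached[OF \<omega>] in auto)
  hence "{\<omega>\<in>space M. epoch N i \<omega> \<le> x} =
    {\<omega>\<in>space M. if \<exists>n. i \<le> N (real n) \<omega> then 0 \<le> x \<and> i \<le> N (max 0 x) \<omega> else Inf {} \<le> x}"
    by (intro Collect_cong conj_cong refl)
  also have "\<dots> \<in> events" by measurable
  finally show "{\<omega>\<in>space M. epoch N i \<omega> \<le> x} \<in> events" .
qed

lemma gap_measurable [measurable]: "gap N i \<in> borel_measurable M"
  unfolding gap_def[abs_def] by measurable

text \<open>
On a bounded path infinitely many indices may have an epoch below \<open>t\<close>, but the unreached epochs
coincide, so that only one further value, 0, arises. On an unbounded path the indices are at most
\<open>N t\<close>.
\<close>

lemma finite_gaps:
  assumes \<omega>: "\<omega> \<in> space M" and t: "0 \<le> t"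
  shows "finite {gap N i \<omega> | i. 1 \<le> i \<and> epoch N i \<omega> \<le> t}"
proof (cases "\<exists>i. \<forall>n. N (real n) \<omega> < i")
  case True
  then obtain i0 where i0: "\<And>n. N (real n) \<omega> < i0" by auto
  have e: "epoch N i \<omega> = Inf {}" if "i0 \<le> i" for i
  proof (rule epoch_unreached[OF \<omega>])
    show "\<not> (\<exists>n. i \<le> N (real n) \<omega>)" using i0 that by (meson leD le_trans)
  qed
  have "gap N i \<omega> = 0" if "i0 < i" for i using e[of i] e[of "i - 1"] that by (simp add: gap_def)
  hence "gap N i \<omega> \<in> insert 0 ((\<lambda>i. gap N i \<omega>) ` {..i0})" for i
    by (cases "i0 < i") auto
  hence "{gap N i \<omega> | i. 1 \<le> i \<and> epoch N i \<omega> \<le> t} \<subseteq> insert 0 ((\<lambda>i. gap N i \<omega>) ` {..i0})"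
    by blast
  thus ?thesis by (rule finite_subset) simp
next
  case False
  have "{gap N i \<omega> | i. 1 \<le> i \<and> epoch N i \<omega> \<le> t} \<subseteq> (\<lambda>i. gap N i \<omega>) ` {..N t \<omega>}"
  proof clarify
    fix i assume i: "1 \<le> i" "epoch N i \<omega> \<le> t"
    obtain n where "i \<le> N (real n) \<omega>" using False by (meson not_less)
    hence "i \<le> N t \<omega>" using epoch_le_iff[OF \<omega>, of "real n" i t] t i by auto
    thus "gap N i \<omega> \<in> (\<lambda>i. gap N i \<omega>) ` {..N t \<omega>}" by auto
  qed
  thus ?thesis by (rule finite_subset) simp
qed

text \<open>
The maximum is compared with \<open>x\<close> by a countable condition, except that an empty set of gaps yields
the constant \<open>Max {}\<close>.
\<close>

lemma longest_gap_measurable [measurable]: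
  assumes t: "0 \<le> t" shows "longest_gap N t \<in> borel_measurable M"
  unfolding borel_measurable_iff_le
proof
  fix x :: real
  have "longest_gap N t \<omega> \<le> x \<longleftrightarrow>
     (if \<exists>i\<ge>1. epoch N i \<omega> \<le> t then \<forall>i\<ge>1. epoch N i \<omega> \<le> t \<longrightarrow> gap N i \<omega> \<le> x else Max {} \<le> x)"
    if \<omega>: "\<omega> \<in> space M" for \<omega>
  proof (cases "\<exists>i\<ge>1. epoch N i \<omega> \<le> t")
    case True
    hence "{gap N i \<omega> | i. 1 \<le> i \<and> epoch N i \<omega> \<le> t} \<noteq> {}" by auto
    from Max_le_iff[OF finite_gaps[OF \<omega> t] this, of x] show ?thesis using True
      unfolding longest_gap_def by auto
  next
    case False
    hence "{gap N i \<omega> | i. 1 \<le> i \<and> epoch N i \<omega> \<le> t} = {}" by auto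
    hence "longest_gap N t \<omega> = Max {}" by (simp only: longest_gap_def)
    thus ?thesis by (simp only: False if_False)
  qed
  hence "{\<omega>\<in>space M. longest_gap N t \<omega> \<le> x} = {\<omega>\<in>space M.
     if \<exists>i\<ge>1. epoch N i \<omega> \<le> t then \<forall>i\<ge>1. epoch N i \<omega> \<le> t \<longrightarrow> gap N i \<omega> \<le> x else Max {} \<le> x}"
    by (intro Collect_cong conj_cong refl)
  also have "\<dots> \<in> events" by measurable
  finally show "{\<omega>\<in>space M. longest_gap N t \<omega> \<le> x} \<in> events" .
qed

lemma longest_gap_end_measurable [measurable]:
  assumes t: "0 \<le> t" shows "longest_gap_end N t \<in> borel_measurable M"
  unfolding borel_measurable_iff_less
proof
  fix x :: real
  note [measurable] = longest_gap_measurable[OF t]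
  have "longest_gap_end N t \<omega> < x \<longleftrightarrow>
     (if \<exists>i\<ge>1. gap N i \<omega> = longest_gap N t \<omega> then \<exists>i\<ge>1. gap N i \<omega> = longest_gap N t \<omega> \<and> epoch N i \<omega> < x
      else Inf {} < x)"
    if \<omega>: "\<omega> \<in> space M" for \<omega>
  proof (cases "\<exists>i\<ge>1. gap N i \<omega> = longest_gap N t \<omega>")
    case True
    have "min 0 (Inf {}) \<le> epoch N i \<omega>" for i
      using epoch_attained(1)[OF \<omega>, of "real _" i] epoch_unreached[OF \<omega>, of i]
      by (cases "\<exists>n. i \<le> N (real n) \<omega>") (auto intro: min.coboundedI1)
    hence "bdd_below {epoch N i \<omega> | i. 1 \<le> i \<and> gap N i \<omega> = longest_gap N t \<omega>}"
      by (intro bdd_belowI[of _ "min 0 (Inf {})"]) blast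
    with True have "longest_gap_end N t \<omega> < x \<longleftrightarrow> (\<exists>y\<in>{epoch N i \<omega> | i. 1 \<le> i \<and> gap N i \<omega> = longest_gap N t \<omega>}. y < x)"
      unfolding longest_gap_end_def by (intro cInf_less_iff) auto
    thus ?thesis using True by auto
  next
    case False
    hence "{epoch N i \<omega> | i. 1 \<le> i \<and> gap N i \<omega> = longest_gap N t \<omega>} = {}" by auto
    hence "longest_gap_end N t \<omega> = Inf {}" by (simp only: longest_gap_end_def)
    thus ?thesis by (simp only: False if_False)
  qed
  hence "{\<omega>\<in>space M. longest_gap_end N t \<omega> < x} = {\<omega>\<in>space M.
     if \<exists>i\<ge>1. gap N i \<omega> = longest_gap N t \<omega> then \<exists>i\<ge>1. gap N i \<omega> = longest_gap N t \<omega> \<and> epoch N i \<omega> < x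
      else Inf {} < x}"
    by (intro Collect_cong conj_cong refl)
  also have "\<dots> \<in> events" by measurable
  finally show "{\<omega>\<in>space M. longest_gap_end N t \<omega> < x} \<in> events" .
qed

lemma mean_at_top: "filterlim (\<lambda>t. mean 0 t) at_top at_top"
  unfolding mean_def using alpha_pos kappa_pos by real_asymp

lemma prob_few: "((\<lambda>t. \<P>(\<omega> in M. N t \<omega> = k)) \<longlongrightarrow> 0) at_top"
proof -
  have "((\<lambda>x::real. x ^ k / exp x) \<longlongrightarrow> 0) at_top" by (rule tendsto_power_div_exp_0)
  from tendsto_mult[OF tendsto_const[of "1 / fact k"] filterlim_compose[OF this mean_at_top]]
  have "((\<lambda>t. mean 0 t ^ k / fact k * exp (- mean 0 t)) \<longlongrightarrow> 0) at_top"
    by (simp add: exp_minus field_simps)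
  moreover have "eventually (\<lambda>t. mean 0 t ^ k / fact k * exp (- mean 0 t) = \<P>(\<omega> in M. N t \<omega> = k)) at_top"
    using eventually_gt_at_top[of 0]
  proof eventually_elim
    case (elim t)
    have "{\<omega>\<in>space M. N t \<omega> = k} = {\<omega>\<in>space M. N t \<omega> - N 0 \<omega> = k}" using N_zero by auto
    thus ?case using prob_increment[of 0 t k] elim by simp
  qed
  ultimately show ?thesis by (rule Lim_transform_eventually)
qed

text \<open>
The means tend to infinity, so every fixed value of \<open>N t\<close> has a probability tending to 0.
\<close>

lemma AE_unbounded: "AE \<omega> in M. \<forall>i. \<exists>n. i \<le> N (real n) \<omega>"
  unfolding AE_all_countable
proof
  fix i
  have [measurable]: "N (real n) \<in> measurable M (count_space UNIV)" for n :: nat by (rule N_measurable) simp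
  have "((\<lambda>n. \<Sum>k<i. \<P>(\<omega> in M. N (real n) \<omega> = k)) \<longlongrightarrow> (\<Sum>k<i. 0)) sequentially"
    by (intro tendsto_sum filterlim_compose[OF prob_few filterlim_real_sequentially])
  hence lim: "((\<lambda>n. \<Sum>k<i. \<P>(\<omega> in M. N (real n) \<omega> = k)) \<longlongrightarrow> 0) sequentially" by simp
  have "\<P>(\<omega> in M. \<forall>n. N (real n) \<omega> < i) \<le> (\<Sum>k<i. \<P>(\<omega> in M. N (real n) \<omega> = k))" for n
  proof -
    have "\<P>(\<omega> in M. \<forall>n. N (real n) \<omega> < i) \<le> prob (\<Union>k<i. {\<omega>\<in>space M. N (real n) \<omega> = k})"
      by (intro finite_measure_mono) auto
    also have "\<dots> \<le> (\<Sum>k<i. \<P>(\<omega> in M. N (real n) \<omega> = k))"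
      by (intro finite_measure_subadditive_finite) auto
    finally show ?thesis .
  qed
  hence "\<P>(\<omega> in M. \<forall>n. N (real n) \<omega> < i) \<le> 0"
    by (intro tendsto_lowerbound[OF lim]) auto
  hence "\<P>(\<omega> in M. \<not> (\<exists>n. i \<le> N (real n) \<omega>)) = 0"
    by (simp add: not_le antisym)
  thus "AE \<omega> in M. \<exists>n. i \<le> N (real n) \<omega>"
    by (subst (asm) prob_eq_0) (auto simp: AE_iff_null)
qed

end

section \<open>Gaps before and after a given time\<close>

context power_rate_poisson
begin

text \<open>
Indices are restricted by \<open>i \<le> N t\<close> instead of \<open>epoch N i \<le> t\<close>. The two agree on unbounded paths,
and with the former the event says nothing about epochs that are never reached.
\<close>

definition gaps_below :: "real \<Rightarrow> real \<Rightarrow> real \<Rightarrow> real \<Rightarrow> 'a \<Rightarrow> bool" where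
  "gaps_below y x1 x2 t \<omega> \<longleftrightarrow> (\<forall>i. 1 \<le> i \<longrightarrow> i \<le> N t \<omega> \<longrightarrow>
     gap N i \<omega> \<le> (if epoch N i \<omega> \<le> ago y t then level x1 t else level x2 t))"

lemma gaps_below_event: "0 \<le> t \<Longrightarrow> {\<omega>\<in>space M. gaps_below y x1 x2 t \<omega>} \<in> events"
proof -
  assume "0 \<le> t"
  note [measurable] = N_measurable[OF this]
  show ?thesis unfolding gaps_below_def by measurable
qed

text \<open>
An empty run inside \<open>(a, b]\<close> lies in a gap. Either this gap ends in \<open>(a, b]\<close>, and is too long, or it
reaches beyond \<open>b\<close>, and then the last \<open>L\<close> time units before \<open>b\<close> are empty.
\<close>

lemma no_run_or_final_empty:
  assumes \<omega>: "\<omega> \<in> space M" and ab: "0 \<le> a" "a < b" "b \<le> t" "0 < n"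
    and L: "0 \<le> L" "L \<le> real m * ((b - a) / real n)"
    and gaps: "\<And>i. 1 \<le> i \<Longrightarrow> i \<le> N t \<omega> \<Longrightarrow> a < epoch N i \<omega> \<Longrightarrow> epoch N i \<omega> \<le> b \<Longrightarrow> gap N i \<omega> \<le> L"
  shows "no_run m n (incr (grid a b n) \<omega>) \<or> N b \<omega> = N (b - L) \<omega>"
proof (rule ccontr)
  assume c: "\<not> ?thesis"
  let ?g = "grid a b n"
  obtain j where j: "j + m \<le> n" "N (?g (j + m)) \<omega> = N (?g j) \<omega>"
    using c no_run_incr_iff[OF \<omega>, of ?g n m] grid_Suc[of a b n] ab by auto
  have len: "?g (j + m) = ?g j + real m * ((b - a) / real n)" 
    unfolding grid_def of_nat_add distrib_right by simp
  have mono: "?g i \<le> ?g k" if "i \<le> k" "k \<le> n" for i k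
    by (rule time_mono[of n]) (use that grid_Suc ab in auto)
  have g: "a \<le> ?g j" "?g (j + m) \<le> b" "?g j \<le> ?g (j + m)"
    using mono[of 0 j] mono[of "j+m" n] mono[of j "j+m"] j ab by auto
  show False
  proof (cases "N (?g (j + m)) \<omega> < N b \<omega>")
    case True
    obtain i where i: "1 \<le> i" "i \<le> N b \<omega>" "?g (j + m) < epoch N i \<omega>" "epoch N i \<omega> \<le> b"
      "?g (j + m) - ?g j < gap N i \<omega>"
      by (rule long_gap_of_empty[OF \<omega>, of "?g j" "?g (j + m)" b]) (use g ab j True in auto)
    have "N b \<omega> \<le> N t \<omega>" using N_mono[OF \<omega>] ab by auto
    hence "gap N i \<omega> \<le> L" using i g by (intro gaps) auto
    thus False using i len L by linarith
  next
    case False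
    have "?g j \<le> b - L" using len g L by linarith
    hence "N (?g j) \<omega> \<le> N (b - L) \<omega>" "N (b - L) \<omega> \<le> N b \<omega>"
      using g ab L by (auto intro!: N_mono[OF \<omega>])
    thus False using c False j by auto
  qed
qed

text \<open>
Conversely, a long gap within one of the two intervals contains a run of empty cells. A long gap
straddling the time \<open>ago y t\<close> extends by at least half its length, hence by \<open>d\<close>, to one of the
two sides, which is excluded by the last two assumptions.
\<close>

lemma gaps_below_of_no_runs:
  assumes \<omega>: "\<omega> \<in> space M" and s: "0 < ago y t" "ago y t < t" and n: "0 < n"
    and m1: "real (m1 + 1) * ((ago y t - 0) / real n) \<le> level x1 t"
    and m2: "real (m2 + 1) * ((t - ago y t) / real n) \<le> level x2 t"
    and d: "0 < d" "2 * d \<le> level x2 t" "d \<le> ago y t"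
    and run1: "no_run m1 n (incr (grid 0 (ago y t) n) \<omega>)"
    and run2: "no_run m2 n (incr (grid (ago y t) t n) \<omega>)"
    and e1: "N (ago y t) \<omega> \<noteq> N (ago y t - d) \<omega>" and e2: "N (ago y t + d) \<omega> \<noteq> N (ago y t) \<omega>"
  shows "gaps_below y x1 x2 t \<omega>"
  unfolding gaps_below_def
proof (intro allI impI, rule ccontr)
  fix i assume i: "1 \<le> i" "i \<le> N t \<omega>"
    and c: "\<not> gap N i \<omega> \<le> (if epoch N i \<omega> \<le> ago y t then level x1 t else level x2 t)"
  have t: "0 \<le> t" using s by simp
  have it: "epoch N i \<omega> \<le> t" using epoch_le_iff[OF \<omega> t i(2) t] i by simp
  have i1: "i - 1 \<le> N t \<omega>" using i by simp
  have e0: "0 \<le> epoch N (i - 1) \<omega>" by (rule epoch_attained(1)[OF \<omega> t i1])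
  show False
  proof (cases "epoch N i \<omega> \<le> ago y t")
    case True
    have "i \<le> N (ago y t) \<omega>" using epoch_le_iff[OF \<omega> t i(2), of "ago y t"] True s by simp
    thus False using run_of_gap[OF \<omega> i(1), of "ago y t" 0 n m1] run1 True c e0 m1 s n by auto
  next
    case False
    show False
    proof (cases "ago y t \<le> epoch N (i - 1) \<omega>")
      case True
      thus False using run_of_gap[OF \<omega> i(1,2), of "ago y t" n m2] run2 False c e0 m2 s n it by auto
    next
      case before: False
      have "2 * d < epoch N i \<omega> - epoch N (i - 1) \<omega>" using c False d by (simp add: gap_def)
      hence "epoch N (i - 1) \<omega> \<le> ago y t - d \<or> ago y t + d < epoch N i \<omega>" by linarith
      thus False
      proof
        assume "epoch N (i - 1) \<omega> \<le> ago y t - d"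
        hence "N (ago y t) \<omega> = N (ago y t - d) \<omega>"
          using False d by (intro constant_on_gap[OF \<omega> i(1) t i(2)]) auto
        thus False using e1 by simp
      next
        assume "ago y t + d < epoch N i \<omega>"
        hence "N (ago y t + d) \<omega> = N (ago y t) \<omega>"
          using before d s by (intro constant_on_gap[OF \<omega> i(1) t i(2)]) auto
        thus False using e2 by simp
      qed
    qed
  qed
qed

text \<open>
Crude but uniform: before time \<open>t\<close> the rate is at least \<open>rate t\<close>.
\<close>

lemma prob_empty_le:
  assumes "0 \<le> u" "u \<le> v" "0 < v" "v \<le> t"
  shows "\<P>(\<omega> in M. N v \<omega> = N u \<omega>) \<le> exp (- (rate t * (v - u)))"
proof -
  have "rate t * (v - u) \<le> rate v * (v - u)"
    using assms by (intro mult_right_mono rate_antimono) auto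
  also have "\<dots> \<le> mean u v" using assms by (intro rate_le_mean) auto
  finally show ?thesis using prob_empty[OF assms(1,2)] by simp
qed

lemma level_limit: "((\<lambda>t. rate t * level x t - centering t) \<longlongrightarrow> x) at_top"
  by (rule tendsto_eventually)
    (use eventually_gt_at_top[of 0] in \<open>eventually_elim, simp add: rate_level\<close>)

lemma level_bounds:
  assumes "0 < e"
  shows "\<forall>\<^sub>F t in at_top. 1 < t \<and> 0 < level x t \<and> level x t \<le> e * t / ln t \<and> level x t \<le> ago y t"
proof -
  \<comment> \<open>A quarter of \<open>t\<close> suffices, as \<open>ago y t\<close> is eventually at least half of \<open>t\<close>.\<close>
  have "\<forall>\<^sub>F t in at_top. level x t * ln t / t < min e (1 / 4)"
    using length_negligible[OF level_limit] assms by (intro order_tendstoD(2)) auto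
  moreover have "\<forall>\<^sub>F t::real in at_top. 1 < ln t" by real_asymp
  ultimately show ?thesis using length_eventually_pos[OF level_limit, of x] ago_ge_half[of y]
  proof eventually_elim
    case (elim t)
    have *: "level x t * ln t < e * t" "level x t * ln t < t / 4"
      using elim by (simp_all add: pos_divide_less_eq)
    have "level x t \<le> level x t * ln t" using elim by simp
    hence "level x t \<le> ago y t" using elim * by linarith
    thus ?case using elim * by (auto simp: pos_le_divide_eq)
  qed
qed

lemma exp_level_tendsto_0:
  assumes "0 < k" shows "((\<lambda>t. exp (- (rate t * (level x t / k)))) \<longlongrightarrow> 0) at_top"
proof -
  have "filterlim (\<lambda>t. (x + centering t) * (1 / k)) at_top at_top"
    using assms by (intro filterlim_at_top_mult_tendsto_pos[OF tendsto_const]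
        filterlim_tendsto_add_at_top[OF tendsto_const centering_at_top]) auto
  hence "((\<lambda>t. exp (- ((x + centering t) * (1 / k)))) \<longlongrightarrow> 0) at_top"
    by (intro filterlim_compose[OF exp_at_bot]) (simp add: filterlim_uminus_at_bot)
  moreover have "\<forall>\<^sub>F t in at_top. exp (- ((x + centering t) * (1 / k))) = exp (- (rate t * (level x t / k)))"
    using eventually_gt_at_top[of 0]
  proof eventually_elim
    case (elim t)
    have "rate t * (level x t / k) = (rate t * level x t) * (1 / k)" by simp
    thus ?case using rate_level[OF elim, of x] by (simp add: add.commute)
  qed
  ultimately show ?thesis by (rule Lim_transform_eventually)
qed

lemma no_run_event_grid: "0 \<le> a \<Longrightarrow> a \<le> b \<Longrightarrow> {\<omega>\<in>space M. no_run m n (incr (grid a b n) \<omega>)} \<in> events"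
  by (rule no_run_event) (auto intro: grid_Suc)

lemma prob_two_adjacent_grids:
  assumes "0 \<le> a" "a \<le> s" "s \<le> t" "0 < n"
  shows "\<P>(\<omega> in M. no_run m n (incr (grid a s n) \<omega>) \<and> no_run m' n' (incr (grid s t n') \<omega>)) =
    \<P>(\<omega> in M. no_run m n (incr (grid a s n) \<omega>)) * \<P>(\<omega> in M. no_run m' n' (incr (grid s t n') \<omega>))"
  using assms by (intro prob_two_grids) (auto intro: grid_Suc)

text \<open>
The interval before \<open>ago y t\<close> is truncated at \<open>ago Y t\<close>, since the bound for runs is
good only where the rate changes little. The contribution of earlier gaps vanishes as \<open>Y\<close> grows.
\<close>

lemma gaps_below_upper:
  assumes y: "0 < y" "y < Y"
  shows "\<exists>g. (g \<longlongrightarrow> exp (- (exp (- (x1 + \<alpha> * (1 - \<alpha>) * y)) - exp (- (x1 + \<alpha> * (1 - \<alpha>) * Y)))) *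
      exp (- (exp (- x2) - exp (- (x2 + \<alpha> * (1 - \<alpha>) * y))))) at_top \<and>
    (\<forall>\<^sub>F t in at_top. \<P>(\<omega> in M. gaps_below y x1 x2 t \<omega>) \<le> g t)"
proof -
  define h1 where "h1 t = (ago y t - ago Y t) / real (cells t)" for t
  define h2 where "h2 t = (ago 0 t - ago y t) / real (cells t)" for t
  have w1: "\<forall>\<^sub>F t in at_top. 0 < h1 t \<and> h1 t \<le> 1 / t" unfolding h1_def using y by (intro cell_width) auto
  have w2: "\<forall>\<^sub>F t in at_top. 0 < h2 t \<and> h2 t \<le> 1 / t" unfolding h2_def using y by (intro cell_width) auto
  define m1 where "m1 t = nat \<lceil>level x1 t / h1 t\<rceil>" for t
  define m2 where "m2 t = nat \<lceil>level x2 t / h2 t\<rceil>" for t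
  let ?R1 = "\<lambda>t \<omega>. no_run (m1 t) (cells t) (incr (grid (ago Y t) (ago y t) (cells t)) \<omega>)"
  let ?R2 = "\<lambda>t \<omega>. no_run (m2 t) (cells t) (incr (grid (ago y t) (ago 0 t) (cells t)) \<omega>)"
  obtain g1 where g1: "(g1 \<longlongrightarrow> exp (- (exp (- (x1 + \<alpha> * (1 - \<alpha>) * y)) - exp (- (x1 + \<alpha> * (1 - \<alpha>) * Y))))) at_top"
    "\<forall>\<^sub>F t in at_top. \<P>(\<omega> in M. ?R1 t \<omega>) \<le> g1 t"
    using no_run_upper_limit[OF _ refl window_up_limit[OF w1, of x1] y(2)] y
    unfolding h1_def[abs_def] m1_def[abs_def] by auto
  obtain g2 where g2: "(g2 \<longlongrightarrow> exp (- (exp (- (x2 + \<alpha> * (1 - \<alpha>) * 0)) - exp (- (x2 + \<alpha> * (1 - \<alpha>) * y))))) at_top"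
    "\<forall>\<^sub>F t in at_top. \<P>(\<omega> in M. ?R2 t \<omega>) \<le> g2 t"
    using no_run_upper_limit[OF _ refl window_up_limit[OF w2, of x2] y(1)] y
    unfolding h2_def[abs_def] m2_def[abs_def] by auto
  define g where "g t = g1 t * g2 t + exp (- (rate t * (level x1 t / 1))) + exp (- (rate t * (level x2 t / 1)))" for t
  show ?thesis
  proof (intro exI conjI)
    have z: "(0::real) < 1" by simp
    from tendsto_add[OF tendsto_add[OF tendsto_mult[OF g1(1) g2(1)] exp_level_tendsto_0[OF z, of x1]] exp_level_tendsto_0[OF z, of x2]]
    show "(g \<longlongrightarrow> exp (- (exp (- (x1 + \<alpha> * (1 - \<alpha>) * y)) - exp (- (x1 + \<alpha> * (1 - \<alpha>) * Y)))) *
      exp (- (exp (- x2) - exp (- (x2 + \<alpha> * (1 - \<alpha>) * y))))) at_top"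
      by (simp add: g_def[abs_def])
    show "\<forall>\<^sub>F t in at_top. \<P>(\<omega> in M. gaps_below y x1 x2 t \<omega>) \<le> g t"
      using g1(2) g2(2) window_up[OF w1, of x1] window_up[OF w2, of x2] ago_ge_half[of Y] w1 w2
        level_bounds[OF z, of x1 y] level_bounds[OF z, of x2 0]
    proof eventually_elim
      case (elim t)
      have t: "1 < t" and n: "0 < cells t" using elim cells_pos[of t] by auto
      have p: "0 < ago Y t" "ago Y t < ago y t" "ago y t < ago 0 t" "ago 0 t = t"
        using elim y t n by (auto simp: h1_def h2_def ago_def zero_less_divide_iff)
      let ?B1 = "\<lambda>\<omega>. N (ago y t) \<omega> = N (ago y t - level x1 t) \<omega>"
      let ?B2 = "\<lambda>\<omega>. N t \<omega> = N (t - level x2 t) \<omega>"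
      have incl: "(?R1 t \<omega> \<and> ?R2 t \<omega>) \<or> ?B1 \<omega> \<or> ?B2 \<omega>" if "\<omega> \<in> space M" "gaps_below y x1 x2 t \<omega>" for \<omega>
      proof -
        have "?R1 t \<omega> \<or> ?B1 \<omega>"
        proof (rule no_run_or_final_empty[OF that(1), where t=t])
          show "level x1 t \<le> real (m1 t) * ((ago y t - ago Y t) / real (cells t))"
            using elim by (simp add: m1_def h1_def)
          show "gap N i \<omega> \<le> level x1 t" if "1 \<le> i" "i \<le> N t \<omega>" "ago Y t < epoch N i \<omega>" "epoch N i \<omega> \<le> ago y t" for i
            using \<open>gaps_below y x1 x2 t \<omega>\<close> that by (auto simp: gaps_below_def split: if_splits)
        qed (use p n elim in auto)
        moreover have "?R2 t \<omega> \<or> N (ago 0 t) \<omega> = N (ago 0 t - level x2 t) \<omega>"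
        proof (rule no_run_or_final_empty[OF that(1), where t=t])
          show "level x2 t \<le> real (m2 t) * ((ago 0 t - ago y t) / real (cells t))"
            using elim by (simp add: m2_def h2_def)
          show "gap N i \<omega> \<le> level x2 t" if "1 \<le> i" "i \<le> N t \<omega>" "ago y t < epoch N i \<omega>" "epoch N i \<omega> \<le> ago 0 t" for i
            using \<open>gaps_below y x1 x2 t \<omega>\<close> that by (auto simp: gaps_below_def split: if_splits)
        qed (use p n elim in auto)
        ultimately show ?thesis using p by auto
      qed
      have ev: "{\<omega>\<in>space M. ?R1 t \<omega>} \<in> events" "{\<omega>\<in>space M. ?R2 t \<omega>} \<in> events"
        using p by (auto intro!: no_run_event_grid)
      have ev3: "{\<omega>\<in>space M. ?B1 \<omega>} \<in> events" "{\<omega>\<in>space M. ?B2 \<omega>} \<in> events"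
        using p elim by (auto intro!: event_N[where P="\<lambda>a b. a = b"])
      have ev12: "{\<omega>\<in>space M. ?R1 t \<omega> \<and> ?R2 t \<omega>} \<in> events" by (rule sets.sets_Collect_conj[OF ev(2,1)])
      have "\<P>(\<omega> in M. gaps_below y x1 x2 t \<omega>) \<le>
        prob (({\<omega>\<in>space M. ?R1 t \<omega> \<and> ?R2 t \<omega>} \<union> {\<omega>\<in>space M. ?B1 \<omega>}) \<union> {\<omega>\<in>space M. ?B2 \<omega>})"
        using incl ev12 ev3 by (intro finite_measure_mono) auto
      also have "\<dots> \<le> prob ({\<omega>\<in>space M. ?R1 t \<omega> \<and> ?R2 t \<omega>} \<union> {\<omega>\<in>space M. ?B1 \<omega>}) + \<P>(\<omega> in M. ?B2 \<omega>)"
        using ev12 ev3 by (intro measure_Un_le) auto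
      also have "prob ({\<omega>\<in>space M. ?R1 t \<omega> \<and> ?R2 t \<omega>} \<union> {\<omega>\<in>space M. ?B1 \<omega>})
         \<le> \<P>(\<omega> in M. ?R1 t \<omega> \<and> ?R2 t \<omega>) + \<P>(\<omega> in M. ?B1 \<omega>)"
        using ev12 ev3 by (intro measure_Un_le) auto
      also have "\<P>(\<omega> in M. ?R1 t \<omega> \<and> ?R2 t \<omega>) = \<P>(\<omega> in M. ?R1 t \<omega>) * \<P>(\<omega> in M. ?R2 t \<omega>)"
        using p n by (intro prob_two_adjacent_grids) auto
      also have "\<dots> \<le> g1 t * g2 t"
        using elim order_trans[OF measure_nonneg elim(1)] by (intro mult_mono) auto
      also have "\<P>(\<omega> in M. ?B1 \<omega>) \<le> exp (- (rate t * (ago y t - (ago y t - level x1 t))))"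
        using p elim by (intro prob_empty_le) auto
      also have "\<P>(\<omega> in M. ?B2 \<omega>) \<le> exp (- (rate t * (t - (t - level x2 t))))"
        using p elim by (intro prob_empty_le) auto
      finally show ?case by (simp add: g_def)
    qed
  qed
qed

lemma gaps_below_lower:
  assumes y: "0 < y"
  shows "\<exists>g. (g \<longlongrightarrow> exp (- exp (- (x1 + \<alpha> * (1 - \<alpha>) * y))) *
      exp (- (exp (- x2) - exp (- (x2 + \<alpha> * (1 - \<alpha>) * y))))) at_top \<and>
    (\<forall>\<^sub>F t in at_top. g t \<le> \<P>(\<omega> in M. gaps_below y x1 x2 t \<omega>))"
proof -
  define h1 where "h1 t = (ago y t - 0) / real (cells t)" for t
  define h2 where "h2 t = (ago 0 t - ago y t) / real (cells t)" for t
  have w1: "\<forall>\<^sub>F t in at_top. 0 < h1 t \<and> h1 t \<le> 1 / t" using ago_ge_half[of y]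
  proof eventually_elim
    case (elim t)
    thus ?case unfolding h1_def using cells_pos[of t] ago_le[of y t] y cell_width_le[of t "ago y t" 0] by auto
  qed
  have w2: "\<forall>\<^sub>F t in at_top. 0 < h2 t \<and> h2 t \<le> 1 / t" unfolding h2_def using y by (intro cell_width) auto
  define m1 where "m1 t = nat \<lfloor>level x1 t / h1 t\<rfloor> - 1" for t
  define m2 where "m2 t = nat \<lfloor>level x2 t / h2 t\<rfloor> - 1" for t
  have l1: "((\<lambda>t. rate t * (real (m1 t) * h1 t) - centering t) \<longlongrightarrow> x1) at_top"
    unfolding m1_def by (rule window_down_limit[OF w1])
  have l2: "((\<lambda>t. rate t * (real (m2 t) * h2 t) - centering t) \<longlongrightarrow> x2) at_top"
    unfolding m2_def by (rule window_down_limit[OF w2])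
  let ?R1 = "\<lambda>t \<omega>. no_run (m1 t) (cells t) (incr (grid 0 (ago y t) (cells t)) \<omega>)"
  let ?R2 = "\<lambda>t \<omega>. no_run (m2 t) (cells t) (incr (grid (ago y t) (ago 0 t) (cells t)) \<omega>)"
  have pos1: "\<forall>\<^sub>F t in at_top. 0 \<le> ago (y + 1) t" using ago_ge_half[of "y+1"] by eventually_elim auto
  obtain g1 where g1: "(g1 \<longlongrightarrow> exp (- (exp (- (x1 + \<alpha> * (1 - \<alpha>) * y)) - 0))) at_top"
    "\<forall>\<^sub>F t in at_top. g1 t \<le> \<P>(\<omega> in M. ?R1 t \<omega>)"
    using no_run_lower_limit[OF _ refl l1, where ya="y+1" and a="\<lambda>_. 0" and yb=y and A="\<lambda>_. 0" and ?A0.0=0] y pos1 vacancy_pos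
    unfolding h1_def[abs_def] by (auto simp: less_imp_le)
  obtain g2 where g2: "(g2 \<longlongrightarrow> exp (- (exp (- (x2 + \<alpha> * (1 - \<alpha>) * 0)) - exp (- (x2 + \<alpha> * (1 - \<alpha>) * y))))) at_top"
    "\<forall>\<^sub>F t in at_top. g2 t \<le> \<P>(\<omega> in M. ?R2 t \<omega>)"
  proof -
    have *: "\<forall>\<^sub>F t in at_top. 0 \<le> ago y t" using ago_ge_half[of "y"] by eventually_elim auto
    have lim: "((\<lambda>t. vacancy (real (m2 t) * h2 t) (ago y t) / rate_drop (real (m2 t) * h2 t) (ago (0 + real (m2 t) * h2 t * ln t / t) t))
       \<longlongrightarrow> exp (- (x2 + \<alpha> * (1 - \<alpha>) * y))) at_top"
      by (rule vacancy_over_rate_drop_limit[OF l2 tendsto_const end_limit[OF l2]])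
    from no_run_lower_limit[OF order_refl refl l2 y _ _ * _ lim] that
    show ?thesis unfolding h2_def[abs_def] by auto
  qed
  define g where "g t = g1 t * g2 t - exp (- (rate t * (level x2 t / 2))) - exp (- (rate t * (level x2 t / 2)))" for t
  show ?thesis
  proof (intro exI conjI)
    have z: "(0::real) < 2" by simp
    from tendsto_diff[OF tendsto_diff[OF tendsto_mult[OF g1(1) g2(1)] exp_level_tendsto_0[OF z, of x2]] exp_level_tendsto_0[OF z, of x2]]
    show "(g \<longlongrightarrow> exp (- exp (- (x1 + \<alpha> * (1 - \<alpha>) * y))) *
      exp (- (exp (- x2) - exp (- (x2 + \<alpha> * (1 - \<alpha>) * y))))) at_top"
      by (simp add: g_def[abs_def])
    have pos2: "\<forall>\<^sub>F t in at_top. 0 < g2 t" by (rule order_tendstoD(1)[OF g2(1)]) simp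
    show "\<forall>\<^sub>F t in at_top. g t \<le> \<P>(\<omega> in M. gaps_below y x1 x2 t \<omega>)"
      using g1(2) g2(2) pos2 window_down[OF w1, of x1] window_down[OF w2, of x2] ago_ge_half[of y] w1 w2
        level_bounds[OF y, of x2 y]
    proof eventually_elim
      case (elim t)
      have t: "1 < t" and n: "0 < cells t" using elim cells_pos[of t] by auto
      have p: "0 < ago y t" "ago y t < t" "ago 0 t = t"
        using elim y t n by (auto simp: h2_def ago_def zero_less_divide_iff)
      define d where "d = level x2 t / 2"
      have d: "0 < d" "2 * d \<le> level x2 t" "d \<le> ago y t" using elim by (auto simp: d_def)
      have "d \<le> y * t / ln t" using elim d by linarith
      also have "\<dots> = t - ago y t" by (simp add: ago_def right_diff_distrib)
      finally have "d \<le> t - ago y t" .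
      hence sd: "ago y t + d \<le> t" by simp
      let ?B1 = "\<lambda>\<omega>. N (ago y t) \<omega> = N (ago y t - d) \<omega>"
      let ?B2 = "\<lambda>\<omega>. N (ago y t + d) \<omega> = N (ago y t) \<omega>"
      have incl: "gaps_below y x1 x2 t \<omega> \<or> ?B1 \<omega> \<or> ?B2 \<omega>" if "\<omega> \<in> space M" "?R1 t \<omega>" "?R2 t \<omega>" for \<omega>
      proof (rule ccontr)
        assume "\<not> ?thesis"
        moreover have "gaps_below y x1 x2 t \<omega>" if "\<not> ?B1 \<omega>" "\<not> ?B2 \<omega>"
        proof (rule gaps_below_of_no_runs[OF \<open>\<omega> \<in> space M\<close> p(1,2) n _ _ d])
          show "no_run (m1 t) (cells t) (incr (grid 0 (ago y t) (cells t)) \<omega>)" by fact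
          show "no_run (m2 t) (cells t) (incr (grid (ago y t) t (cells t)) \<omega>)" using \<open>?R2 t \<omega>\<close> p by simp
        qed (use that elim p in \<open>auto simp: m1_def m2_def h1_def h2_def\<close>)
        ultimately show False by auto
      qed
      have ev: "{\<omega>\<in>space M. ?R1 t \<omega>} \<in> events" "{\<omega>\<in>space M. ?R2 t \<omega>} \<in> events"
        using p by (auto intro!: no_run_event_grid)
      have ev3: "{\<omega>\<in>space M. ?B1 \<omega>} \<in> events" "{\<omega>\<in>space M. ?B2 \<omega>} \<in> events"
        using p d by (auto intro!: event_N[where P="\<lambda>a b. a = b"])
      have evg: "{\<omega>\<in>space M. gaps_below y x1 x2 t \<omega>} \<in> events" using t by (intro gaps_below_event) auto
      have "g1 t * g2 t \<le> \<P>(\<omega> in M. ?R1 t \<omega>) * \<P>(\<omega> in M. ?R2 t \<omega>)"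
        using elim by (intro mult_mono) auto
      also have "\<dots> = \<P>(\<omega> in M. ?R1 t \<omega> \<and> ?R2 t \<omega>)"
        using p n by (intro prob_two_adjacent_grids[symmetric]) auto
      also have "\<dots> \<le> prob (({\<omega>\<in>space M. gaps_below y x1 x2 t \<omega>} \<union> {\<omega>\<in>space M. ?B1 \<omega>}) \<union> {\<omega>\<in>space M. ?B2 \<omega>})"
        using incl evg ev3 by (intro finite_measure_mono) auto
      also have "\<dots> \<le> prob ({\<omega>\<in>space M. gaps_below y x1 x2 t \<omega>} \<union> {\<omega>\<in>space M. ?B1 \<omega>}) + \<P>(\<omega> in M. ?B2 \<omega>)"
        using evg ev3 by (intro measure_Un_le) auto
      also have "prob ({\<omega>\<in>space M. gaps_below y x1 x2 t \<omega>} \<union> {\<omega>\<in>space M. ?B1 \<omega>})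
         \<le> \<P>(\<omega> in M. gaps_below y x1 x2 t \<omega>) + \<P>(\<omega> in M. ?B1 \<omega>)"
        using evg ev3 by (intro measure_Un_le) auto
      also have "\<P>(\<omega> in M. ?B1 \<omega>) \<le> exp (- (rate t * (ago y t - (ago y t - d))))"
        using p d by (intro prob_empty_le) auto
      also have "\<P>(\<omega> in M. ?B2 \<omega>) \<le> exp (- (rate t * (ago y t + d - ago y t)))"
        using p d sd by (intro prob_empty_le) auto
      finally show ?case by (simp add: g_def d_def)
    qed
  qed
qed

text \<open>
The exponent is the mean number of points that a Poisson process of intensity
\<open>exp (- x) * (c * exp (- c * u))\<close>, with \<open>c = \<alpha> * (1 - \<alpha>)\<close>, has in the region \<open>x > x1, u \<ge> y\<close>
or \<open>x > x2, 0 \<le> u < y\<close>.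
\<close>

lemma gaps_below_limit:
  assumes y: "0 < y"
  shows "((\<lambda>t. \<P>(\<omega> in M. gaps_below y x1 x2 t \<omega>)) \<longlongrightarrow>
    exp (- exp (- (x1 + \<alpha> * (1 - \<alpha>) * y))) * exp (- (exp (- x2) - exp (- (x2 + \<alpha> * (1 - \<alpha>) * y))))) at_top"
    (is "(_ \<longlongrightarrow> ?A * ?B) _")
proof (rule order_tendstoI)
  fix r assume r: "r < ?A * ?B"
  from gaps_below_lower[OF y] obtain g where g: "(g \<longlongrightarrow> ?A * ?B) at_top" "\<forall>\<^sub>F t in at_top. g t \<le> \<P>(\<omega> in M. gaps_below y x1 x2 t \<omega>)"
    by blast
  show "\<forall>\<^sub>F t in at_top. r < \<P>(\<omega> in M. gaps_below y x1 x2 t \<omega>)"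
    using order_tendstoD(1)[OF g(1) r] g(2) by eventually_elim simp
next
  fix r assume r: "?A * ?B < r"
  have "((\<lambda>Y. exp (- (x1 + \<alpha> * (1 - \<alpha>) * Y))) \<longlongrightarrow> 0) at_top"
    using alpha_pos alpha_less_1 by real_asymp
  from tendsto_mult[OF tendsto_exp[OF tendsto_minus[OF tendsto_diff[OF tendsto_const this]]] tendsto_const]
  have "((\<lambda>Y. exp (- (exp (- (x1 + \<alpha> * (1 - \<alpha>) * y)) - exp (- (x1 + \<alpha> * (1 - \<alpha>) * Y)))) * ?B) \<longlongrightarrow> ?A * ?B) at_top"
    by simp
  from order_tendstoD(2)[OF this r]
  have "\<forall>\<^sub>F Y in at_top. y < Y \<and> exp (- (exp (- (x1 + \<alpha> * (1 - \<alpha>) * y)) - exp (- (x1 + \<alpha> * (1 - \<alpha>) * Y)))) * ?B < r"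
    using eventually_gt_at_top[of y] by eventually_elim simp
  then obtain Y where Y: "y < Y" "exp (- (exp (- (x1 + \<alpha> * (1 - \<alpha>) * y)) - exp (- (x1 + \<alpha> * (1 - \<alpha>) * Y)))) * ?B < r"
    by (auto dest: eventually_happens)
  obtain g where g: "(g \<longlongrightarrow> exp (- (exp (- (x1 + \<alpha> * (1 - \<alpha>) * y)) - exp (- (x1 + \<alpha> * (1 - \<alpha>) * Y)))) * ?B) at_top"
    "\<forall>\<^sub>F t in at_top. \<P>(\<omega> in M. gaps_below y x1 x2 t \<omega>) \<le> g t"
    using gaps_below_upper[OF y Y(1)] by blast
  show "\<forall>\<^sub>F t in at_top. \<P>(\<omega> in M. gaps_below y x1 x2 t \<omega>) < r"
    using order_tendstoD(2)[OF g(1) Y(2)] g(2) by eventually_elim simp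
qed

end

section \<open>Joint law of the length and the end of the longest gap\<close>

text \<open>
The summands are the increments of \<open>exp (- p v)\<close>, weighted with \<open>exp (- (1 - p) v)\<close> at the far end,
over a grid of mesh \<open>\<theta>\<close>. On this grid the sum is geometric, with value near
\<open>p * exp (- v)\<close> when \<open>\<theta>\<close> is small and \<open>K \<theta>\<close> is large; \<open>\<theta> = 1 / sqrt K\<close> achieves both.
\<close>

lemma geometric_riemann_sum:
  fixes p v r :: real
  assumes p: "0 < p" "p < 1" and r: "r < p * exp (- v)"
  obtains \<theta> :: real and K :: nat where "0 < \<theta>"
    "r < (\<Sum>k<K. exp (- ((1 - p) * (v + real (Suc k) * \<theta>))) * exp (- (p * (v + real k * \<theta>))) -
              exp (- ((1 - p) * (v + real (Suc k) * \<theta>))) * exp (- (p * (v + real (Suc k) * \<theta>))))"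
proof -
  have sum: "(\<Sum>k<K. exp (- ((1 - p) * (v + real (Suc k) * \<theta>))) * exp (- (p * (v + real k * \<theta>))) -
              exp (- ((1 - p) * (v + real (Suc k) * \<theta>))) * exp (- (p * (v + real (Suc k) * \<theta>))))
     = exp (- v) * (exp (- ((1 - p) * \<theta>)) * (1 - exp (- (p * \<theta>)))) * ((1 - exp (- (real K * \<theta>))) / (1 - exp (- \<theta>)))"
    if "0 < \<theta>" for K \<theta>
  proof -
    have "exp (- ((1 - p) * (v + real (Suc k) * \<theta>))) * exp (- (p * (v + real k * \<theta>))) -
              exp (- ((1 - p) * (v + real (Suc k) * \<theta>))) * exp (- (p * (v + real (Suc k) * \<theta>)))
      = exp (- v) * (exp (- ((1 - p) * \<theta>)) * (1 - exp (- (p * \<theta>)))) * exp (- \<theta>) ^ k" for k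
      by (simp add: exp_add[symmetric] exp_of_nat_mult[symmetric] algebra_simps)
    moreover have "(\<Sum>k<K. exp (- \<theta>) ^ k) = (1 - exp (- \<theta>) ^ K) / (1 - exp (- \<theta>))"
      using that by (subst sum_gp_strict) auto
    moreover have "exp (- \<theta>) ^ K = exp (- (real K * \<theta>))" by (simp add: exp_of_nat_mult[symmetric])
    ultimately show ?thesis by (simp add: sum_distrib_left[symmetric])
  qed
  have "((\<lambda>K. exp (- v) * (exp (- ((1 - p) * (1 / sqrt K))) * (1 - exp (- (p * (1 / sqrt K))))) *
      ((1 - exp (- (K * (1 / sqrt K)))) / (1 - exp (- (1 / sqrt K))))) \<longlongrightarrow> p * exp (- v)) at_top"
    using p by (real_asymp simp: exp_minus)
  hence "((\<lambda>K. exp (- v) * (exp (- ((1 - p) * (1 / sqrt (real K)))) * (1 - exp (- (p * (1 / sqrt (real K)))))) *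
      ((1 - exp (- (real K * (1 / sqrt (real K))))) / (1 - exp (- (1 / sqrt (real K)))))) \<longlongrightarrow> p * exp (- v)) sequentially"
    by (rule filterlim_compose[OF _ filterlim_real_sequentially])
  from order_tendstoD(1)[OF this r] eventually_gt_at_top[of 0]
  have "\<forall>\<^sub>F K in sequentially. 0 < K \<and> r < exp (- v) * (exp (- ((1 - p) * (1 / sqrt (real K)))) * (1 - exp (- (p * (1 / sqrt (real K)))))) *
      ((1 - exp (- (real K * (1 / sqrt (real K))))) / (1 - exp (- (1 / sqrt (real K)))))"
    by eventually_elim simp
  then obtain K :: nat where K: "0 < K" "r < exp (- v) * (exp (- ((1 - p) * (1 / sqrt (real K)))) * (1 - exp (- (p * (1 / sqrt (real K)))))) *
      ((1 - exp (- (real K * (1 / sqrt (real K))))) / (1 - exp (- (1 / sqrt (real K)))))"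
    by (auto dest: eventually_happens)
  show ?thesis by (rule that[of "1 / sqrt (real K)" K]) (use K sum[of "1 / sqrt (real K)" K] in auto)
qed

context power_rate_poisson
begin

definition gap_stat :: "real \<Rightarrow> 'a \<Rightarrow> real" where
  "gap_stat t \<omega> = rate t * longest_gap N t \<omega> - centering t"

definition end_stat :: "real \<Rightarrow> 'a \<Rightarrow> real" where
  "end_stat t \<omega> = (t - longest_gap_end N t \<omega>) / t * ln t"

text \<open>
If all epochs are reached, they increase with the index, so the infimum defining the right end is
attained at the least index of a gap of maximal length.
\<close>

lemma longest_gap_props:
  assumes \<omega>: "\<omega> \<in> space M" and unb: "\<forall>i. \<exists>n. i \<le> N (real n) \<omega>" and t: "0 \<le> t" "N t \<omega> \<noteq> 0"
  shows "\<And>i. 1 \<le> i \<Longrightarrow> i \<le> N t \<omega> \<Longrightarrow> gap N i \<omega> \<le> longest_gap N t \<omega>"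
    and "\<exists>i. 1 \<le> i \<and> i \<le> N t \<omega> \<and> gap N i \<omega> = longest_gap N t \<omega> \<and> longest_gap_end N t \<omega> = epoch N i \<omega> \<and> epoch N i \<omega> \<le> t"
proof -
  let ?S = "{gap N i \<omega> | i. 1 \<le> i \<and> epoch N i \<omega> \<le> t}"
  have iff: "epoch N i \<omega> \<le> t \<longleftrightarrow> i \<le> N t \<omega>" for i
    using epoch_le_iff[OF \<omega>, of "real _" i t] unb t by auto
  have mono: "epoch N i \<omega> \<le> epoch N j \<omega>" if "i \<le> j" for i j
    using epoch_mono[OF \<omega>, of "real _" j i] unb that by auto
  have fin: "finite ?S" by (rule finite_gaps[OF \<omega> t(1)])
  show le: "gap N i \<omega> \<le> longest_gap N t \<omega>" if "1 \<le> i" "i \<le> N t \<omega>" for i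
    unfolding longest_gap_def using fin that iff by (intro Max_ge) auto
  have "gap N 1 \<omega> \<in> ?S" using iff[of 1] t by force
  hence "longest_gap N t \<omega> \<in> ?S" unfolding longest_gap_def using fin by (intro Max_in) auto
  then obtain i where i: "1 \<le> i \<and> gap N i \<omega> = longest_gap N t \<omega>" "i \<le> N t \<omega>" using iff by auto
  define j where "j = (LEAST i. 1 \<le> i \<and> gap N i \<omega> = longest_gap N t \<omega>)"
  have j: "1 \<le> j \<and> gap N j \<omega> = longest_gap N t \<omega>" unfolding j_def by (rule LeastI[of _ i]) (rule i(1))
  have jle: "j \<le> k" if "1 \<le> k \<and> gap N k \<omega> = longest_gap N t \<omega>" for k
    unfolding j_def by (rule Least_le) (rule that)
  have "longest_gap_end N t \<omega> = epoch N j \<omega>"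
    unfolding longest_gap_end_def using j jle mono by (intro cInf_eq_minimum) auto
  thus "\<exists>i. 1 \<le> i \<and> i \<le> N t \<omega> \<and> gap N i \<omega> = longest_gap N t \<omega> \<and> longest_gap_end N t \<omega> = epoch N i \<omega> \<and> epoch N i \<omega> \<le> t"
    using j jle[OF i(1)] i(2) iff[of j] by (intro exI[of _ j]) auto
qed

lemma gap_stat_le_iff: "0 < t \<Longrightarrow> gap_stat t \<omega> \<le> x \<longleftrightarrow> longest_gap N t \<omega> \<le> level x t"
  using rate_pos[of t] by (simp add: gap_stat_def level_def pos_le_divide_eq mult.commute algebra_simps)

lemma end_stat_less_iff: "1 < t \<Longrightarrow> end_stat t \<omega> < y \<longleftrightarrow> ago y t < longest_gap_end N t \<omega>"
  by (simp add: end_stat_def ago_def field_simps)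

lemma level_mono: "0 < t \<Longrightarrow> x \<le> x' \<Longrightarrow> level x t \<le> level x' t"
  using rate_pos[of t] by (simp add: level_def divide_right_mono)

context
  fixes \<omega> :: 'a and t :: real
  assumes good: "\<omega> \<in> space M" "\<forall>i. \<exists>n. i \<le> N (real n) \<omega>" "1 < t" "N t \<omega> \<noteq> 0"
begin

lemma gaps_below_of_gap_stat: "gap_stat t \<omega> \<le> x \<Longrightarrow> gaps_below y x x t \<omega>"
  using longest_gap_props(1)[OF good(1,2) _ good(4)] good(3)
  by (force simp: gap_stat_le_iff gaps_below_def)

text \<open>
Some gap exceeds level \<open>x'\<close>, and those that do so end after \<open>ago y t\<close> and stay below level \<open>x\<close>.
The longest gap is one of them.
\<close>

lemma stats_of_late_gap:
  assumes "x' \<le> x" "gaps_below y x' x t \<omega>" "\<not> gaps_below y x' x' t \<omega>"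
  shows "x' < gap_stat t \<omega> \<and> gap_stat t \<omega> \<le> x \<and> end_stat t \<omega> < y"
proof -
  obtain i where i: "1 \<le> i" "i \<le> N t \<omega>" "gap N i \<omega> = longest_gap N t \<omega>" "longest_gap_end N t \<omega> = epoch N i \<omega>"
    using longest_gap_props(2)[OF good(1,2) _ good(4)] good(3) by auto
  have "x' < gap_stat t \<omega>" using gaps_below_of_gap_stat[of x' y] assms(3) by (meson not_le)
  moreover from this have *: "level x' t < longest_gap N t \<omega>" using gap_stat_le_iff[of t \<omega> x'] good(3) by simp
  moreover have g: "gap N i \<omega> \<le> (if epoch N i \<omega> \<le> ago y t then level x' t else level x t)"
    using assms(2) i unfolding gaps_below_def by blast
  ultimately show ?thesis using i good(3) by (simp add: gap_stat_le_iff end_stat_less_iff split: if_splits)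
qed

lemma stats_of_early_gap:
  assumes "x' \<le> x" "gaps_below y x x' t \<omega>" "\<not> gaps_below y x' x' t \<omega>"
  shows "x' < gap_stat t \<omega> \<and> gap_stat t \<omega> \<le> x \<and> y \<le> end_stat t \<omega>"
proof -
  obtain i where i: "1 \<le> i" "i \<le> N t \<omega>" "gap N i \<omega> = longest_gap N t \<omega>" "longest_gap_end N t \<omega> = epoch N i \<omega>"
    using longest_gap_props(2)[OF good(1,2) _ good(4)] good(3) by auto
  have "x' < gap_stat t \<omega>" using gaps_below_of_gap_stat[of x' y] assms(3) by (meson not_le)
  moreover from this have *: "level x' t < longest_gap N t \<omega>" using gap_stat_le_iff[of t \<omega> x'] good(3) by simp
  moreover have g: "gap N i \<omega> \<le> (if epoch N i \<omega> \<le> ago y t then level x t else level x' t)"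
    using assms(2) i unfolding gaps_below_def by blast
  moreover from * g have "epoch N i \<omega> \<le> ago y t" "longest_gap N t \<omega> \<le> level x t"
    using i by (auto split: if_splits)
  ultimately show ?thesis using i gap_stat_le_iff[of t \<omega> x] end_stat_less_iff[of t \<omega> y] good(3) by auto
qed

lemma end_stat_nonneg: "0 \<le> end_stat t \<omega>"
  using longest_gap_props(2)[OF good(1,2) _ good(4)] good(3) by (auto simp: end_stat_def)

end

lemma stats_measurable:
  assumes "0 \<le> t"
  shows "gap_stat t \<in> borel_measurable M" "end_stat t \<in> borel_measurable M"
proof -
  note [measurable] = longest_gap_measurable[OF assms] longest_gap_end_measurable[OF assms]
  show "gap_stat t \<in> borel_measurable M" unfolding gap_stat_def[abs_def] by measurable
  show "end_stat t \<in> borel_measurable M" unfolding end_stat_def[abs_def] by measurable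
qed

text \<open>
Outside a null set all epochs are reached, so only the event \<open>N t = 0\<close> has to be paid for.
\<close>

lemma prob_good_le:
  assumes t: "1 < t" and ev: "{\<omega>\<in>space M. P \<omega>} \<in> events" "{\<omega>\<in>space M. Q \<omega>} \<in> events"
    and imp: "\<And>\<omega>. \<omega> \<in> space M \<Longrightarrow> \<forall>i. \<exists>n. i \<le> N (real n) \<omega> \<Longrightarrow> N t \<omega> \<noteq> 0 \<Longrightarrow> P \<omega> \<Longrightarrow> Q \<omega>"
  shows "\<P>(\<omega> in M. P \<omega>) \<le> \<P>(\<omega> in M. Q \<omega>) + \<P>(\<omega> in M. N t \<omega> = 0)"
proof -
  have e0: "{\<omega>\<in>space M. N t \<omega> = 0} \<in> events"
    using t by (intro event_N[where P="\<lambda>_ k. k = 0"]) auto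
  have "\<P>(\<omega> in M. P \<omega>) \<le> prob ({\<omega>\<in>space M. Q \<omega>} \<union> {\<omega>\<in>space M. N t \<omega> = 0})"
  proof (rule finite_measure_mono_AE)
    show "AE \<omega> in M. \<omega> \<in> {\<omega>\<in>space M. P \<omega>} \<longrightarrow> \<omega> \<in> {\<omega>\<in>space M. Q \<omega>} \<union> {\<omega>\<in>space M. N t \<omega> = 0}"
      using AE_unbounded by eventually_elim (use imp in blast)
  qed (use ev e0 in auto)
  also have "\<dots> \<le> \<P>(\<omega> in M. Q \<omega>) + \<P>(\<omega> in M. N t \<omega> = 0)"
    using ev e0 by (intro measure_Un_le) auto
  finally show ?thesis .
qed

text \<open>
\<open>A x\<close> is the probability that the normalised length is at most \<open>x\<close> and that the longest gap ends on
a given side of \<open>ago y t\<close>; \<open>G x' x\<close> is the probability that gaps on this side are below level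
\<open>x\<close> and the others below level \<open>x'\<close>. Adding the increments along the levels
\<open>x k = - ln (v + k \<theta>)\<close>, for which the limits of \<open>G\<close> form a geometric sum, gives the bound.
\<close>

lemma liminf_of_increments:
  fixes G :: "real \<Rightarrow> real \<Rightarrow> real \<Rightarrow> real" and A :: "real \<Rightarrow> real \<Rightarrow> real"
  assumes p: "0 < p" "p < 1" and v: "0 < v" and r: "r < p * exp (- v)"
    and A0: "\<And>x t. 0 \<le> A x t"
    and e: "(e \<longlongrightarrow> 0) at_top"
    and incr: "\<And>x x'. x' \<le> x \<Longrightarrow> \<forall>\<^sub>F t in at_top. G x' x t - G x' x' t - e t \<le> A x t - A x' t"
    and G: "\<And>v v'. 0 < v \<Longrightarrow> 0 < v' \<Longrightarrow>
       ((\<lambda>t. G (- ln v') (- ln v) t) \<longlongrightarrow> exp (- ((1 - p) * v')) * exp (- (p * v))) at_top"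
  shows "\<forall>\<^sub>F t in at_top. r < A (- ln v) t"
proof -
  obtain \<theta> :: real and K :: nat where \<theta>: "0 < \<theta>" and
    rK: "r < (\<Sum>k<K. exp (- ((1 - p) * (v + real (Suc k) * \<theta>))) * exp (- (p * (v + real k * \<theta>))) -
              exp (- ((1 - p) * (v + real (Suc k) * \<theta>))) * exp (- (p * (v + real (Suc k) * \<theta>))))"
    by (rule geometric_riemann_sum[OF p r])
  define x where "x k = - ln (v + real k * \<theta>)" for k :: nat
  have vk: "0 < v + real k * \<theta>" for k using v \<theta> by (simp add: add_pos_nonneg)
  have xm: "x (Suc k) \<le> x k" for k
    unfolding x_def using vk[of k] vk[of "Suc k"] \<theta> by (simp add: algebra_simps)
  have "((\<lambda>t. \<Sum>k<K. G (x (Suc k)) (x k) t - G (x (Suc k)) (x (Suc k)) t - e t) \<longlongrightarrow>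
    (\<Sum>k<K. exp (- ((1 - p) * (v + real (Suc k) * \<theta>))) * exp (- (p * (v + real k * \<theta>))) -
              exp (- ((1 - p) * (v + real (Suc k) * \<theta>))) * exp (- (p * (v + real (Suc k) * \<theta>))) - 0)) at_top"
    unfolding x_def by (intro tendsto_sum tendsto_diff G e vk)
  hence "\<forall>\<^sub>F t in at_top. r < (\<Sum>k<K. G (x (Suc k)) (x k) t - G (x (Suc k)) (x (Suc k)) t - e t)"
    using rK by (intro order_tendstoD(1)) auto
  moreover have "\<forall>\<^sub>F t in at_top. \<forall>k\<in>{..<K}. G (x (Suc k)) (x k) t - G (x (Suc k)) (x (Suc k)) t - e t \<le> A (x k) t - A (x (Suc k)) t"
    by (intro eventually_ball_finite) (auto intro: incr xm)
  ultimately show ?thesis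
  proof eventually_elim
    case (elim t)
    note elim(1)
    also have "(\<Sum>k<K. G (x (Suc k)) (x k) t - G (x (Suc k)) (x (Suc k)) t - e t) \<le> (\<Sum>k<K. A (x k) t - A (x (Suc k)) t)"
      using elim(2) by (intro sum_mono) auto
    also have "\<dots> = A (x 0) t - A (x K) t" by (rule sum_lessThan_telescope')
    also have "\<dots> \<le> A (- ln v) t" using A0[of "x K" t] by (simp add: x_def)
    finally show ?case .
  qed
qed

text \<open>
With \<open>q = exp (- \<alpha> (1 - \<alpha>) y)\<close> and \<open>v = exp (- x)\<close>, the lower limits for ending late and ending early
are \<open>(1 - q) exp (- v)\<close> and \<open>q exp (- v)\<close>. Their sum is the limit of the total probability, so neither
can be exceeded.
\<close>

lemma rectangle_limit_pos:
  assumes y: "0 < y"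
  shows "((\<lambda>t. \<P>(\<omega> in M. gap_stat t \<omega> \<le> x \<and> end_stat t \<omega> < y)) \<longlongrightarrow>
    exp (- exp (- x)) * (1 - exp (- (\<alpha> * (1 - \<alpha>) * y)))) at_top"
proof -
  define q where "q = exp (- (\<alpha> * (1 - \<alpha>) * y))"
  have q: "0 < q" "q < 1" using y alpha_pos alpha_less_1 by (auto simp: q_def)
  define v where "v = exp (- x)"
  have v: "0 < v" "x = - ln v" by (auto simp: v_def)
  define e where "e t = \<P>(\<omega> in M. N t \<omega> = 0)" for t
  have e: "(e \<longlongrightarrow> 0) at_top" unfolding e_def by (rule prob_few)
  have G: "((\<lambda>t. \<P>(\<omega> in M. gaps_below y (- ln v1) (- ln v2) t \<omega>)) \<longlongrightarrow> exp (- (q * v1)) * exp (- ((1 - q) * v2))) at_top"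
    if "0 < v1" "0 < v2" for v1 v2
    using gaps_below_limit[OF y, of "- ln v1" "- ln v2"] that
    by (simp add: exp_add exp_diff exp_minus q_def algebra_simps)
  have ev: "{\<omega>\<in>space M. gap_stat t \<omega> \<le> x \<and> end_stat t \<omega> < y} \<in> events" (is ?P1)
    "{\<omega>\<in>space M. gap_stat t \<omega> \<le> x \<and> y \<le> end_stat t \<omega>} \<in> events" (is ?P2)
    "{\<omega>\<in>space M. gap_stat t \<omega> \<le> x} \<in> events" (is ?P3)
    "{\<omega>\<in>space M. (x' < gap_stat t \<omega> \<and> gap_stat t \<omega> \<le> x) \<and> end_stat t \<omega> < y} \<in> events" (is ?P4)
    "{\<omega>\<in>space M. (x' < gap_stat t \<omega> \<and> gap_stat t \<omega> \<le> x) \<and> y \<le> end_stat t \<omega>} \<in> events" (is ?P5)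
    "{\<omega>\<in>space M. gaps_below y x x' t \<omega>} \<in> events" (is ?P6)
    "{\<omega>\<in>space M. gaps_below y x x' t \<omega> \<and> \<not> gaps_below y x'' x''' t \<omega>} \<in> events" (is ?P7)
    if "1 < t" for t x x' x'' x'''
  proof -
    have t: "0 \<le> t" using that by simp
    note [measurable] = stats_measurable[OF t] gaps_below_event[OF t]
    show ?P1 ?P2 ?P3 ?P4 ?P5 ?P6 ?P7
      by measurable
  qed
  have diff: "\<P>(\<omega> in M. P \<omega>) - \<P>(\<omega> in M. Q \<omega>) = \<P>(\<omega> in M. P \<omega> \<and> \<not> Q \<omega>)"
    if "{\<omega>\<in>space M. P \<omega>} \<in> events" "{\<omega>\<in>space M. Q \<omega>} \<in> events" "\<And>\<omega>. Q \<omega> \<Longrightarrow> P \<omega>" for P Q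
  proof -
    have "{\<omega>\<in>space M. P \<omega> \<and> \<not> Q \<omega>} = {\<omega>\<in>space M. P \<omega>} - {\<omega>\<in>space M. Q \<omega>}" by auto
    hence "\<P>(\<omega> in M. P \<omega> \<and> \<not> Q \<omega>) = prob ({\<omega>\<in>space M. P \<omega>} - {\<omega>\<in>space M. Q \<omega>})" by (rule arg_cong)
    thus ?thesis using that by (subst (asm) finite_measure_Diff) auto
  qed
  have gb_mono: "gaps_below y x1 x2 t \<omega>" if "gaps_below y x1' x2' t \<omega>" "x1' \<le> x1" "x2' \<le> x2" "1 < t" for x1 x2 x1' x2' t \<omega>
    using that level_mono[of t x1' x1] level_mono[of t x2' x2] unfolding gaps_below_def
    by (auto intro: order_trans)
  have late: "\<forall>\<^sub>F t in at_top. r < \<P>(\<omega> in M. gap_stat t \<omega> \<le> x \<and> end_stat t \<omega> < y)" if "r < (1 - q) * exp (- v)" for r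
    unfolding v(2)
  proof (rule liminf_of_increments[where p="1 - q" and e=e and A="\<lambda>x t. \<P>(\<omega> in M. gap_stat t \<omega> \<le> x \<and> end_stat t \<omega> < y)" and G="\<lambda>x' x t. \<P>(\<omega> in M. gaps_below y x' x t \<omega>)"])
    show "((\<lambda>t. \<P>(\<omega> in M. gaps_below y (- ln v') (- ln v) t \<omega>)) \<longlongrightarrow> exp (- ((1 - (1 - q)) * v')) * exp (- ((1 - q) * v))) at_top"
      if "0 < v" "0 < v'" for v v' using G[OF that(2,1)] by simp
    show "\<forall>\<^sub>F t in at_top. \<P>(\<omega> in M. gaps_below y x' x t \<omega>) - \<P>(\<omega> in M. gaps_below y x' x' t \<omega>) - e t
      \<le> \<P>(\<omega> in M. gap_stat t \<omega> \<le> x \<and> end_stat t \<omega> < y) - \<P>(\<omega> in M. gap_stat t \<omega> \<le> x' \<and> end_stat t \<omega> < y)"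
      if xx: "x' \<le> x" for x x'
      using eventually_gt_at_top[of 1]
    proof eventually_elim
      case (elim t)
      have "\<P>(\<omega> in M. gaps_below y x' x t \<omega>) - \<P>(\<omega> in M. gaps_below y x' x' t \<omega>)
         = \<P>(\<omega> in M. gaps_below y x' x t \<omega> \<and> \<not> gaps_below y x' x' t \<omega>)"
        using xx elim by (intro diff ev) (auto intro: gb_mono)
      also have "\<dots> \<le> \<P>(\<omega> in M. (x' < gap_stat t \<omega> \<and> gap_stat t \<omega> \<le> x) \<and> end_stat t \<omega> < y) + e t"
        unfolding e_def
      proof (intro prob_good_le ev elim)
        fix \<omega> assume *: "\<omega> \<in> space M" "\<forall>i. \<exists>n. i \<le> N (real n) \<omega>" "N t \<omega> \<noteq> 0"
          and **: "gaps_below y x' x t \<omega> \<and> \<not> gaps_below y x' x' t \<omega>"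
        show "(x' < gap_stat t \<omega> \<and> gap_stat t \<omega> \<le> x) \<and> end_stat t \<omega> < y"
          using stats_of_late_gap[OF *(1,2) elim *(3) xx, of y] ** by auto
      qed
      also have "\<P>(\<omega> in M. (x' < gap_stat t \<omega> \<and> gap_stat t \<omega> \<le> x) \<and> end_stat t \<omega> < y)
         = \<P>(\<omega> in M. (gap_stat t \<omega> \<le> x \<and> end_stat t \<omega> < y) \<and> \<not> (gap_stat t \<omega> \<le> x' \<and> end_stat t \<omega> < y))"
        by (intro arg_cong[where f=prob] Collect_cong) auto
      also have "\<dots> = \<P>(\<omega> in M. gap_stat t \<omega> \<le> x \<and> end_stat t \<omega> < y) - \<P>(\<omega> in M. gap_stat t \<omega> \<le> x' \<and> end_stat t \<omega> < y)"
        using xx elim by (intro diff[symmetric] ev) auto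
      finally show ?case by simp
    qed
  qed (use q v(1) that e in auto)
  have early: "\<forall>\<^sub>F t in at_top. r < \<P>(\<omega> in M. gap_stat t \<omega> \<le> x \<and> y \<le> end_stat t \<omega>)" if "r < q * exp (- v)" for r
    unfolding v(2)
  proof (rule liminf_of_increments[where p="q" and e=e and A="\<lambda>x t. \<P>(\<omega> in M. gap_stat t \<omega> \<le> x \<and> y \<le> end_stat t \<omega>)" and G="\<lambda>x' x t. \<P>(\<omega> in M. gaps_below y x x' t \<omega>)"])
    show "((\<lambda>t. \<P>(\<omega> in M. gaps_below y (- ln v) (- ln v') t \<omega>)) \<longlongrightarrow> exp (- ((1 - q) * v')) * exp (- (q * v))) at_top"
      if "0 < v" "0 < v'" for v v' using G[OF that] by (simp add: mult.commute)
    show "\<forall>\<^sub>F t in at_top. \<P>(\<omega> in M. gaps_below y x x' t \<omega>) - \<P>(\<omega> in M. gaps_below y x' x' t \<omega>) - e t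
      \<le> \<P>(\<omega> in M. gap_stat t \<omega> \<le> x \<and> y \<le> end_stat t \<omega>) - \<P>(\<omega> in M. gap_stat t \<omega> \<le> x' \<and> y \<le> end_stat t \<omega>)"
      if xx: "x' \<le> x" for x x'
      using eventually_gt_at_top[of 1]
    proof eventually_elim
      case (elim t)
      have "\<P>(\<omega> in M. gaps_below y x x' t \<omega>) - \<P>(\<omega> in M. gaps_below y x' x' t \<omega>)
         = \<P>(\<omega> in M. gaps_below y x x' t \<omega> \<and> \<not> gaps_below y x' x' t \<omega>)"
        using xx elim by (intro diff ev) (auto intro: gb_mono)
      also have "\<dots> \<le> \<P>(\<omega> in M. (x' < gap_stat t \<omega> \<and> gap_stat t \<omega> \<le> x) \<and> y \<le> end_stat t \<omega>) + e t"
        unfolding e_def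
      proof (intro prob_good_le ev elim)
        fix \<omega> assume *: "\<omega> \<in> space M" "\<forall>i. \<exists>n. i \<le> N (real n) \<omega>" "N t \<omega> \<noteq> 0"
          and **: "gaps_below y x x' t \<omega> \<and> \<not> gaps_below y x' x' t \<omega>"
        show "(x' < gap_stat t \<omega> \<and> gap_stat t \<omega> \<le> x) \<and> y \<le> end_stat t \<omega>"
          using stats_of_early_gap[OF *(1,2) elim *(3) xx, of y] ** by auto
      qed
      also have "\<P>(\<omega> in M. (x' < gap_stat t \<omega> \<and> gap_stat t \<omega> \<le> x) \<and> y \<le> end_stat t \<omega>)
         = \<P>(\<omega> in M. (gap_stat t \<omega> \<le> x \<and> y \<le> end_stat t \<omega>) \<and> \<not> (gap_stat t \<omega> \<le> x' \<and> y \<le> end_stat t \<omega>))"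
        by (intro arg_cong[where f=prob] Collect_cong) auto
      also have "\<dots> = \<P>(\<omega> in M. gap_stat t \<omega> \<le> x \<and> y \<le> end_stat t \<omega>) - \<P>(\<omega> in M. gap_stat t \<omega> \<le> x' \<and> y \<le> end_stat t \<omega>)"
        using xx elim by (intro diff[symmetric] ev) auto
      finally show ?case by simp
    qed
  qed (use q v(1) that e in auto)
  have "((\<lambda>t. \<P>(\<omega> in M. gaps_below y x x t \<omega>) + e t) \<longlongrightarrow> exp (- (q * v)) * exp (- ((1 - q) * v)) + 0) at_top"
    unfolding v(2) by (intro tendsto_add G v e)
  also have "exp (- (q * v)) * exp (- ((1 - q) * v)) + 0 = exp (- v)"
    by (simp add: exp_add[symmetric] algebra_simps)
  finally have tot: "((\<lambda>t. \<P>(\<omega> in M. gaps_below y x x t \<omega>) + e t) \<longlongrightarrow> exp (- v)) at_top" .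
  have total: "\<forall>\<^sub>F t in at_top. \<P>(\<omega> in M. gap_stat t \<omega> \<le> x \<and> end_stat t \<omega> < y) +
     \<P>(\<omega> in M. gap_stat t \<omega> \<le> x \<and> y \<le> end_stat t \<omega>) \<le> \<P>(\<omega> in M. gaps_below y x x t \<omega>) + e t"
    using eventually_gt_at_top[of 1]
  proof eventually_elim
    case (elim t)
    have "\<P>(\<omega> in M. gap_stat t \<omega> \<le> x) - \<P>(\<omega> in M. gap_stat t \<omega> \<le> x \<and> end_stat t \<omega> < y)
      = \<P>(\<omega> in M. gap_stat t \<omega> \<le> x \<and> \<not> (gap_stat t \<omega> \<le> x \<and> end_stat t \<omega> < y))"
      using elim by (intro diff ev) auto
    also have "\<dots> = \<P>(\<omega> in M. gap_stat t \<omega> \<le> x \<and> y \<le> end_stat t \<omega>)"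
      by (intro arg_cong[where f=prob] Collect_cong) auto
    finally have "\<P>(\<omega> in M. gap_stat t \<omega> \<le> x \<and> end_stat t \<omega> < y) +
     \<P>(\<omega> in M. gap_stat t \<omega> \<le> x \<and> y \<le> end_stat t \<omega>) = \<P>(\<omega> in M. gap_stat t \<omega> \<le> x)" by simp
    also have "\<dots> \<le> \<P>(\<omega> in M. gaps_below y x x t \<omega>) + e t"
      unfolding e_def
    proof (intro prob_good_le ev elim)
      fix \<omega> assume *: "\<omega> \<in> space M" "\<forall>i. \<exists>n. i \<le> N (real n) \<omega>" "N t \<omega> \<noteq> 0" "gap_stat t \<omega> \<le> x"
      show "gaps_below y x x t \<omega>" by (rule gaps_below_of_gap_stat[OF *(1,2) elim *(3,4)])
    qed
    finally show ?case .
  qed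
  have "((\<lambda>t. \<P>(\<omega> in M. gap_stat t \<omega> \<le> x \<and> end_stat t \<omega> < y)) \<longlongrightarrow> (1 - q) * exp (- v)) at_top"
  proof (rule order_tendstoI)
    fix r assume "(1 - q) * exp (- v) < r"
    then obtain d where d: "0 < d" "r = (1 - q) * exp (- v) + 2 * d"
      using that[of "(r - (1 - q) * exp (- v)) / 2"] by (auto simp: field_simps)
    have "\<forall>\<^sub>F t in at_top. q * exp (- v) - d < \<P>(\<omega> in M. gap_stat t \<omega> \<le> x \<and> y \<le> end_stat t \<omega>)"
      using d by (intro early) auto
    moreover have "\<forall>\<^sub>F t in at_top. \<P>(\<omega> in M. gaps_below y x x t \<omega>) + e t < exp (- v) + d"
      using d by (intro order_tendstoD(2)[OF tot]) auto
    ultimately show "\<forall>\<^sub>F t in at_top. \<P>(\<omega> in M. gap_stat t \<omega> \<le> x \<and> end_stat t \<omega> < y) < r"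
      using total
    proof eventually_elim
      case (elim t)
      have "(1 - q) * exp (- v) = exp (- v) - q * exp (- v)" by (simp add: algebra_simps)
      thus ?case using elim unfolding d(2) by linarith
    qed
  qed (rule late)
  thus ?thesis by (simp add: q_def v_def mult.commute)
qed

lemma rectangle_limit:
  "((\<lambda>t. \<P>(\<omega> in M. gap_stat t \<omega> \<le> x \<and> end_stat t \<omega> < y)) \<longlongrightarrow>
    exp (- exp (- x)) * (if 0 < y then 1 - exp (- (\<alpha> * (1 - \<alpha>) * y)) else 0)) at_top"
proof (cases "0 < y")
  case False
  have "((\<lambda>t. \<P>(\<omega> in M. gap_stat t \<omega> \<le> x \<and> end_stat t \<omega> < y)) \<longlongrightarrow> 0) at_top"
  proof (rule tendsto_sandwich[OF _ _ tendsto_const prob_few])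
    show "\<forall>\<^sub>F t in at_top. \<P>(\<omega> in M. gap_stat t \<omega> \<le> x \<and> end_stat t \<omega> < y) \<le> \<P>(\<omega> in M. N t \<omega> = 0)"
      using eventually_gt_at_top[of 1]
    proof eventually_elim
      case (elim t)
      have "0 \<le> t" using elim by simp
      note [measurable] = stats_measurable[OF this]
      have "\<P>(\<omega> in M. gap_stat t \<omega> \<le> x \<and> end_stat t \<omega> < y) \<le> \<P>(\<omega> in M. False) + \<P>(\<omega> in M. N t \<omega> = 0)"
      proof (rule prob_good_le[OF elim])
        show "{\<omega>\<in>space M. gap_stat t \<omega> \<le> x \<and> end_stat t \<omega> < y} \<in> events" by measurable
        fix \<omega> assume *: "\<omega> \<in> space M" "\<forall>i. \<exists>n. i \<le> N (real n) \<omega>" "N t \<omega> \<noteq> 0"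
          and "gap_stat t \<omega> \<le> x \<and> end_stat t \<omega> < y"
        thus False using end_stat_nonneg[OF *(1,2) elim *(3)] False by simp
      qed simp
      thus ?case by simp
    qed
  qed simp
  thus ?thesis using False by simp
qed (use rectangle_limit_pos in simp)

end

section \<open>Convergence in distribution from quadrants\<close>

text \<open>
The cells of a square grid on \<open>[-R, R]\<times>[-R, R]\<close>. They are left-open in the first and right-open in the second
coordinate, which matches quadrants of the form \<open>u \<le> x, v < y\<close>.
\<close>

definition box_cell :: "real \<Rightarrow> real \<Rightarrow> nat \<times> nat \<Rightarrow> real \<times> real \<Rightarrow> bool" where
  "box_cell R w ij z \<longleftrightarrow> -R + real (fst ij) * w < fst z \<and> fst z \<le> -R + real (Suc (fst ij)) * w \<and>
     -R + real (snd ij) * w \<le> snd z \<and> snd z < -R + real (Suc (snd ij)) * w"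

lemma box_cell_unique: "0 < w \<Longrightarrow> box_cell R w a z \<Longrightarrow> box_cell R w b z \<Longrightarrow> a = b"
proof -
  assume w: "0 < w" and ab: "box_cell R w a z" "box_cell R w b z"
  have "real (fst a) * w < real (Suc (fst b)) * w" "real (fst b) * w < real (Suc (fst a)) * w"
    "real (snd a) * w < real (Suc (snd b)) * w" "real (snd b) * w < real (Suc (snd a)) * w"
    using ab unfolding box_cell_def by linarith+
  hence "fst a = fst b" "snd a = snd b" using w by (auto simp del: of_nat_Suc)
  thus "a = b" by (rule prod_eqI)
qed

lemma box_cell_exists:
  assumes w: "0 < w" "real n * w = 2 * R" and z: "-R < fst z" "fst z \<le> R" "-R \<le> snd z" "snd z < R"
  shows "\<exists>i<n. \<exists>j<n. box_cell R w (i, j) z"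
proof -
  let ?a = "(fst z + R) / w" and ?b = "(snd z + R) / w"
  have a: "0 < ?a" "?a \<le> real n" and b: "0 \<le> ?b" "?b < real n"
    using w z by (auto simp: field_simps)
  define i where "i = nat (\<lceil>?a\<rceil> - 1)"
  define j where "j = nat \<lfloor>?b\<rfloor>"
  have i: "real i < ?a" "?a \<le> real (Suc i)" "i < n" using a unfolding i_def by linarith+
  have j: "real j \<le> ?b" "?b < real (Suc j)" "j < n" using b unfolding j_def by linarith+
  have "real i * w < fst z + R" "fst z + R \<le> real (Suc i) * w" "real j * w \<le> snd z + R" "snd z + R < real (Suc j) * w"
    using i j unfolding pos_less_divide_eq[OF w(1)] pos_divide_le_eq[OF w(1)] pos_le_divide_eq[OF w(1)] pos_divide_less_eq[OF w(1)]
    by blast+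
  hence "box_cell R w (i, j) z" unfolding box_cell_def fst_conv snd_conv by linarith
  thus ?thesis using i j by blast
qed

lemma (in prob_space) prob_rectangle:
  fixes X :: "'a \<Rightarrow> real \<times> real"
  assumes X: "X \<in> borel_measurable M" and "a \<le> b" "c \<le> d"
  shows "\<P>(\<omega> in M. a < fst (X \<omega>) \<and> fst (X \<omega>) \<le> b \<and> c \<le> snd (X \<omega>) \<and> snd (X \<omega>) < d) =
    \<P>(\<omega> in M. fst (X \<omega>) \<le> b \<and> snd (X \<omega>) < d) - \<P>(\<omega> in M. fst (X \<omega>) \<le> a \<and> snd (X \<omega>) < d)
    - (\<P>(\<omega> in M. fst (X \<omega>) \<le> b \<and> snd (X \<omega>) < c) - \<P>(\<omega> in M. fst (X \<omega>) \<le> a \<and> snd (X \<omega>) < c))"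
proof -
  note [measurable] = X
  have fX: "(\<lambda>\<omega>. fst (X \<omega>)) \<in> borel_measurable M" "(\<lambda>\<omega>. snd (X \<omega>)) \<in> borel_measurable M"
    using X by (auto simp: borel_prod[symmetric])
  note [measurable] = fX
  let ?H = "\<lambda>x y. {\<omega>\<in>space M. fst (X \<omega>) \<le> x \<and> snd (X \<omega>) < y}"
  have H: "?H x y \<in> events" for x y by measurable
  have "{\<omega>\<in>space M. a < fst (X \<omega>) \<and> fst (X \<omega>) \<le> b \<and> c \<le> snd (X \<omega>) \<and> snd (X \<omega>) < d}
     = (?H b d - ?H a d) - (?H b c - ?H a c)" using assms by auto
  moreover have "prob ((?H b d - ?H a d) - (?H b c - ?H a c)) = prob (?H b d - ?H a d) - prob (?H b c - ?H a c)"
    using assms H by (intro finite_measure_Diff) auto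
  moreover have "prob (?H b d - ?H a d) = prob (?H b d) - prob (?H a d)"
    using assms H by (intro finite_measure_Diff) auto
  moreover have "prob (?H b c - ?H a c) = prob (?H b c) - prob (?H a c)"
    using assms H by (intro finite_measure_Diff) auto
  ultimately show ?thesis by simp
qed

text \<open>
On the big box \<open>f\<close> is within \<open>\<epsilon>\<close> of the step function with values \<open>g\<close>; off the box the step
function is 0 and \<open>f\<close> is at most \<open>B\<close>.
\<close>

lemma (in prob_space) expectation_step_approx:
  fixes X :: "'a \<Rightarrow> real \<times> real" and f :: "real \<times> real \<Rightarrow> real"
  assumes X: "X \<in> borel_measurable M" and f: "continuous_on UNIV f"
    and B: "\<And>z. \<bar>f z\<bar> \<le> B" and w: "0 < w" "real n * w = 2 * R" and \<epsilon>: "0 \<le> \<epsilon>"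
    and p: "\<And>i j z. i < n \<Longrightarrow> j < n \<Longrightarrow> box_cell R w (i, j) z \<Longrightarrow> \<bar>f z - g (i, j)\<bar> \<le> \<epsilon>"
  shows "\<bar>(\<integral>\<omega>. f (X \<omega>) \<partial>M) - (\<Sum>ij\<in>{..<n}\<times>{..<n}. g ij * \<P>(\<omega> in M. box_cell R w ij (X \<omega>)))\<bar>
    \<le> \<epsilon> + B * (1 - \<P>(\<omega> in M. -R < fst (X \<omega>) \<and> fst (X \<omega>) \<le> R \<and> -R \<le> snd (X \<omega>) \<and> snd (X \<omega>) < R))"
proof -
  let ?box = "\<lambda>z. -R < fst z \<and> fst z \<le> R \<and> -R \<le> snd z \<and> snd z < (R::real)"
  have [measurable]: "(\<lambda>\<omega>. fst (X \<omega>)) \<in> borel_measurable M" "(\<lambda>\<omega>. snd (X \<omega>)) \<in> borel_measurable M"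
    using X by (auto simp: borel_prod[symmetric])
  have fX: "(\<lambda>\<omega>. f (X \<omega>)) \<in> borel_measurable M"
    using borel_measurable_continuous_onI[OF f] X by measurable
  have B0: "0 \<le> B" using B[of undefined] by simp
  have int: "integrable M (\<lambda>\<omega>. f (X \<omega>))"
    by (rule integrable_const_bound[where B=B]) (use B fX in auto)
  have cell: "{\<omega>\<in>space M. box_cell R w ij (X \<omega>)} \<in> events" for ij unfolding box_cell_def by measurable
  have bx: "{\<omega>\<in>space M. ?box (X \<omega>)} \<in> events" by measurable
  let ?F = "\<lambda>\<omega>. \<Sum>ij\<in>{..<n}\<times>{..<n}. g ij * indicator {\<omega>\<in>space M. box_cell R w ij (X \<omega>)} \<omega>"
  have intF: "integrable M ?F"
    using cell by (intro Bochner_Integration.integrable_sum integrable_mult_right integrable_real_indicator) (auto simp: emeasure_eq_measure)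
  have EF: "(\<integral>\<omega>. ?F \<omega> \<partial>M) = (\<Sum>ij\<in>{..<n}\<times>{..<n}. g ij * \<P>(\<omega> in M. box_cell R w ij (X \<omega>)))"
    using cell by (subst Bochner_Integration.integral_sum)
      (auto intro!: integrable_mult_right integrable_real_indicator simp: emeasure_eq_measure Int_absorb2 sets.sets_into_space)
  have ptw: "\<bar>f (X \<omega>) - ?F \<omega>\<bar> \<le> \<epsilon> + B * indicator (space M - {\<omega>\<in>space M. ?box (X \<omega>)}) \<omega>" if \<omega>: "\<omega> \<in> space M" for \<omega>
  proof (cases "?box (X \<omega>)")
    case True
    obtain i j where ij: "i < n" "j < n" "box_cell R w (i, j) (X \<omega>)"
      using box_cell_exists[OF w, of "X \<omega>"] True by blast
    have only: "box_cell R w k (X \<omega>) \<longleftrightarrow> k = (i, j)" for k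
      using box_cell_unique[OF w(1) ij(3), of k] ij(3) by metis
    have "?F \<omega> = (\<Sum>k\<in>{..<n}\<times>{..<n}. if k = (i, j) then g k else 0)"
      by (intro sum.cong refl) (simp add: only \<omega> indicator_def)
    also have "\<dots> = g (i, j)" using ij by (subst sum.delta) simp_all
    finally show ?thesis using p[OF ij] True \<omega> by (simp add: indicator_def)
  next
    case False
    have "\<not> box_cell R w ij (X \<omega>)" if "ij \<in> {..<n}\<times>{..<n}" for ij
    proof
      assume c: "box_cell R w ij (X \<omega>)"
      have "real (Suc (fst ij)) * w \<le> real n * w" "real (Suc (snd ij)) * w \<le> real n * w"
        "0 \<le> real (fst ij) * w" "0 \<le> real (snd ij) * w"
        using that w(1) by (auto simp del: of_nat_Suc)
      thus False using c False w(2) unfolding box_cell_def by linarith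
    qed
    hence "?F \<omega> = 0" by (intro sum.neutral) (auto simp: indicator_def)
    thus ?thesis using False \<omega> B[of "X \<omega>"] \<epsilon> by (simp add: indicator_def)
  qed
  have "\<bar>(\<integral>\<omega>. f (X \<omega>) \<partial>M) - (\<integral>\<omega>. ?F \<omega> \<partial>M)\<bar> = \<bar>\<integral>\<omega>. f (X \<omega>) - ?F \<omega> \<partial>M\<bar>"
    by (subst Bochner_Integration.integral_diff[OF int intF]) simp
  also have "\<dots> \<le> (\<integral>\<omega>. \<bar>f (X \<omega>) - ?F \<omega>\<bar> \<partial>M)" by (rule integral_abs_bound)
  also have "\<dots> \<le> (\<integral>\<omega>. \<epsilon> + B * indicator (space M - {\<omega>\<in>space M. ?box (X \<omega>)}) \<omega> \<partial>M)"
    using int intF bx ptw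
    by (intro integral_mono integrable_abs Bochner_Integration.integrable_diff Bochner_Integration.integrable_add
         integrable_mult_right integrable_real_indicator integrable_const) (auto simp: emeasure_eq_measure)
  also have "\<dots> = \<epsilon> + B * prob (space M - {\<omega>\<in>space M. ?box (X \<omega>)})"
    using bx by (subst Bochner_Integration.integral_add)
      (auto intro!: integrable_mult_right integrable_real_indicator simp: emeasure_eq_measure prob_space Int_absorb2)
  also have "prob (space M - {\<omega>\<in>space M. ?box (X \<omega>)}) = 1 - \<P>(\<omega> in M. ?box (X \<omega>))"
    by (rule prob_compl[OF bx])
  finally show ?thesis unfolding EF by simp
qed

lemma (in prob_space) box_exhausts:
  fixes X :: "'a \<Rightarrow> real \<times> real"
  assumes X: "X \<in> borel_measurable M"
  shows "(\<lambda>n. \<P>(\<omega> in M. - real n < fst (X \<omega>) \<and> fst (X \<omega>) \<le> real n \<and> - real n \<le> snd (X \<omega>) \<and> snd (X \<omega>) < real n))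
    \<longlonglongrightarrow> 1"
proof -
  have [measurable]: "(\<lambda>\<omega>. fst (X \<omega>)) \<in> borel_measurable M" "(\<lambda>\<omega>. snd (X \<omega>)) \<in> borel_measurable M"
    using X by (auto simp: borel_prod[symmetric])
  let ?A = "\<lambda>n. {\<omega>\<in>space M. - real n < fst (X \<omega>) \<and> fst (X \<omega>) \<le> real n \<and> - real n \<le> snd (X \<omega>) \<and> snd (X \<omega>) < real n}"
  have "(\<lambda>n. prob (?A n)) \<longlonglongrightarrow> prob (\<Union>n. ?A n)"
    by (rule finite_Lim_measure_incseq) (auto simp: incseq_def)
  moreover have "(\<Union>n. ?A n) = space M"
  proof (intro set_eqI iffI)
    fix \<omega> assume \<omega>: "\<omega> \<in> space M"
    obtain n :: nat where "\<bar>fst (X \<omega>)\<bar> + \<bar>snd (X \<omega>)\<bar> < real n" using reals_Archimedean2 by blast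
    hence "\<omega> \<in> ?A n" using \<omega> by auto
    thus "\<omega> \<in> (\<Union>n. ?A n)" by blast
  qed auto
  ultimately show ?thesis by (simp add: prob_space)
qed

text \<open>
Inclusion and exclusion turns convergence on quadrants into convergence on the cells of a grid. A box
that carries almost all of the limit law carries almost all of the approximating laws eventually, so
the family is tight, and on the box \<open>f\<close> is uniformly continuous. The choice \<open>\<epsilon> = e / 6\<close> leaves room
for two step approximations with error \<open>2 \<epsilon>\<close> each and the difference of the two step sums.
\<close>

lemma converges_in_distribution_of_quadrants:
  fixes X :: "'i \<Rightarrow> 'a \<Rightarrow> real \<times> real" and Y :: "'b \<Rightarrow> real \<times> real"
  assumes M: "prob_space M" and M': "prob_space M'"
    and X: "\<forall>\<^sub>F t in F. X t \<in> borel_measurable M" and Y: "Y \<in> borel_measurable M'"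
    and lim: "\<And>x y. ((\<lambda>t. measure M {\<omega>\<in>space M. fst (X t \<omega>) \<le> x \<and> snd (X t \<omega>) < y}) \<longlongrightarrow>
       measure M' {\<omega>\<in>space M'. fst (Y \<omega>) \<le> x \<and> snd (Y \<omega>) < y}) F"
  shows "converges_in_distribution M X F M' Y"
  unfolding converges_in_distribution_def
proof (intro conjI allI impI)
  interpret M: prob_space M by fact
  interpret M': prob_space M' by fact
  show "\<forall>\<^sub>F t in F. X t \<in> borel_measurable M" "Y \<in> borel_measurable M'" by (rule X Y)+
  fix f :: "real \<times> real \<Rightarrow> real" assume f: "continuous_on UNIV f" and bf: "bounded (range f)"
  obtain B where B: "0 < B" "\<And>z. \<bar>f z\<bar> \<le> B" using bf unfolding bounded_pos by auto
  have rect: "((\<lambda>t. \<P>(\<omega> in M. a < fst (X t \<omega>) \<and> fst (X t \<omega>) \<le> b \<and> c \<le> snd (X t \<omega>) \<and> snd (X t \<omega>) < d)) \<longlongrightarrow>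
    \<P>(\<omega> in M'. a < fst (Y \<omega>) \<and> fst (Y \<omega>) \<le> b \<and> c \<le> snd (Y \<omega>) \<and> snd (Y \<omega>) < d)) F" if "a \<le> b" "c \<le> d" for a b c d
    unfolding M'.prob_rectangle[OF Y that]
  proof (rule Lim_transform_eventually)
    show "\<forall>\<^sub>F t in F. \<P>(\<omega> in M. fst (X t \<omega>) \<le> b \<and> snd (X t \<omega>) < d) - \<P>(\<omega> in M. fst (X t \<omega>) \<le> a \<and> snd (X t \<omega>) < d)
    - (\<P>(\<omega> in M. fst (X t \<omega>) \<le> b \<and> snd (X t \<omega>) < c) - \<P>(\<omega> in M. fst (X t \<omega>) \<le> a \<and> snd (X t \<omega>) < c)) =
     \<P>(\<omega> in M. a < fst (X t \<omega>) \<and> fst (X t \<omega>) \<le> b \<and> c \<le> snd (X t \<omega>) \<and> snd (X t \<omega>) < d)"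
      using X by eventually_elim (rule M.prob_rectangle[OF _ that, symmetric])
  qed (intro tendsto_diff lim)
  show "((\<lambda>t. \<integral>\<omega>. f (X t \<omega>) \<partial>M) \<longlongrightarrow> (\<integral>\<omega>. f (Y \<omega>) \<partial>M')) F"
  proof (rule tendstoI)
    fix e :: real assume e: "0 < e"
    define \<epsilon> where "\<epsilon> = e / 6"
    have \<epsilon>: "0 < \<epsilon>" using e by (simp add: \<epsilon>_def)
    have "1 - \<epsilon> / B < 1" using \<epsilon> B by simp
    from order_tendstoD(1)[OF M'.box_exhausts[OF Y] this] eventually_gt_at_top[of 0]
    have "\<forall>\<^sub>F n in sequentially. 0 < n \<and> 1 - \<epsilon> / B < \<P>(\<omega> in M'. - real n < fst (Y \<omega>) \<and> fst (Y \<omega>) \<le> real n \<and> - real n \<le> snd (Y \<omega>) \<and> snd (Y \<omega>) < real n)"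
      by eventually_elim simp
    then obtain m :: nat where m: "0 < m" "1 - \<epsilon> / B < \<P>(\<omega> in M'. - real m < fst (Y \<omega>) \<and> fst (Y \<omega>) \<le> real m \<and> - real m \<le> snd (Y \<omega>) \<and> snd (Y \<omega>) < real m)"
      by (auto dest: eventually_happens)
    define R where "R = real m"
    have R: "0 < R" using m by (simp add: R_def)
    have "uniformly_continuous_on ({-R..R} \<times> {-R..R}) f"
      by (rule compact_uniformly_continuous[OF continuous_on_subset[OF f]]) (auto intro: compact_Times)
    then obtain \<delta> where \<delta>: "0 < \<delta>" "\<And>z z'. z \<in> {-R..R} \<times> {-R..R} \<Longrightarrow> z' \<in> {-R..R} \<times> {-R..R} \<Longrightarrow> dist z' z < \<delta> \<Longrightarrow> dist (f z') (f z) < \<epsilon>"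
      using \<epsilon> unfolding uniformly_continuous_on_def by meson
    obtain n :: nat where n: "4 * R / \<delta> < real n" using reals_Archimedean2 by blast
    have n0: "0 < real n" using n R \<delta> by (meson divide_pos_pos less_trans mult_pos_pos zero_less_numeral)
    define w where "w = 2 * R / real n"
    have w: "0 < w" "real n * w = 2 * R" "2 * w < \<delta>"
      using n n0 R \<delta> by (auto simp: w_def field_simps)
    define g where "g ij = f (-R + real (fst ij) * w, -R + real (snd ij) * w)" for ij
    have p: "\<bar>f z - g (i, j)\<bar> \<le> \<epsilon>" if "i < n" "j < n" "box_cell R w (i, j) z" for i j z
    proof -
      let ?z = "(-R + real i * w, -R + real j * w)"
      have *: "0 \<le> real i * w" "real (Suc i) * w \<le> real n * w" "0 \<le> real j * w" "real (Suc j) * w \<le> real n * w"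
        using that(1,2) w(1) by (auto simp del: of_nat_Suc)
      have s: "real (Suc k) * w = real k * w + w" for k by (simp add: distrib_right)
      have c: "- R + real i * w < fst z" "fst z \<le> - R + (real i * w + w)" "- R + real j * w \<le> snd z" "snd z < - R + (real j * w + w)"
        using that(3) unfolding box_cell_def fst_conv snd_conv s by blast+
      have iw: "real i * w + w \<le> 2 * R" "real j * w + w \<le> 2 * R" using *(2,4) unfolding s w(2) .
      have 1: "?z \<in> {-R..R} \<times> {-R..R}"
        unfolding mem_Times_iff atLeastAtMost_iff fst_conv snd_conv using *(1,3) iw w(1) by linarith
      have "fst z \<in> {-R..R}" "snd z \<in> {-R..R}"
        unfolding atLeastAtMost_iff using c *(1,3) iw w(1) by linarith+
      hence 2: "z \<in> {-R..R} \<times> {-R..R}" by (cases z) auto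
      have "dist z ?z \<le> dist (fst z) (fst ?z) + dist (snd z) (snd ?z)"
        unfolding dist_prod_def by (rule sqrt_sum_squares_le_sum) auto
      also have "\<dots> \<le> w + w" using c by (intro add_mono) (auto simp: dist_real_def)
      also have "\<dots> < \<delta>" using w by simp
      finally have "dist (f z) (f ?z) < \<epsilon>" by (rule \<delta>(2)[OF 1 2])
      thus ?thesis by (simp add: g_def dist_real_def)
    qed
    let ?box = "\<lambda>z. -R < fst z \<and> fst z \<le> R \<and> -R \<le> snd z \<and> snd z < (R::real)"
    let ?S = "\<lambda>t. \<Sum>ij\<in>{..<n}\<times>{..<n}. g ij * \<P>(\<omega> in M. box_cell R w ij (X t \<omega>))"
    let ?S' = "\<Sum>ij\<in>{..<n}\<times>{..<n}. g ij * \<P>(\<omega> in M'. box_cell R w ij (Y \<omega>))"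
    have "(?S \<longlongrightarrow> ?S') F"
      unfolding box_cell_def using w by (intro tendsto_sum tendsto_mult tendsto_const rect) auto
    hence 1: "\<forall>\<^sub>F t in F. \<bar>?S t - ?S'\<bar> < \<epsilon>" using \<epsilon> by (auto dest: tendstoD simp: dist_real_def)
    have 2: "\<forall>\<^sub>F t in F. 1 - \<epsilon> / B < \<P>(\<omega> in M. ?box (X t \<omega>))"
      using R m(2) by (intro order_tendstoD(1)[OF rect]) (auto simp: R_def)
    have small: "B * (1 - q) \<le> \<epsilon>" if "1 - \<epsilon> / B < q" for q
    proof -
      have "1 - q \<le> \<epsilon> / B" using that by simp
      hence "B * (1 - q) \<le> B * (\<epsilon> / B)" using B by (intro mult_left_mono) auto
      thus ?thesis using B by simp
    qed
    have Y1: "\<bar>(\<integral>\<omega>. f (Y \<omega>) \<partial>M') - ?S'\<bar> \<le> \<epsilon> + \<epsilon>"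
      using M'.expectation_step_approx[where g=g, OF Y f B(2) w(1,2) less_imp_le[OF \<epsilon>] p] small[OF m(2)] by (simp add: R_def)
    show "\<forall>\<^sub>F t in F. dist (\<integral>\<omega>. f (X t \<omega>) \<partial>M) (\<integral>\<omega>. f (Y \<omega>) \<partial>M') < e"
      using 1 2 X
    proof eventually_elim
      case (elim t)
      have "\<bar>(\<integral>\<omega>. f (X t \<omega>) \<partial>M) - ?S t\<bar> \<le> \<epsilon> + \<epsilon>"
        using M.expectation_step_approx[where g=g, OF elim(3) f B(2) w(1,2) less_imp_le[OF \<epsilon>] p] small[OF elim(2)] by simp
      hence "\<bar>(\<integral>\<omega>. f (X t \<omega>) \<partial>M) - (\<integral>\<omega>. f (Y \<omega>) \<partial>M')\<bar> < 6 * \<epsilon>"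
        using Y1 elim(1) \<epsilon> by linarith
      thus ?case by (simp add: dist_real_def \<epsilon>_def)
    qed
  qed
qed

section \<open>The limit theorem\<close>

text \<open>
The strict inequality is needed for the quadrants; a law with a density has no atoms.
\<close>

lemma (in prob_space) prob_exponential_less:
  assumes D: "distributed M lborel X (exponential_density l)" and l: "0 < l"
  shows "\<P>(\<omega> in M. X \<omega> < a) = (if 0 < a then 1 - exp (- (l * a)) else 0)"
proof -
  have [measurable]: "X \<in> borel_measurable M" using distributed_measurable[OF D] by simp
  have "emeasure M (X -` {a} \<inter> space M) = (\<integral>\<^sup>+x. ennreal (exponential_density l x) * indicator {a} x \<partial>lborel)"
    by (rule distributed_emeasure[OF D]) simp
  also have "\<dots> = 0"
    using AE_lborel_singleton[of a]
    by (subst nn_integral_0_iff_AE) (auto simp: indicator_def elim!: eventually_mono)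
  finally have "prob (X -` {a} \<inter> space M) = 0" by (simp add: measure_def)
  moreover have "{\<omega>\<in>space M. X \<omega> < a} = {\<omega>\<in>space M. X \<omega> \<le> a} - X -` {a} \<inter> space M" by auto
  ultimately have eq: "\<P>(\<omega> in M. X \<omega> < a) = \<P>(\<omega> in M. X \<omega> \<le> a)"
    by (simp, subst finite_measure_Diff) auto
  show ?thesis
  proof (cases "0 < a")
    case True
    thus ?thesis unfolding eq using exponential_distributedD_le[OF D, of a] l by (simp add: mult.commute)
  next
    case False
    have "\<P>(\<omega> in M. X \<omega> \<le> a) \<le> \<P>(\<omega> in M. X \<omega> \<le> 0)"
      using False by (intro finite_measure_mono) auto
    also have "\<dots> = 0" using exponential_distributedD_le[OF D, of 0] l by simp
    finally show ?thesis unfolding eq using False by (simp add: antisym)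
  qed
qed

theorem theorem1p1:
  fixes M :: "'a measure" and N :: "real \<Rightarrow> 'a \<Rightarrow> nat"
    and M' :: "'b measure" and G E :: "'b \<Rightarrow> real"
    and \<alpha> \<kappa> :: real and rate b :: "real \<Rightarrow> real"
  assumes "0 < \<alpha>" "\<alpha> < 1" "0 < \<kappa>"
    and "rate = (\<lambda>t. \<kappa> * t powr (\<alpha> - 1))"
    and "b = (\<lambda>t. \<alpha> * ln t - ln (ln t) - ln (\<alpha> * (1 - \<alpha>) / \<kappa>))"
    and "inhomogeneous_poisson_process M N rate"
    and "prob_space M'"
    and "prob_space.indep_var M' borel G borel E"
    and "\<And>x. measure M' {\<omega>\<in>space M'. G \<omega> \<le> x} = exp (- exp (- x))"
    and "distributed M' lborel E (exponential_density (\<alpha> * (1 - \<alpha>)))"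
  shows "converges_in_distribution M
           (\<lambda>t \<omega>. (rate t * longest_gap N t \<omega> - b t,
                   (t - longest_gap_end N t \<omega>) / t * ln t))
           at_top M' (\<lambda>\<omega>. (G \<omega>, E \<omega>))"
proof -
  have pr: "power_rate \<alpha> \<kappa>" using assms by unfold_locales
  have rate: "rate = power_rate.rate \<alpha> \<kappa>"
    using assms(4) by (simp add: fun_eq_iff power_rate.rate_def[OF pr])
  have b: "b = power_rate.centering \<alpha> \<kappa>"
    using assms(5) by (simp add: fun_eq_iff power_rate.centering_def[OF pr])
  have ps: "prob_space M" using assms(6) by (simp add: inhomogeneous_poisson_process_def)
  interpret power_rate_poisson \<alpha> \<kappa> M N
    using pr ps assms(6) unfolding rate by (intro power_rate_poisson.intro power_rate_poisson_axioms.intro)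
  interpret M': prob_space M' by fact
  have stats: "(rate t * longest_gap N t \<omega> - b t, (t - longest_gap_end N t \<omega>) / t * ln t)
      = (gap_stat t \<omega>, end_stat t \<omega>)" for t \<omega>
    by (simp add: rate b gap_stat_def end_stat_def)
  have GE: "G \<in> borel_measurable M'" "E \<in> borel_measurable M'"
    using M'.indep_var_rv1[OF assms(8)] M'.indep_var_rv2[OF assms(8)] by auto
  have c: "0 < \<alpha> * (1 - \<alpha>)" using assms by simp
  have limit_law: "measure M' {\<omega>\<in>space M'. G \<omega> \<le> x \<and> E \<omega> < y}
      = exp (- exp (- x)) * (if 0 < y then 1 - exp (- (\<alpha> * (1 - \<alpha>) * y)) else 0)" for x y
    using M'.prob_indep_random_variable[OF assms(8), of "{..x}" "{..<y}"]
      M'.prob_exponential_less[OF assms(10) c, of y] assms(9)[of x] by simp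
  show ?thesis unfolding stats
  proof (rule converges_in_distribution_of_quadrants[OF ps assms(7)])
    show "\<forall>\<^sub>F t in at_top. (\<lambda>\<omega>. (gap_stat t \<omega>, end_stat t \<omega>)) \<in> borel_measurable M"
      using eventually_ge_at_top[of 0]
      by eventually_elim (intro borel_measurable_Pair stats_measurable)
    show "(\<lambda>\<omega>. (G \<omega>, E \<omega>)) \<in> borel_measurable M'" by (intro borel_measurable_Pair GE)
    show "((\<lambda>t. \<P>(\<omega> in M. fst (gap_stat t \<omega>, end_stat t \<omega>) \<le> x \<and> snd (gap_stat t \<omega>, end_stat t \<omega>) < y)) \<longlongrightarrow>
        measure M' {\<omega>\<in>space M'. fst (G \<omega>, E \<omega>) \<le> x \<and> snd (G \<omega>, E \<omega>) < y}) at_top" for x y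
      using rectangle_limit[of x y] by (simp add: limit_law)
  qed
qed

end
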